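(* Let $T,N\in\mathbb N$, $\ell_1,\dots,\ell_T>0$, and let $\boldsymbol\pi_{T,D}=\pi_T^{\otimes D}$ be as in the context. Assume that for every $t\in[T]$: $\bar w_t=\log G_t+\log m_t$ is twice continuously differentiable; $\partial_t^2\bar w_t$, $\partial_t^2\bar w_{t+1}$ and $\partial_t\partial_{t+1}\bar w_{t+1}$ are Lipschitz-continuous and bounded; and $\pi_T(|\partial_t\bar w_t|^4)<\infty$, $\pi_T(|\partial_t\bar w_{t+1}|^4)<\infty$ (with $\bar w_{T+1}\equiv0$). For each version of the i-RW-CSMC algorithm (with or without backward sampling, with or without forced move), let $\bar d^N_{T,D,\mathbf x_{1:T}}$ be the total variation distance between the law of $(A_{1:T-1},K_{1:T})$ under one i-RW-CSMC update started from $\mathbf x_{1:T}\in(\mathbb R^D)^T$ and the law of $(A_{1:T-1},K_{1:T})$ under the corresponding version of the limiting law $\overline{\mathbb P}^N_T$. Then there exists a family of Borel sets $\mathbf F_{T,D}\subseteq(\mathbb R^D)^T$, $D\ge1$, with $\lim_{D\to\infty}\boldsymbol\pi_{T,D}(\mathbf F_{T,D})=1$ and $$\lim_{D\to\infty}\ \sup_{\mathbf x_{1:T}\in\mathbf F_{T,D}}\bar d^N_{T,D,\mathbf x_{1:T}}=0 .$$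
   Context: Notation: $[n]=\{1,\dots,n\}$, $[n]_0=\{0,\dots,n\}$; $\partial_t$ is the derivative with respect to $x_t$; $\pi_T(\varphi)=\int\varphi\,\pi_T$; $\mathbf 1_N$ is the all-ones vector, $I_N$ the identity. Quantities with time index $0$ are ignored. Model. $M_1$ is a probability measure on $\mathbb R$ with Lebesgue density $m_1$; for $t\ge2$, $M_t$ is a Markov kernel on $\mathbb R$ with transition density $m_t(x,y)$; $G_t:\mathbb R\to(0,\infty)$ is measurable. $\pi_T(x_{1:T})\propto m_1(x_1)G_1(x_1)\prod_{t=2}^T m_t(x_{t-1},x_t)G_t(x_t)$ is a probability density on $\mathbb R^T$. $\bar w_t(x_{t-1},x_t)=\log G_t(x_t)+\log m_t(x_{t-1},x_t)$ (a function of $x_1$ only if $t=1$), $\bar w_{T+1}\equiv0$. For $D\in\mathbb N$ and $\mathbf x_t=(x_{t,1},\dots,x_{t,D})\in\mathbb R^D$: $\mathbf m_t(\mathbf x_{t-1},\mathbf x_t)=\prod_d m_t(x_{t-1,d},x_{t,d})$, $\mathbf G_t(\mathbf x_t)=\prod_d G_t(x_{t,d})$, and the target $\boldsymbol\pi_{T,D}$ on $(\mathbb R^D)^T$ has density $\prod_{d=1}^D\pi_T(x_{1,d},\dots,x_{T,d})$. Selection functions. For $h^{1:N}\in\mathbb R^N$, $h^0:=0$: $\Psi^n(\{h^m\}_{m=1}^N)=\frac{e^{h^n}}{1+\sum_{m=1}^N e^{h^m}}$ for $n\in[N]_0$; $\Phi^n(\{h^m\}_{m=1}^N)=\frac{e^{h^n}}{1-1\wedge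 e^{h^n}+\sum_{m=1}^N e^{h^m}}$ for $n\in[N]$, $\Phi^0=1-\sum_{n=1}^N\Phi^n$. Let $\Sigma=\tfrac12(I_N+\mathbf 1_N\mathbf 1_N^{\mathsf T})$. One i-RW-CSMC update from $\mathbf x_{1:T}$. Particles: $\mathbf Z_t^0=\mathbf x_t$; independently over $(t,d)$ sample $U_{t,d}^{1:N}\sim\mathrm N(0,\Sigma)$ and set $Z_{t,d}^n=x_{t,d}+\sqrt{\ell_t/D}\,U_{t,d}^n$, $\mathbf Z_t^n=(Z_{t,d}^n)_{d\in[D]}$, $n\in[N]$. Ancestors: for $t=1,\dots,T-1$ set $A_t^0=0$ and, conditionally independently for $n\in[N]$, sample $A_t^n=l\in[N]_0$ with probability proportional to $\omega_t^l:=\mathbf m_t(\mathbf Z_{t-1}^{A_{t-1}^l},\mathbf Z_t^l)\mathbf G_t(\mathbf Z_t^l)$. Define $\omega_T^l$ in the same way and sample $K_T=k\in[N]_0$ with probability $\Psi^k(\{\log\omega_T^m-\log\omega_T^0\}_{m=1}^N)=\omega_T^k/\sum_{m=0}^N\omega_T^m$ (forced move: replace $\Psi^k$ by $\Phi^k$). For $t=T-1,\dots,1$: without backward sampling set $K_t=A_t^{K_{t+1}}$; with backward sampling sample $K_t=k\in[N]_0$ with probability proportional to $\omega_t^k\,\mathbf m_{t+1}(\mathbf Z_t^k,\mathbf Z_{t+1}^{K_{t+1}})$. New state: $(\mathbf Z_1^{K_1},\dots,\mathbf Z_T^{K_T})$. Limiting law $\overline{\mathbb P}^N_T$. (1) Independently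 over $t\in[T]$ sample the Gaussian vector $(V_t,W_t)$, $V_t=V_t^{1:N}$, $W_t=W_t^{1:N}$, with means $\mathbb E V_t=\tfrac12\ell_t\pi_T(\partial_t^2\bar w_t)\mathbf 1_N$, $\mathbb E W_t=\tfrac12\ell_t\pi_T(\partial_t^2\bar w_{t+1})\mathbf 1_N$ and covariances $\mathrm{var}(V_t)=\ell_t\pi_T([\partial_t\bar w_t]^2)\Sigma$, $\mathrm{var}(W_t)=\ell_t\pi_T([\partial_t\bar w_{t+1}]^2)\Sigma$, $\mathrm{cov}(V_t,W_t)=\ell_t\pi_T([\partial_t\bar w_t][\partial_t\bar w_{t+1}])\Sigma$; put $V_t^0=W_t^0=0$ and $W_0^n=0$. (2) For $t=1,\dots,T-1$ set $A_t^0=0$ and, conditionally independently for $n\in[N]$, sample $A_t^n=l\in[N]_0$ with probability $\Psi^l(\{V_t^m+W_{t-1}^{A_{t-1}^m}\}_{m=1}^N)$. (3) Sample $K_T=k$ with probability $\Psi^k(\{V_T^m+W_{T-1}^{A_{T-1}^m}\}_{m=1}^N)$ (forced move: $\Phi^k$ instead). (4) For $t=T-1,\dots,1$: without backward sampling $K_t=A_t^{K_{t+1}}$; with backward sampling sample $K_t=k\in[N]_0$ with probability $\Psi^k(\{V_t^m+W_t^m+W_{t-1}^{A_{t-1}^m}\}_{m=1}^N)$. *)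

theory Defs
  imports "HOL-Probability.Probability"
begin

record csmc_model =
  dens1 :: "real \<Rightarrow> real"
  dens :: "nat \<Rightarrow> real \<Rightarrow> real \<Rightarrow> real"
  pot :: "nat \<Rightarrow> real \<Rightarrow> real"

text \<open>
  For \<open>t = 1\<close> the first argument is ignored. Thus the formulas below may mention a state at
  time \<open>0\<close>, whose value is irrelevant.
\<close>

definition mdens :: "csmc_model \<Rightarrow> nat \<Rightarrow> real \<Rightarrow> real \<Rightarrow> real" where
  "mdens M t x y = (if t = 1 then dens1 M y else dens M t x y)"

definition csmc_model_ok :: "nat \<Rightarrow> csmc_model \<Rightarrow> bool" where
  "csmc_model_ok T M \<longleftrightarrow>
     (\<forall>x. dens1 M x \<ge> 0) \<and> dens1 M \<in> borel_measurable borel \<and>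
     prob_space (density lborel (\<lambda>x. ennreal (dens1 M x))) \<and>
     (\<forall>t\<in>{2..T}. (\<forall>x y. dens M t x y \<ge> 0) \<and>
        (\<lambda>(x, y). dens M t x y) \<in> borel_measurable (borel \<Otimes>\<^sub>M borel) \<and>
        (\<forall>x. prob_space (density lborel (\<lambda>y. ennreal (dens M t x y))))) \<and>
     (\<forall>t\<in>{1..T}. (\<forall>x. pot M t x > 0) \<and> pot M t \<in> borel_measurable borel)"

text \<open>Points of \<open>\<real>\<^sup>T\<close> are functions on \<open>{1..T}\<close>; points of \<open>(\<real>\<^sup>D)\<^sup>T\<close> are curried functions
  of \<open>t \<in> {1..T}\<close> and \<open>d \<in> {1..D}\<close>.\<close>

definition path_weight :: "nat \<Rightarrow> csmc_model \<Rightarrow> (nat \<Rightarrow> real) \<Rightarrow> real" where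
  "path_weight T M x = (\<Prod>t=1..T. mdens M t (x (t - 1)) (x t) * pot M t (x t))"

definition target_dens :: "nat \<Rightarrow> csmc_model \<Rightarrow> (nat \<Rightarrow> real) \<Rightarrow> real" where
  "target_dens T M x =
     path_weight T M x / (\<integral>z. path_weight T M z \<partial>(\<Pi>\<^sub>M t\<in>{1..T}. lborel))"

definition target :: "nat \<Rightarrow> csmc_model \<Rightarrow> (nat \<Rightarrow> real) measure" where
  "target T M = density (\<Pi>\<^sub>M t\<in>{1..T}. lborel) (\<lambda>x. ennreal (target_dens T M x))"

definition target_D :: "nat \<Rightarrow> nat \<Rightarrow> csmc_model \<Rightarrow> (nat \<Rightarrow> nat \<Rightarrow> real) measure" where
  "target_D T D M = density (\<Pi>\<^sub>M t\<in>{1..T}. \<Pi>\<^sub>M d\<in>{1..D}. lborel)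
     (\<lambda>x. ennreal (\<Prod>d=1..D. target_dens T M (\<lambda>t. x t d)))"

definition wbar :: "nat \<Rightarrow> csmc_model \<Rightarrow> nat \<Rightarrow> real \<Rightarrow> real \<Rightarrow> real" where
  "wbar T M t x y = (if t = T + 1 then 0 else ln (pot M t y) + ln (mdens M t x y))"

definition twice_cont_diff :: "('a::real_normed_vector \<Rightarrow> real) \<Rightarrow> bool" where
  "twice_cont_diff f \<longleftrightarrow>
     (\<exists>(f' :: 'a \<Rightarrow> 'a \<Rightarrow>\<^sub>L real) (f'' :: 'a \<Rightarrow> 'a \<Rightarrow>\<^sub>L 'a \<Rightarrow>\<^sub>L real).
        (\<forall>z. (f has_derivative blinfun_apply (f' z)) (at z)) \<and>
        (\<forall>z. (f' has_derivative blinfun_apply (f'' z)) (at z)) \<and>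
        continuous_on UNIV f'')"

text \<open>For \<open>f = wbar T M t\<close>, the derivatives in the first and second argument are the ones
  with respect to \<open>x\<^bsub>t-1\<^esub>\<close> and \<open>x\<^sub>t\<close>.\<close>

definition partial1 :: "(real \<Rightarrow> real \<Rightarrow> real) \<Rightarrow> real \<Rightarrow> real \<Rightarrow> real" where
  "partial1 f x y = deriv (\<lambda>x'. f x' y) x"

definition partial2 :: "(real \<Rightarrow> real \<Rightarrow> real) \<Rightarrow> real \<Rightarrow> real \<Rightarrow> real" where
  "partial2 f x y = deriv (\<lambda>y'. f x y') y"

definition lipschitz_bounded :: "(real \<Rightarrow> real \<Rightarrow> real) \<Rightarrow> bool" where
  "lipschitz_bounded f \<longleftrightarrow>
     (\<exists>C. C-lipschitz_on UNIV (\<lambda>(x, y). f x y)) \<and> bounded (range (\<lambda>(x, y). f x y))"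

text \<open>Covariances may be singular, so there need not be a Lebesgue density.\<close>

definition normal_law :: "real \<Rightarrow> real \<Rightarrow> real measure" where
  "normal_law \<mu> v =
     (if v = 0 then return borel \<mu>
      else density lborel (\<lambda>x. ennreal (normal_density \<mu> (sqrt v) x)))"

definition is_gaussian_law ::
  "'i set \<Rightarrow> ('i \<Rightarrow> real) \<Rightarrow> ('i \<Rightarrow> 'i \<Rightarrow> real) \<Rightarrow> ('i \<Rightarrow> real) measure \<Rightarrow> bool" where
  "is_gaussian_law I \<mu> C P \<longleftrightarrow>
     sets P = sets (\<Pi>\<^sub>M i\<in>I. borel) \<and>
     (\<forall>\<theta>. distr P borel (\<lambda>x. \<Sum>i\<in>I. \<theta> i * x i) =
        normal_law (\<Sum>i\<in>I. \<theta> i * \<mu> i) (\<Sum>i\<in>I. \<Sum>j\<in>I. \<theta> i * C i j * \<theta> j))"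

text \<open>For finite \<open>I\<close> and positive semidefinite \<open>C\<close> (the only case used) such a law exists, and it is
  unique by the Cramer-Wold theorem.\<close>

definition gaussian_law ::
  "'i set \<Rightarrow> ('i \<Rightarrow> real) \<Rightarrow> ('i \<Rightarrow> 'i \<Rightarrow> real) \<Rightarrow> ('i \<Rightarrow> real) measure" where
  "gaussian_law I \<mu> C = (SOME P. is_gaussian_law I \<mu> C P)"

definition Sigma_cov :: "nat \<Rightarrow> nat \<Rightarrow> real" where
  "Sigma_cov n m = ((if n = m then 1 else 0) + 1) / 2"

text \<open>Only \<open>h 1, \<dots>, h N\<close> matter; \<open>h(0 := 0)\<close> implements the convention \<open>h\<^sup>0 = 0\<close>.\<close>

definition Psi :: "nat \<Rightarrow> (nat \<Rightarrow> real) \<Rightarrow> nat \<Rightarrow> real" where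
  "Psi N h n = exp ((h(0 := 0)) n) / (1 + (\<Sum>m=1..N. exp (h m)))"

definition Phi_pos :: "nat \<Rightarrow> (nat \<Rightarrow> real) \<Rightarrow> nat \<Rightarrow> real" where
  "Phi_pos N h n = exp (h n) / (1 - min 1 (exp (h n)) + (\<Sum>m=1..N. exp (h m)))"

definition Phi :: "nat \<Rightarrow> (nat \<Rightarrow> real) \<Rightarrow> nat \<Rightarrow> real" where
  "Phi N h n = (if n = 0 then 1 - (\<Sum>k=1..N. Phi_pos N h k) else Phi_pos N h n)"

definition index_pmf :: "nat \<Rightarrow> (nat \<Rightarrow> real) \<Rightarrow> nat pmf" where
  "index_pmf N p = embed_pmf (\<lambda>n. if n \<le> N then p n else 0)"

definition categorical_pmf :: "nat \<Rightarrow> (nat \<Rightarrow> real) \<Rightarrow> nat pmf" where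
  "categorical_pmf N \<omega> = index_pmf N (\<lambda>n. \<omega> n / (\<Sum>m=0..N. \<omega> m))"

text \<open>Selection of \<open>K\<^sub>T\<close>, with (\<open>fm\<close>) or without forced move.\<close>

definition final_pmf :: "bool \<Rightarrow> nat \<Rightarrow> (nat \<Rightarrow> real) \<Rightarrow> nat pmf" where
  "final_pmf fm N h = index_pmf N (if fm then Phi N h else Psi N h)"

text \<open>
  The algorithm and its limit generate \<open>(A\<^bsub>1:T-1\<^esub>, K\<^bsub>1:T\<^esub>)\<close> by the same scheme, and differ only in
  the following distributions on \<open>{0..N}\<close>, in which \<open>a\<close> stands for \<open>A\<^bsub>t-1\<^esub>\<close>:
  \<open>R t a\<close> for each \<open>A\<^sub>t\<^sup>n\<close>, \<open>S a\<close> for \<open>K\<^sub>T\<close> (with \<open>t = T\<close>), and \<open>B t a k\<close> for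
  \<open>K\<^sub>t\<close> given \<open>K\<^bsub>t+1\<^esub> = k\<close> under backward sampling.

  \<open>A t n\<close> and \<open>K t\<close> are \<open>0\<close> outside of the index ranges \<open>t \<in> {1..T-1}\<close>, \<open>n \<in> {1..N}\<close> and
  \<open>t \<in> {1..T}\<close>, respectively; in particular \<open>A t 0 = 0\<close>, as required.
\<close>

primrec ancestor_pmf ::
  "nat \<Rightarrow> (nat \<Rightarrow> (nat \<Rightarrow> nat) \<Rightarrow> nat pmf) \<Rightarrow> nat \<Rightarrow> (nat \<Rightarrow> nat \<Rightarrow> nat) pmf" where
  "ancestor_pmf N R 0 = return_pmf (\<lambda>_ _. 0)"
| "ancestor_pmf N R (Suc t) =
     do {
       A \<leftarrow> ancestor_pmf N R t;
       a \<leftarrow> Pi_pmf {1..N} 0 (\<lambda>_. R (Suc t) (A t));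
       return_pmf (A(Suc t := a))
     }"

text \<open>After \<open>j\<close> backward steps, \<open>K\<^sub>T, \<dots>, K\<^bsub>T-j\<^esub>\<close> have been sampled.\<close>

primrec backward_pmf ::
  "bool \<Rightarrow> nat \<Rightarrow> ((nat \<Rightarrow> nat) \<Rightarrow> nat pmf) \<Rightarrow> (nat \<Rightarrow> (nat \<Rightarrow> nat) \<Rightarrow> nat \<Rightarrow> nat pmf) \<Rightarrow>
   (nat \<Rightarrow> nat \<Rightarrow> nat) \<Rightarrow> nat \<Rightarrow> (nat \<Rightarrow> nat) pmf" where
  "backward_pmf bs T S B A 0 = map_pmf (\<lambda>k. (\<lambda>_. 0)(T := k)) (S (A (T - 1)))"
| "backward_pmf bs T S B A (Suc j) =
     do {
       K \<leftarrow> backward_pmf bs T S B A j;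
       let t = T - Suc j;
       k \<leftarrow> (if bs then B t (A (t - 1)) (K (t + 1)) else return_pmf (A t (K (t + 1))));
       return_pmf (K(t := k))
     }"

definition indices_pmf ::
  "bool \<Rightarrow> nat \<Rightarrow> nat \<Rightarrow> (nat \<Rightarrow> (nat \<Rightarrow> nat) \<Rightarrow> nat pmf) \<Rightarrow> ((nat \<Rightarrow> nat) \<Rightarrow> nat pmf) \<Rightarrow>
   (nat \<Rightarrow> (nat \<Rightarrow> nat) \<Rightarrow> nat \<Rightarrow> nat pmf) \<Rightarrow> ((nat \<Rightarrow> nat \<Rightarrow> nat) \<times> (nat \<Rightarrow> nat)) pmf" where
  "indices_pmf bs T N R S B =
     do {
       A \<leftarrow> ancestor_pmf N R (T - 1);
       K \<leftarrow> backward_pmf bs T S B A (T - 1);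
       return_pmf (A, K)
     }"

definition noise_law :: "nat \<Rightarrow> nat \<Rightarrow> nat \<Rightarrow> (nat \<times> nat \<Rightarrow> nat \<Rightarrow> real) measure" where
  "noise_law T N D =
     (\<Pi>\<^sub>M td\<in>{1..T} \<times> {1..D}. gaussian_law {1..N} (\<lambda>_. 0) Sigma_cov)"

definition particle ::
  "nat \<Rightarrow> (nat \<Rightarrow> real) \<Rightarrow> (nat \<Rightarrow> nat \<Rightarrow> real) \<Rightarrow> (nat \<times> nat \<Rightarrow> nat \<Rightarrow> real) \<Rightarrow>
   nat \<Rightarrow> nat \<Rightarrow> nat \<Rightarrow> real" where
  "particle D ell x u t n d =
     (if n = 0 then x t d else x t d + sqrt (ell t / real D) * u (t, d) n)"

definition mdens_D :: "nat \<Rightarrow> csmc_model \<Rightarrow> nat \<Rightarrow> (nat \<Rightarrow> real) \<Rightarrow> (nat \<Rightarrow> real) \<Rightarrow> real" where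
  "mdens_D D M t x y = (\<Prod>d=1..D. mdens M t (x d) (y d))"

definition pot_D :: "nat \<Rightarrow> csmc_model \<Rightarrow> nat \<Rightarrow> (nat \<Rightarrow> real) \<Rightarrow> real" where
  "pot_D D M t x = (\<Prod>d=1..D. pot M t (x d))"

definition particle_weight ::
  "nat \<Rightarrow> csmc_model \<Rightarrow> (nat \<Rightarrow> nat \<Rightarrow> nat \<Rightarrow> real) \<Rightarrow> nat \<Rightarrow> (nat \<Rightarrow> nat) \<Rightarrow> nat \<Rightarrow> real" where
  "particle_weight D M Z t a l = mdens_D D M t (Z (t - 1) (a l)) (Z t l) * pot_D D M t (Z t l)"

definition csmc_indices_pmf ::
  "bool \<Rightarrow> bool \<Rightarrow> nat \<Rightarrow> nat \<Rightarrow> nat \<Rightarrow> csmc_model \<Rightarrow> (nat \<Rightarrow> nat \<Rightarrow> nat \<Rightarrow> real) \<Rightarrow>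
   ((nat \<Rightarrow> nat \<Rightarrow> nat) \<times> (nat \<Rightarrow> nat)) pmf" where
  "csmc_indices_pmf bs fm T N D M Z = indices_pmf bs T N
     (\<lambda>t a. categorical_pmf N (particle_weight D M Z t a))
     (\<lambda>a. final_pmf fm N
        (\<lambda>l. ln (particle_weight D M Z T a l) - ln (particle_weight D M Z T a 0)))
     (\<lambda>t a k. categorical_pmf N
        (\<lambda>l. particle_weight D M Z t a l * mdens_D D M (t + 1) (Z t l) (Z (t + 1) k)))"

definition irwcsmc_law ::
  "bool \<Rightarrow> bool \<Rightarrow> nat \<Rightarrow> nat \<Rightarrow> nat \<Rightarrow> csmc_model \<Rightarrow> (nat \<Rightarrow> real) \<Rightarrow> (nat \<Rightarrow> nat \<Rightarrow> real) \<Rightarrow>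
   ((nat \<Rightarrow> nat \<Rightarrow> nat) \<times> (nat \<Rightarrow> nat)) measure" where
  "irwcsmc_law bs fm T N D M ell x =
     noise_law T N D \<bind>
       (\<lambda>u. measure_pmf (csmc_indices_pmf bs fm T N D M (particle D ell x u)))"

text \<open>\<open>\<pi>\<^sub>T(\<phi>)\<close> for a function \<open>\<phi>\<close> of \<open>(x\<^bsub>t-1\<^esub>, x\<^sub>t)\<close>\<close>

definition target_mean :: "nat \<Rightarrow> csmc_model \<Rightarrow> nat \<Rightarrow> (real \<Rightarrow> real \<Rightarrow> real) \<Rightarrow> real" where
  "target_mean T M t \<phi> = (\<integral>x. \<phi> (x (t - 1)) (x t) \<partial>target T M)"

text \<open>\<open>Inl n\<close> and \<open>Inr n\<close> are the indices of \<open>V\<^sub>t\<^sup>n\<close> and \<open>W\<^sub>t\<^sup>n\<close>.\<close>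

definition VW_mean :: "nat \<Rightarrow> csmc_model \<Rightarrow> (nat \<Rightarrow> real) \<Rightarrow> nat \<Rightarrow> nat + nat \<Rightarrow> real" where
  "VW_mean T M ell t i = (case i of
     Inl n \<Rightarrow> 1/2 * ell t * target_mean T M t (partial2 (partial2 (wbar T M t)))
   | Inr n \<Rightarrow> 1/2 * ell t * target_mean T M (t + 1) (partial1 (partial1 (wbar T M (t + 1)))))"

definition VW_cross :: "nat \<Rightarrow> csmc_model \<Rightarrow> nat \<Rightarrow> real" where
  "VW_cross T M t =
     (\<integral>x. partial2 (wbar T M t) (x (t - 1)) (x t) *
          partial1 (wbar T M (t + 1)) (x t) (x (t + 1)) \<partial>target T M)"

definition VW_cov ::
  "nat \<Rightarrow> csmc_model \<Rightarrow> (nat \<Rightarrow> real) \<Rightarrow> nat \<Rightarrow> nat + nat \<Rightarrow> nat + nat \<Rightarrow> real" where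
  "VW_cov T M ell t i j = (case (i, j) of
     (Inl n, Inl m) \<Rightarrow>
       ell t * target_mean T M t (\<lambda>x y. (partial2 (wbar T M t) x y)\<^sup>2) * Sigma_cov n m
   | (Inr n, Inr m) \<Rightarrow>
       ell t * target_mean T M (t + 1) (\<lambda>x y. (partial1 (wbar T M (t + 1)) x y)\<^sup>2) * Sigma_cov n m
   | (Inl n, Inr m) \<Rightarrow> ell t * VW_cross T M t * Sigma_cov n m
   | (Inr n, Inl m) \<Rightarrow> ell t * VW_cross T M t * Sigma_cov n m)"

definition VW_law ::
  "nat \<Rightarrow> nat \<Rightarrow> csmc_model \<Rightarrow> (nat \<Rightarrow> real) \<Rightarrow> (nat \<Rightarrow> nat + nat \<Rightarrow> real) measure" where
  "VW_law T N M ell =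
     (\<Pi>\<^sub>M t\<in>{1..T}. gaussian_law ({1..N} <+> {1..N}) (VW_mean T M ell t) (VW_cov T M ell t))"

definition Vpart :: "(nat \<Rightarrow> nat + nat \<Rightarrow> real) \<Rightarrow> nat \<Rightarrow> nat \<Rightarrow> real" where
  "Vpart vw t n = (if n = 0 then 0 else vw t (Inl n))"

definition Wpart :: "(nat \<Rightarrow> nat + nat \<Rightarrow> real) \<Rightarrow> nat \<Rightarrow> nat \<Rightarrow> real" where
  "Wpart vw t n = (if t = 0 \<or> n = 0 then 0 else vw t (Inr n))"

definition limit_indices_pmf ::
  "bool \<Rightarrow> bool \<Rightarrow> nat \<Rightarrow> nat \<Rightarrow> (nat \<Rightarrow> nat + nat \<Rightarrow> real) \<Rightarrow>
   ((nat \<Rightarrow> nat \<Rightarrow> nat) \<times> (nat \<Rightarrow> nat)) pmf" where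
  "limit_indices_pmf bs fm T N vw = indices_pmf bs T N
     (\<lambda>t a. index_pmf N (Psi N (\<lambda>m. Vpart vw t m + Wpart vw (t - 1) (a m))))
     (\<lambda>a. final_pmf fm N (\<lambda>m. Vpart vw T m + Wpart vw (T - 1) (a m)))
     (\<lambda>t a k. index_pmf N
        (Psi N (\<lambda>m. Vpart vw t m + Wpart vw t m + Wpart vw (t - 1) (a m))))"

definition limit_law ::
  "bool \<Rightarrow> bool \<Rightarrow> nat \<Rightarrow> nat \<Rightarrow> csmc_model \<Rightarrow> (nat \<Rightarrow> real) \<Rightarrow>
   ((nat \<Rightarrow> nat \<Rightarrow> nat) \<times> (nat \<Rightarrow> nat)) measure" where
  "limit_law bs fm T N M ell =
     VW_law T N M ell \<bind> (\<lambda>vw. measure_pmf (limit_indices_pmf bs fm T N vw))"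

definition tv_dist :: "'a measure \<Rightarrow> 'a measure \<Rightarrow> real" where
  "tv_dist P Q = (SUP E\<in>sets P. \<bar>measure P E - measure Q E\<bar>)"

end

theory Submission
  imports Defs
begin

text \<open>
  Expand \<open>log \<omega>\<^sub>t\<close> to second order around the current state. Given the state, the first-order terms are
  exactly Gaussian, because the proposals are, so no central limit theorem is needed. The second-order
  terms concentrate around empirical averages over the \<open>D\<close> coordinates, with an error of order
  \<open>D\<^sup>-\<^sup>1\<^sup>/\<^sup>2\<close> in \<open>L\<^sup>1\<close> that is uniform in the state, because second derivatives are bounded and Lipschitz.
  The covariances of the first-order terms are empirical averages, too. On the sets of states for which
  these averages are close to their means under the target (weak law of large numbers), the two
  Gaussian vectors are coupled through square roots of their covariance matrices, which depend
  continuously on the matrices even at singular ones. Finally, the probability of each value of the indices is a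
  Lipschitz function of the log-weights.

  The law \<open>gaussian_law\<close> is chosen by its one-dimensional projections only, so identifying it requires
  the uniqueness theorem for characteristic functions on \<open>\<real>\<^sup>n\<close>, which is deduced from the one-dimensional one.
\<close>

section \<open>Uniqueness of multivariate characteristic functions\<close>

text \<open>The limiting Gaussian vectors may be degenerate (\<open>W\<close> at time
  \<open>T\<close> is always zero), so the Gaussian laws themselves need not converge in total
  variation. Only their effect on the indices is compared: these range over a finite set, each of
  their point probabilities is the expectation of a Lipschitz function of the log-weights, and
  closeness in mean of coupled log-weights suffices. To couple vectors driven by
  \<open>D\<close>-dimensional noise with vectors given only by their law, both are rewritten,
  without error, as linear images of the same two-dimensional noise. Two dimensions are enough
  because, at each time, the coefficient vectors of \<open>V\<close> and \<open>W\<close> matter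
  only through their 2 by 2 Gram matrix. The symmetric root is used since a triangular one can jump
  at singular matrices. The state enters the approximating law through five averages per time: two
  drifts and three Gram entries. The bound on the Taylor remainder does not involve the state, so
  the good sets have to control these averages only. Fourth moments give the squared first
  derivatives a finite variance.\<close>

lemma weighted_Levy_uniqueness:
  fixes P Q :: "'a measure" and w X :: "'a \<Rightarrow> real" and g :: "real \<Rightarrow> real"
  assumes P: "prob_space P" and Q: "prob_space Q" and sets: "sets Q = sets P"
    and w[measurable]: "w \<in> borel_measurable P" and w0: "\<And>x. 0 \<le> w x" and wb: "\<And>x. w x \<le> b"
    and X[measurable]: "X \<in> borel_measurable P"
    and eq: "\<And>\<theta> \<phi>. (\<integral>x. w x * (1 + cos (\<theta> * X x + \<phi>)) \<partial>P) = (\<integral>x. w x * (1 + cos (\<theta> * X x + \<phi>)) \<partial>Q)"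
    and g[measurable]: "g \<in> borel_measurable borel"
  shows "(\<integral>x. w x * g (X x) \<partial>P) = (\<integral>x. w x * g (X x) \<partial>Q)"
proof -
  interpret P: prob_space P by fact
  interpret Q: prob_space Q by fact
  have [measurable]: "w \<in> borel_measurable Q" "X \<in> borel_measurable Q"
    using w X measurable_cong_sets[OF sets refl] by blast+
  have ab: "\<bar>w x\<bar> \<le> b" for x using w0[of x] wb[of x] by simp
  have b0: "0 \<le> b" using ab[of undefined] by linarith
  have iP: "integrable P w" and iQ: "integrable Q w"
    using ab by (auto intro!: P.integrable_const_bound[of _ b] Q.integrable_const_bound[of _ b])
  have cb: "\<bar>w x * cos y\<bar> \<le> b" for x y
    using mult_mono[OF ab[of x] abs_cos_le_one[of y]] b0 by (simp add: abs_mult)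
  have ciP: "integrable P (\<lambda>x. w x * cos (\<theta> * X x + \<phi>))" for \<theta> \<phi>
    using cb by (intro P.integrable_const_bound[of _ b]) auto
  have ciQ: "integrable Q (\<lambda>x. w x * cos (\<theta> * X x + \<phi>))" for \<theta> \<phi>
    using cb by (intro Q.integrable_const_bound[of _ b]) auto
  \<comment> \<open>Frequency 0 and phase pi/2 kill the cosine and leave the mass; the cosines
    follow, and the phase -pi/2 yields the sines. So the images under \<open>X\<close> of the
    weighted measures have equal characteristic functions. The summand 1 keeps these test functions
    nonnegative, so that they can themselves be factors of a weight.\<close>
  have mass: "(\<integral>x. w x \<partial>P) = (\<integral>x. w x \<partial>Q)"
    using eq[of 0 "pi/2"] by simp
  have ceq: "(\<integral>x. w x * cos (\<theta> * X x + \<phi>) \<partial>P) = (\<integral>x. w x * cos (\<theta> * X x + \<phi>) \<partial>Q)" for \<theta> \<phi>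
    using eq[of \<theta> \<phi>] mass ciP[of \<theta> \<phi>] ciQ[of \<theta> \<phi>] iP iQ by (simp add: distrib_left)
  have "cos (a + (-(pi/2))) = sin a" for a :: real
    by (simp only: cos_add cos_minus sin_minus cos_pi_half sin_pi_half)
  then have seq: "(\<integral>x. w x * sin (\<theta> * X x) \<partial>P) = (\<integral>x. w x * sin (\<theta> * X x) \<partial>Q)" for \<theta>
    using ceq[of \<theta> "-(pi/2)"] by simp
  define c where "c = (\<integral>x. w x \<partial>P)"
  have c0: "0 \<le> c" unfolding c_def using w0 by simp
  show ?thesis
  \<comment> \<open>A weight of mass zero cannot be normalised to a probability; it vanishes almost
    everywhere under both measures.\<close>
  proof (cases "c = 0")
    case True
    then have "AE x in P. w x = 0" "AE x in Q. w x = 0"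
      using integral_nonneg_eq_0_iff_AE[OF iP] integral_nonneg_eq_0_iff_AE[OF iQ] w0 mass
      by (auto simp: c_def)
    then have "(\<integral>x. w x * g (X x) \<partial>P) = 0" "(\<integral>x. w x * g (X x) \<partial>Q) = 0"
      by (auto intro!: integral_eq_zero_AE)
    then show ?thesis by simp
  next
    case False
    then have cpos: "c > 0" using c0 by simp
    define M where "M R = distr (density R (\<lambda>x. ennreal (w x / c))) borel X" for R
    have RD: "real_distribution (M R)"
      if R: "prob_space R" and [measurable]: "w \<in> borel_measurable R" "X \<in> borel_measurable R"
        and "integrable R w" "(\<integral>x. w x \<partial>R) = c" for R
    proof -
      have "emeasure (density R (\<lambda>x. ennreal (w x / c))) (space (density R (\<lambda>x. ennreal (w x / c)))) = 1"
        using that w0 cpos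
        by (simp add: emeasure_density nn_integral_eq_integral)
      then have "prob_space (density R (\<lambda>x. ennreal (w x / c)))" by (rule prob_spaceI)
      then show ?thesis unfolding M_def by (auto intro!: prob_space.real_distribution_distr)
    qed
    have charM: "char (M R) \<theta> =
        Complex ((\<integral>x. w x * cos (\<theta> * X x + 0) \<partial>R) / c) ((\<integral>x. w x * sin (\<theta> * X x) \<partial>R) / c)"
      if R: "prob_space R" and [measurable]: "w \<in> borel_measurable R" "X \<in> borel_measurable R" for R \<theta>
    proof -
      interpret R: prob_space R by fact
      have int: "integrable R (\<lambda>x. (w x / c) *\<^sub>R iexp (\<theta> * X x))"
        using ab cpos by (intro R.integrable_const_bound[of _ "b / c"]) (auto simp: divide_right_mono)
      have "char (M R) \<theta> = (\<integral>x. (w x / c) *\<^sub>R iexp (\<theta> * X x) \<partial>R)"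
        unfolding M_def char_def using w0 cpos
        by (simp add: integral_distr integral_density)
      also have "\<dots> = Complex (\<integral>x. Re ((w x / c) *\<^sub>R iexp (\<theta> * X x)) \<partial>R) (\<integral>x. Im ((w x / c) *\<^sub>R iexp (\<theta> * X x)) \<partial>R)"
        by (simp only: integral_Re[OF int] integral_Im[OF int] complex_surj)
      finally show ?thesis by (simp add: Re_exp Im_exp)
    qed
    have "M P = M Q"
      by (rule Levy_uniqueness)
        (use RD[OF P] RD[OF Q] iP iQ mass ceq[of _ 0] seq in \<open>auto simp: charM[OF P] charM[OF Q] c_def fun_eq_iff\<close>)
    moreover have "(\<integral>x. g x \<partial>M R) = (\<integral>x. w x * g (X x) \<partial>R) / c"
      if [measurable]: "w \<in> borel_measurable R" "X \<in> borel_measurable R" for R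
      unfolding M_def using w0 cpos
      by (simp add: integral_distr integral_density)
    ultimately have "(\<integral>x. w x * g (X x) \<partial>P) / c = (\<integral>x. w x * g (X x) \<partial>Q) / c"
      by (metis w X \<open>w \<in> borel_measurable Q\<close> \<open>X \<in> borel_measurable Q\<close>)
    then show ?thesis using cpos by simp
  qed
qed

text \<open>Product-to-sum formulas turn a factor \<open>1 + cos\<close> times a cosine into three
  cosines of linear forms. The additional cosine with free \<eta> and \<zeta> makes the induction
  over \<open>K\<close> close; when no factors are left, it is the real part of a characteristic
  function rotated by the phase.\<close>

lemma trig_product_integral_eq:
  fixes P Q :: "('i \<Rightarrow> real) measure"
  assumes I: "finite I" and P: "prob_space P" and Q: "prob_space Q"
    and sP: "sets P = sets (\<Pi>\<^sub>M i\<in>I. borel)" and sQ: "sets Q = sets (\<Pi>\<^sub>M i\<in>I. borel)"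
    and eq: "\<And>\<theta>. (\<integral>x. iexp (\<Sum>i\<in>I. \<theta> i * x i) \<partial>P) = (\<integral>x. iexp (\<Sum>i\<in>I. \<theta> i * x i) \<partial>Q)"
    and K: "K \<subseteq> I"
  shows "(\<integral>x. (\<Prod>j\<in>K. 1 + cos (\<theta> j * x j + \<phi> j)) * cos ((\<Sum>i\<in>I. \<eta> i * x i) + \<zeta>) \<partial>P)
       = (\<integral>x. (\<Prod>j\<in>K. 1 + cos (\<theta> j * x j + \<phi> j)) * cos ((\<Sum>i\<in>I. \<eta> i * x i) + \<zeta>) \<partial>Q)"
proof -
  interpret P: prob_space P by fact
  interpret Q: prob_space Q by fact
  note [measurable_cong] = sP sQ
  have "finite K" using K I finite_subset by blast
  then show ?thesis using K
  proof (induction K arbitrary: \<eta> \<zeta> rule: finite_induct)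
    case empty
    have *: "(\<integral>x. cos ((\<Sum>i\<in>I. \<eta> i * x i) + \<zeta>) \<partial>R) =
        Re (cis \<zeta> * (\<integral>x. iexp (\<Sum>i\<in>I. \<eta> i * x i) \<partial>R))"
      if "prob_space R" and [measurable_cong]: "sets R = sets (\<Pi>\<^sub>M i\<in>I. borel)" for R
    proof -
      interpret R: prob_space R by fact
      have i: "integrable R (\<lambda>x. iexp (\<Sum>i\<in>I. \<eta> i * x i))"
        by (intro R.integrable_const_bound[of _ 1]) auto
      then have j: "integrable R (\<lambda>x. cis \<zeta> * iexp (\<Sum>i\<in>I. \<eta> i * x i))" by simp
      have "Re (cis \<zeta> * iexp r) = cos (r + \<zeta>)" for r
        by (simp add: cis_mult add.commute flip: cis_conv_exp)
      then have "(\<integral>x. cos ((\<Sum>i\<in>I. \<eta> i * x i) + \<zeta>) \<partial>R) =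
          (\<integral>x. Re (cis \<zeta> * iexp (\<Sum>i\<in>I. \<eta> i * x i)) \<partial>R)"
        by (simp only:)
      also have "\<dots> = Re (cis \<zeta> * (\<integral>x. iexp (\<Sum>i\<in>I. \<eta> i * x i) \<partial>R))"
        using integral_Re[OF j] by simp
      finally show ?thesis .
    qed
    show ?case using *[OF P sP] *[OF Q sQ] eq[of \<eta>] by simp
  next
    case (insert k K)
    let ?p = "\<lambda>x. \<Prod>j\<in>K. 1 + cos (\<theta> j * x j + \<phi> j)"
    let ?c = "\<lambda>\<eta> \<zeta> x. cos ((\<Sum>i\<in>I. \<eta> i * x i) + \<zeta>)"
    have kI: "k \<in> I" and KI: "K \<subseteq> I" using insert by auto
    have sum_upd: "(\<Sum>i\<in>I. (\<eta>(k := \<eta> k + s)) i * x i) = (\<Sum>i\<in>I. \<eta> i * x i) + s * x k" for s and x :: "'i \<Rightarrow> real"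
    proof -
      have "(\<Sum>i\<in>I. (\<eta>(k := \<eta> k + s)) i * x i) = (\<Sum>i\<in>I. \<eta> i * x i + (if i = k then s * x i else 0))"
        by (intro sum.cong) (auto simp: algebra_simps)
      then show ?thesis using kI I by (simp add: sum.distrib)
    qed
    have trig: "(1 + cos a) * cos (y + \<zeta>) =
        cos (y + \<zeta>) + 1/2 * cos ((y + \<theta> k * z) + (\<zeta> + \<phi> k)) + 1/2 * cos ((y + (- \<theta> k) * z) + (\<zeta> - \<phi> k))"
      if "a = \<theta> k * z + \<phi> k" for a y z
    proof -
      have 1: "(y + \<theta> k * z) + (\<zeta> + \<phi> k) = (y + \<zeta>) + a" and 2: "(y + (- \<theta> k) * z) + (\<zeta> - \<phi> k) = (y + \<zeta>) - a"
        using that by (simp_all add: algebra_simps)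
      show ?thesis unfolding 1 2 unfolding cos_add[of "y + \<zeta>" a] cos_diff[of "y + \<zeta>" a] by (simp add: field_simps)
    qed
    have split: "(\<Prod>j\<in>insert k K. 1 + cos (\<theta> j * x j + \<phi> j)) * ?c \<eta> \<zeta> x =
       ?p x * ?c \<eta> \<zeta> x + (1/2 * (?p x * ?c (\<eta>(k := \<eta> k + \<theta> k)) (\<zeta> + \<phi> k) x) +
         1/2 * (?p x * ?c (\<eta>(k := \<eta> k + - \<theta> k)) (\<zeta> - \<phi> k) x))" for x :: "'i \<Rightarrow> real"
    proof -
      have "(\<Prod>j\<in>insert k K. 1 + cos (\<theta> j * x j + \<phi> j)) * ?c \<eta> \<zeta> x
          = ?p x * ((1 + cos (\<theta> k * x k + \<phi> k)) * ?c \<eta> \<zeta> x)"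
        using insert(1,2) by simp
      then show ?thesis
        unfolding sum_upd trig[OF refl] by (simp only: distrib_left mult.left_commute add.assoc)
    qed
    have int: "integrable R (\<lambda>x. ?p x * ?c \<eta> \<zeta> x)" 
      if "prob_space R" and s: "sets R = sets (\<Pi>\<^sub>M i\<in>I. borel)" for R \<eta> \<zeta>
    proof -
      interpret R: prob_space R by fact
      note [measurable_cong] = s
      have c: "?c \<eta> \<zeta> \<in> borel_measurable R" by measurable
      have "(\<lambda>x. x j) \<in> borel_measurable R" if "j \<in> K" for j
        using that KI by (auto simp: measurable_cong_sets[OF s refl] intro: measurable_component_singleton)
      then have m: "?p \<in> borel_measurable R"
        by (intro borel_measurable_prod borel_measurable_add borel_measurable_const
            borel_measurable_cos borel_measurable_times) auto
      have "\<bar>?p x * ?c \<eta> \<zeta> x\<bar> \<le> 2 ^ card K" for x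
      proof -
        have "\<bar>?p x\<bar> \<le> (\<Prod>j\<in>K. 2)"
          unfolding abs_prod
        proof (intro prod_mono conjI)
          fix j show "\<bar>1 + cos (\<theta> j * x j + \<phi> j)\<bar> \<le> 2"
            using cos_le_one[of "\<theta> j * x j + \<phi> j"] cos_ge_minus_one[of "\<theta> j * x j + \<phi> j"] by linarith
        qed simp
        then have "\<bar>?p x\<bar> * \<bar>?c \<eta> \<zeta> x\<bar> \<le> 2 ^ card K * 1"
          by (intro mult_mono) auto
        then show ?thesis by (simp add: abs_mult)
      qed
      then show ?thesis
        using m c by (intro R.integrable_const_bound[of _ "2 ^ card K"] borel_measurable_times) auto
    qed
    show ?case unfolding split
      using int[OF P sP] int[OF Q sQ] insert.IH[OF KI] by simp
  qed
qed

text \<open>Products of nonnegative functions \<open>1 + cos\<close> have expectations determined by the characteristic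
  function. Taking all factors but one as a weight, the one-dimensional uniqueness theorem
  replaces this factor by an arbitrary function.\<close>

lemma box_integral_eq:
  fixes P Q :: "('i \<Rightarrow> real) measure"
  assumes I: "finite I" and P: "prob_space P" and Q: "prob_space Q"
    and sP: "sets P = sets (\<Pi>\<^sub>M i\<in>I. borel)" and sQ: "sets Q = sets (\<Pi>\<^sub>M i\<in>I. borel)"
    and eq: "\<And>\<theta>. (\<integral>x. iexp (\<Sum>i\<in>I. \<theta> i * x i) \<partial>P) = (\<integral>x. iexp (\<Sum>i\<in>I. \<theta> i * x i) \<partial>Q)"
    and J: "J \<subseteq> I" and A: "\<And>j. j \<in> J \<Longrightarrow> A j \<in> sets borel"
    and g: "\<And>j. j \<in> I \<Longrightarrow> g j = (if j \<in> J then indicator (A j) else (\<lambda>y. 1 + cos (\<theta> j * y + \<phi> j)))"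
  shows "(\<integral>x. (\<Prod>j\<in>I. g j (x j)) \<partial>P) = (\<integral>x. (\<Prod>j\<in>I. g j (x j)) \<partial>Q)"
proof -
  note [measurable_cong] = sP sQ
  have "finite J" using J I finite_subset by blast
  then show ?thesis using J A g
  proof (induction J arbitrary: g \<theta> \<phi> rule: finite_induct)
    case empty
    then show ?case
      using trig_product_integral_eq[OF I P Q sP sQ eq subset_refl, where \<theta>=\<theta> and \<phi>=\<phi> and \<eta>="\<lambda>_. 0" and \<zeta>=0]
      by simp
  next
    case (insert k J)
    have kI: "k \<in> I" using insert by auto
    let ?w = "\<lambda>x. \<Prod>j\<in>I - {k}. g j (x j)"
    have gb: "0 \<le> g j y" "g j y \<le> 2" if "j \<in> I" for j y
    proof -
      have "0 \<le> 1 + cos (\<theta> j * y + \<phi> j)" "1 + cos (\<theta> j * y + \<phi> j) \<le> 2"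
        using cos_le_one[of "\<theta> j * y + \<phi> j"] cos_ge_minus_one[of "\<theta> j * y + \<phi> j"] by linarith+
      then show "0 \<le> g j y" "g j y \<le> 2"
        unfolding insert.prems(3)[OF that] by (auto simp: indicator_def)
    qed
    have gm: "g j \<in> borel_measurable borel" if "j \<in> I" for j
      using insert.prems(3)[OF that] insert.prems(2) by (cases "j \<in> insert k J") auto
    have gc: "(\<lambda>x. g j (x j)) \<in> borel_measurable P" if "j \<in> I" for j
      using measurable_compose[OF measurable_component_singleton[OF that] gm[OF that]] 
      by (simp add: measurable_cong_sets[OF sP refl])
    have split: "(\<Prod>j\<in>I. h j (x j)) = (\<Prod>j\<in>I - {k}. h j (x j)) * h k (x k)" for h :: "'i \<Rightarrow> real \<Rightarrow> real" and x
      using I kI by (subst prod.remove[of I k]) (auto simp: mult.commute)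
    have "(\<integral>x. ?w x * g k (x k) \<partial>P) = (\<integral>x. ?w x * g k (x k) \<partial>Q)"
    proof (rule weighted_Levy_uniqueness[OF P Q _ _ _ _ _ _ gm[OF kI]])
      show "sets Q = sets P" using sP sQ by simp
      show "?w \<in> borel_measurable P" by (intro borel_measurable_prod gc) auto
      show "0 \<le> ?w x" for x by (intro prod_nonneg) (use gb in auto)
      show "?w x \<le> 2 ^ card (I - {k})" for x
      proof -
        have "?w x \<le> (\<Prod>j\<in>I - {k}. 2)" by (intro prod_mono) (use gb in auto)
        then show ?thesis by simp
      qed
      show "(\<lambda>x. x k) \<in> borel_measurable P"
        using measurable_component_singleton[OF kI] measurable_cong_sets[OF sP refl] by blast
      fix t p :: real
      \<comment> \<open>A trigonometric factor put back at \<open>k\<close> leaves one indicator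
        fewer, so the induction hypothesis applies at every frequency and phase. This is the
        hypothesis under which the one-dimensional theorem allows the indicator at
        \<open>k\<close>.\<close>
      let ?h = "g(k := (\<lambda>y. 1 + cos (t * y + p)))"
      have w': "(\<Prod>j\<in>I - {k}. ?h j (x j)) = ?w x" for x
        by (rule prod.cong) auto
      have "(\<integral>x. (\<Prod>j\<in>I. ?h j (x j)) \<partial>P) = (\<integral>x. (\<Prod>j\<in>I. ?h j (x j)) \<partial>Q)"
        by (rule insert.IH[where \<theta> = "\<theta>(k := t)" and \<phi> = "\<phi>(k := p)"])
          (use insert.prems insert.hyps in auto)
      then show "(\<integral>x. ?w x * (1 + cos (t * x k + p)) \<partial>P) = (\<integral>x. ?w x * (1 + cos (t * x k + p)) \<partial>Q)"
        unfolding split[of ?h] w' by simp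
    qed
    then show ?case by (simp add: split)
  qed
qed

text \<open>With an indicator in every coordinate, \<open>box_integral_eq\<close> yields equal
  probabilities of boxes, and these generate the product sigma-algebra.\<close>

theorem PiM_borel_char_eqI:
  fixes P Q :: "('i \<Rightarrow> real) measure"
  assumes I: "finite I" and P: "prob_space P" and Q: "prob_space Q"
    and sP: "sets P = sets (\<Pi>\<^sub>M i\<in>I. borel)" and sQ: "sets Q = sets (\<Pi>\<^sub>M i\<in>I. borel)"
    and eq: "\<And>\<theta>. (\<integral>x. iexp (\<Sum>i\<in>I. \<theta> i * x i) \<partial>P) = (\<integral>x. iexp (\<Sum>i\<in>I. \<theta> i * x i) \<partial>Q)"
  shows "P = Q"
proof (rule measure_eqI_PiM_finite[OF I sP sQ])
  interpret P: prob_space P by fact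
  interpret Q: prob_space Q by fact
  fix A :: "'i \<Rightarrow> real set" assume A: "\<And>i. i \<in> I \<Longrightarrow> A i \<in> sets borel"
  have ind: "(\<Prod>j\<in>I. indicator (A j) (x j)) = (indicator (Pi\<^sub>E I A) x :: real)" if "x \<in> extensional I" for x
    using I that by (auto simp: indicator_def PiE_iff prod_zero_iff)
  have E: "(\<integral>x. (\<Prod>j\<in>I. indicator (A j) (x j)) \<partial>R) = measure R (Pi\<^sub>E I A)"
    if s: "sets R = sets (\<Pi>\<^sub>M i\<in>I. borel)" for R :: "('i \<Rightarrow> real) measure"
  proof -
    have "(\<integral>x. (\<Prod>j\<in>I. indicator (A j) (x j)) \<partial>R) = (\<integral>x. indicator (Pi\<^sub>E I A) x \<partial>R :: real)"
      by (intro Bochner_Integration.integral_cong refl ind) 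
        (use sets_eq_imp_space_eq[OF s] in \<open>auto simp: space_PiM PiE_iff\<close>)
    also have "\<dots> = measure R (Pi\<^sub>E I A)" 
    proof -
      have "Pi\<^sub>E I A \<in> sets R" unfolding s using A I by (auto intro!: sets_PiM_I_finite)
      then show ?thesis by (simp add: sets.Int_space_eq2)
    qed
    finally show ?thesis .
  qed
  have "(\<integral>x. (\<Prod>j\<in>I. indicator (A j) (x j)) \<partial>P) = (\<integral>x. (\<Prod>j\<in>I. indicator (A j) (x j)) \<partial>Q :: real)"
    by (rule box_integral_eq[OF I P Q sP sQ eq subset_refl A]) auto
  then have "measure P (Pi\<^sub>E I A) = measure Q (Pi\<^sub>E I A)"
    unfolding E[OF sP] E[OF sQ] .
  then show "emeasure P (Pi\<^sub>E I A) = emeasure Q (Pi\<^sub>E I A)"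
    by (simp add: P.emeasure_eq_measure Q.emeasure_eq_measure)
next
  interpret P: prob_space P by fact
  show "range (\<lambda>_::nat. Pi\<^sub>E I (\<lambda>_. UNIV :: real set)) \<subseteq> prod_algebra I (\<lambda>_. borel)"
    using I by (auto intro!: prod_algebraI_finite)
  show "(\<Union>i::nat. Pi\<^sub>E I (\<lambda>_. UNIV :: real set)) = space (\<Pi>\<^sub>M i\<in>I. borel)"
    by (simp add: space_PiM)
  show "emeasure P (Pi\<^sub>E I (\<lambda>_. UNIV)) \<noteq> \<infinity>" by simp
qed

section \<open>Gaussian laws and linear images of the noise\<close>

lemma char_normal_law:
  assumes "0 \<le> v"
  shows "char (normal_law \<mu> v) t = exp (\<i> * of_real (t * \<mu>) - of_real (t\<^sup>2 * v / 2))"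
proof (cases "v = 0")
  case True
  then show ?thesis by (simp add: normal_law_def char_def integral_return)
next
  case False
  define \<sigma> where "\<sigma> = sqrt v"
  have \<sigma>: "\<sigma> > 0" "\<sigma>\<^sup>2 = v" using False assms by (auto simp: \<sigma>_def)
  have nd: "normal_density \<mu> \<sigma> (\<mu> + \<sigma> * y) = std_normal_density y / \<sigma>" for y
    using \<sigma>(1) by (simp add: normal_density_def power_mult_distrib real_sqrt_mult field_simps)
  have "char (normal_law \<mu> v) t = (\<integral>x. normal_density \<mu> \<sigma> x *\<^sub>R iexp (t * x) \<partial>lborel)"
    using False by (simp add: normal_law_def char_def integral_density \<sigma>_def)
  also have "\<dots> = \<sigma> *\<^sub>R (\<integral>y. normal_density \<mu> \<sigma> (\<mu> + \<sigma> * y) *\<^sub>R iexp (t * (\<mu> + \<sigma> * y)) \<partial>lborel)"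
    using \<sigma>(1) by (subst lborel_integral_real_affine[where c=\<sigma> and t=\<mu>]) auto
  also have "\<dots> = \<sigma> *\<^sub>R (\<integral>y. (iexp (t * \<mu>) / \<sigma>) * (std_normal_density y *\<^sub>R iexp ((t * \<sigma>) * y)) \<partial>lborel)"
  proof -
    have "normal_density \<mu> \<sigma> (\<mu> + \<sigma> * y) *\<^sub>R iexp (t * (\<mu> + \<sigma> * y))
        = (iexp (t * \<mu>) / \<sigma>) * (std_normal_density y *\<^sub>R iexp ((t * \<sigma>) * y))" for y
      unfolding nd by (simp add: exp_add[symmetric] ring_distribs scaleR_conv_of_real mult_ac)
    then show ?thesis by (simp only:)
  qed
  also have "\<dots> = iexp (t * \<mu>) * char std_normal_distribution (t * \<sigma>)"
    using \<sigma>(1) by (simp add: char_def integral_density scaleR_conv_of_real)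
  also have "\<dots> = exp (\<i> * of_real (t * \<mu>) - of_real (t\<^sup>2 * v / 2))"
    unfolding char_std_normal_distribution power_mult_distrib \<sigma> exp_of_real[symmetric] mult_exp_exp
    by (rule arg_cong[of _ _ exp]) simp
  finally show ?thesis .
qed

lemma prob_space_normal_law: "0 \<le> v \<Longrightarrow> prob_space (normal_law \<mu> v)"
  by (auto simp: normal_law_def intro!: prob_space_return prob_space_normal_density)

lemma sets_normal_law [simp]: "sets (normal_law \<mu> v) = sets borel"
  by (simp add: normal_law_def)

text \<open>The definition prescribes the law of each linear form, and the joint characteristic
  function at \<theta> is that of the form with coefficients \<theta> at the argument 1.\<close>

lemma is_gaussian_lawD:
  assumes g: "is_gaussian_law I \<mu> C P" and q: "0 \<le> (\<Sum>i\<in>I. \<Sum>j\<in>I. \<theta> i * C i j * \<theta> j)"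
  shows "(\<integral>x. iexp (\<Sum>i\<in>I. \<theta> i * x i) \<partial>P)
     = exp (\<i> * of_real (\<Sum>i\<in>I. \<theta> i * \<mu> i) - of_real ((\<Sum>i\<in>I. \<Sum>j\<in>I. \<theta> i * C i j * \<theta> j) / 2))"
proof -
  have [measurable_cong]: "sets P = sets (\<Pi>\<^sub>M i\<in>I. borel)" using g by (simp add: is_gaussian_law_def)
  have "(\<integral>x. iexp (\<Sum>i\<in>I. \<theta> i * x i) \<partial>P) = char (distr P borel (\<lambda>x. \<Sum>i\<in>I. \<theta> i * x i)) 1"
    by (simp add: char_def integral_distr)
  also have "\<dots> = char (normal_law (\<Sum>i\<in>I. \<theta> i * \<mu> i) (\<Sum>i\<in>I. \<Sum>j\<in>I. \<theta> i * C i j * \<theta> j)) 1"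
    using g by (simp add: is_gaussian_law_def)
  also have "\<dots> = exp (\<i> * of_real (\<Sum>i\<in>I. \<theta> i * \<mu> i) - of_real ((\<Sum>i\<in>I. \<Sum>j\<in>I. \<theta> i * C i j * \<theta> j) / 2))"
    by (subst char_normal_law[OF q]) (simp only: mult_1 power_one)
  finally show ?thesis .
qed

text \<open>Total mass 1 is hidden in the prescribed projections: the form with zero coefficients
  has a point mass as its law.\<close>

lemma is_gaussian_law_prob_space:
  assumes g: "is_gaussian_law I \<mu> C P"
  shows "prob_space P"
proof (rule prob_space_distrD)
  have [measurable_cong]: "sets P = sets (\<Pi>\<^sub>M i\<in>I. borel)" using g by (simp add: is_gaussian_law_def)
  show "(\<lambda>x. \<Sum>i\<in>I. 0 * x i) \<in> borel_measurable P" by simp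
  show "prob_space (distr P borel (\<lambda>x. \<Sum>i\<in>I. 0 * x i))"
    using g prob_space_normal_law[of 0 0] unfolding is_gaussian_law_def
    by (auto dest!: spec[of _ "\<lambda>_. 0"])
qed

text \<open>Scaling \<theta> by \<open>t\<close> recovers the whole characteristic function of a
  projection from the joint one, so one-dimensional uniqueness identifies each projection.\<close>

lemma is_gaussian_lawI:
  assumes P: "prob_space P" and s: "sets P = sets (\<Pi>\<^sub>M i\<in>I. borel)"
    and q: "\<And>\<theta>. 0 \<le> (\<Sum>i\<in>I. \<Sum>j\<in>I. \<theta> i * C i j * \<theta> j)"
    and char: "\<And>\<theta>. (\<integral>x. iexp (\<Sum>i\<in>I. \<theta> i * x i) \<partial>P)
     = exp (\<i> * of_real (\<Sum>i\<in>I. \<theta> i * \<mu> i) - of_real ((\<Sum>i\<in>I. \<Sum>j\<in>I. \<theta> i * C i j * \<theta> j) / 2))"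
  shows "is_gaussian_law I \<mu> C P"
  unfolding is_gaussian_law_def
proof (intro conjI allI s)
  fix \<theta>
  note [measurable_cong] = s
  let ?q = "\<Sum>i\<in>I. \<Sum>j\<in>I. \<theta> i * C i j * \<theta> j"
  show "distr P borel (\<lambda>x. \<Sum>i\<in>I. \<theta> i * x i) = normal_law (\<Sum>i\<in>I. \<theta> i * \<mu> i) ?q"
  proof (rule Levy_uniqueness)
    show "real_distribution (distr P borel (\<lambda>x. \<Sum>i\<in>I. \<theta> i * x i))"
      by (intro prob_space.real_distribution_distr P) simp
    show "real_distribution (normal_law (\<Sum>i\<in>I. \<theta> i * \<mu> i) ?q)"
      using prob_space_normal_law[OF q]
      by (simp add: real_distribution_def real_distribution_axioms_def)
    show "char (distr P borel (\<lambda>x. \<Sum>i\<in>I. \<theta> i * x i)) = char (normal_law (\<Sum>i\<in>I. \<theta> i * \<mu> i) ?q)"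
    proof
      fix t
      have 1: "(\<Sum>i\<in>I. (t * \<theta> i) * x i) = t * (\<Sum>i\<in>I. \<theta> i * x i)" for x
        by (simp add: sum_distrib_left mult.assoc)
      have 2: "(\<Sum>i\<in>I. \<Sum>j\<in>I. (t * \<theta> i) * C i j * (t * \<theta> j)) = t\<^sup>2 * ?q"
        by (simp add: sum_distrib_left power2_eq_square mult_ac)
      have "char (distr P borel (\<lambda>x. \<Sum>i\<in>I. \<theta> i * x i)) t = (\<integral>x. iexp (t * (\<Sum>i\<in>I. \<theta> i * x i)) \<partial>P)"
        by (simp add: char_def integral_distr)
      also have "\<dots> = char (normal_law (\<Sum>i\<in>I. \<theta> i * \<mu> i) ?q) t"
        using char[of "\<lambda>i. t * \<theta> i"] unfolding 1 2 char_normal_law[OF q] .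
      finally show "char (distr P borel (\<lambda>x. \<Sum>i\<in>I. \<theta> i * x i)) t = char (normal_law (\<Sum>i\<in>I. \<theta> i * \<mu> i) ?q) t" .
    qed
  qed
qed

section \<open>The bilinear form of the covariance Sigma, and a construction of the law N(0,
  Sigma)\<close>

definition sform :: "nat \<Rightarrow> (nat \<Rightarrow> real) \<Rightarrow> (nat \<Rightarrow> real) \<Rightarrow> real" where
  "sform N a b = ((\<Sum>n=1..N. a n * b n) + (\<Sum>n=1..N. a n) * (\<Sum>n=1..N. b n)) / 2"

lemma sform_Sigma_cov: "(\<Sum>n=1..N. \<Sum>m=1..N. a n * (c * Sigma_cov n m) * b m) = c * sform N a b"
proof -
  have "(\<Sum>n=1..N. \<Sum>m=1..N. a n * (c * Sigma_cov n m) * b m)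
     = (\<Sum>n=1..N. \<Sum>m=1..N. c / 2 * (if n = m then a n * b m else 0) + c / 2 * (a n * b m))"
    by (intro sum.cong refl) (auto simp: Sigma_cov_def field_simps)
  also have "\<dots> = c / 2 * (\<Sum>n=1..N. \<Sum>m=1..N. (if n = m then a n * b m else 0)) + c / 2 * (\<Sum>n=1..N. \<Sum>m=1..N. a n * b m)"
    by (simp only: sum.distrib sum_distrib_left)
  also have "(\<Sum>n=1..N. \<Sum>m=1..N. (if n = m then a n * b m else 0)) = (\<Sum>n=1..N. a n * b n)"
    by (intro sum.cong refl) simp
  also have "(\<Sum>n=1..N. \<Sum>m=1..N. a n * b m) = (\<Sum>n=1..N. a n) * (\<Sum>n=1..N. b n)"
    by (simp add: sum_product)
  finally show ?thesis by (simp add: sform_def field_simps)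
qed

lemma sform_nonneg: "0 \<le> sform N a a"
  by (simp add: sform_def sum_nonneg)

lemma sform_commute: "sform N a b = sform N b a"
  by (simp add: sform_def mult.commute)

lemma sform_add: "sform N (\<lambda>n. x * a n + y * b n) (\<lambda>n. x * a n + y * b n)
    = x\<^sup>2 * sform N a a + 2 * (x * y) * sform N a b + y\<^sup>2 * sform N b b"
proof -
  have "(\<Sum>n=1..N. (x * a n + y * b n) * (x * a n + y * b n))
      = x\<^sup>2 * (\<Sum>n=1..N. a n * a n) + 2 * (x * y) * (\<Sum>n=1..N. a n * b n) + y\<^sup>2 * (\<Sum>n=1..N. b n * b n)"
    by (simp add: sum_distrib_left algebra_simps power2_eq_square flip: sum.distrib)
  moreover have "(\<Sum>n=1..N. x * a n + y * b n) = x * (\<Sum>n=1..N. a n) + y * (\<Sum>n=1..N. b n)"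
    by (simp add: sum.distrib sum_distrib_left)
  ultimately show ?thesis
    unfolding sform_def by (simp add: field_simps power2_eq_square)
qed

abbreviation Sigma_law :: "nat \<Rightarrow> (nat \<Rightarrow> real) measure" where
  "Sigma_law N \<equiv> gaussian_law {1..N} (\<lambda>_. 0) Sigma_cov"

text \<open>Existence, which makes the choice in \<open>gaussian_law\<close> meaningful. With
  independent standard normal \<xi> at the indices 0, ..., N, the variables
  \<open>(\<xi> n + \<xi> 0) / sqrt 2\<close> have variance 1, and the shared \<open>\<xi> 0\<close>
  gives covariance 1/2.\<close>

lemma is_gaussian_Sigma_law: "is_gaussian_law {1..N} (\<lambda>_. 0) Sigma_cov (Sigma_law N)"
proof -
  let ?S = "\<Pi>\<^sub>M n\<in>{0..N}. std_normal_distribution"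
  let ?f = "\<lambda>\<xi>. \<lambda>n\<in>{1..N}. (\<xi> n + \<xi> 0) / sqrt 2 :: real"
  interpret std: prob_space std_normal_distribution
    by (rule prob_space_normal_density) simp
  interpret prod: product_prob_space "\<lambda>_. std_normal_distribution" "{0..N}" ..
  have m[measurable]: "?f \<in> measurable ?S (\<Pi>\<^sub>M n\<in>{1..N}. borel)"
    by (intro measurable_restrict) simp
  have "is_gaussian_law {1..N} (\<lambda>_. 0) Sigma_cov (distr ?S (\<Pi>\<^sub>M n\<in>{1..N}. borel) ?f)"
  proof (rule is_gaussian_lawI)
    show "prob_space (distr ?S (\<Pi>\<^sub>M n\<in>{1..N}. borel) ?f)"
      by (intro prod.prob_space_distr m)
    fix \<theta> :: "nat \<Rightarrow> real"
    have S: "(\<Sum>i=1..N. \<Sum>j=1..N. \<theta> i * Sigma_cov i j * \<theta> j) = sform N \<theta> \<theta>"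
      using sform_Sigma_cov[of \<theta> 1 \<theta> N] by simp
    then show "0 \<le> (\<Sum>i=1..N. \<Sum>j=1..N. \<theta> i * Sigma_cov i j * \<theta> j)"
      using sform_nonneg by simp
    \<comment> \<open>The linear form collected by the independent normals. The coefficient of
      \<open>\<xi> 0\<close> is the sum of all \<open>\<theta> i\<close>, and its square produces
      the rank-one part of Sigma.\<close>
    define c where "c n = (if n = 0 then \<Sum>i=1..N. \<theta> i else \<theta> n) / sqrt 2" for n
    have set: "{0..N} = insert 0 {1..N}" by auto
    have lin: "(\<Sum>i=1..N. \<theta> i * ?f \<xi> i) = (\<Sum>n=0..N. c n * \<xi> n)" for \<xi>
      unfolding set by (simp add: c_def sum_divide_distrib sum_distrib_right sum_distrib_left 
          distrib_left add_divide_distrib sum.distrib)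
    have "(\<integral>x. iexp (\<Sum>i=1..N. \<theta> i * x i) \<partial>distr ?S (\<Pi>\<^sub>M n\<in>{1..N}. borel) ?f)
        = (\<integral>\<xi>. iexp (\<Sum>i=1..N. \<theta> i * ?f \<xi> i) \<partial>?S)"
      by (subst integral_distr) auto
    also have "\<dots> = (\<integral>\<xi>. (\<Prod>n=0..N. iexp (c n * \<xi> n)) \<partial>?S)"
      by (simp only: lin of_real_sum sum_distrib_left exp_sum finite_atLeastAtMost)
    also have "\<dots> = (\<Prod>n=0..N. char std_normal_distribution (c n))"
      unfolding char_def
      by (rule prod.product_integral_prod) (auto intro!: std.integrable_const_bound[of _ 1])
    also have "\<dots> = exp (of_real (- (\<Sum>n=0..N. (c n)\<^sup>2) / 2))"
      by (simp add: char_std_normal_distribution sum_negf sum_divide_distrib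
          flip: exp_of_real exp_sum)
    also have "(\<Sum>n=0..N. (c n)\<^sup>2) = sform N \<theta> \<theta>"
      unfolding set by (simp add: c_def sform_def power_divide power2_eq_square sum_divide_distrib add_divide_distrib add.commute)
    also have "exp (complex_of_real (- sform N \<theta> \<theta> / 2))
      = exp (\<i> * of_real (\<Sum>i=1..N. \<theta> i * 0) - of_real ((\<Sum>i=1..N. \<Sum>j=1..N. \<theta> i * Sigma_cov i j * \<theta> j) / 2))"
      unfolding S by simp
    finally show "(\<integral>x. iexp (\<Sum>i=1..N. \<theta> i * x i) \<partial>distr ?S (\<Pi>\<^sub>M n\<in>{1..N}. borel) ?f)
      = exp (\<i> * of_real (\<Sum>i=1..N. \<theta> i * 0) - of_real ((\<Sum>i=1..N. \<Sum>j=1..N. \<theta> i * Sigma_cov i j * \<theta> j) / 2))"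
      .
  qed simp
  then show ?thesis unfolding gaussian_law_def by (rule someI)
qed

lemma prob_space_Sigma_law: "prob_space (Sigma_law N)"
  using is_gaussian_law_prob_space[OF is_gaussian_Sigma_law] .

lemma sets_Sigma_law [measurable_cong]: "sets (Sigma_law N) = sets (\<Pi>\<^sub>M n\<in>{1..N}. borel)"
  using is_gaussian_Sigma_law[of N] by (simp add: is_gaussian_law_def)

lemma char_Sigma_law: "(\<integral>x. iexp (\<Sum>n=1..N. c n * x n) \<partial>Sigma_law N) = exp (of_real (- (sform N c c / 2)))"
proof -
  have S: "(\<Sum>i=1..N. \<Sum>j=1..N. c i * Sigma_cov i j * c j) = sform N c c"
    using sform_Sigma_cov[of c 1 c N] by simp
  show ?thesis
    using is_gaussian_lawD[OF is_gaussian_Sigma_law[of N], where \<theta>=c] sform_nonneg[of N c] unfolding S by simp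
qed

text \<open>\<open>\<alpha>\<close> and \<open>\<beta>\<close> weight the same noise at time
  \<open>t\<close>. This sharing creates the covariance between the \<open>V\<close> and the
  \<open>W\<close> components, while different times stay independent.\<close>

definition noise_lin :: "nat \<Rightarrow> (nat \<Rightarrow> nat \<Rightarrow> real) \<Rightarrow> (nat \<Rightarrow> nat \<Rightarrow> real) \<Rightarrow>
    (nat \<times> nat \<Rightarrow> nat \<Rightarrow> real) \<Rightarrow> nat \<Rightarrow> nat + nat \<Rightarrow> real" where
  "noise_lin D \<alpha> \<beta> u t i = (case i of
      Inl n \<Rightarrow> \<Sum>d=1..D. \<alpha> t d * u (t, d) n
    | Inr n \<Rightarrow> \<Sum>d=1..D. \<beta> t d * u (t, d) n)"

text \<open>The quadratic form of the Kronecker product of the symmetric matrix with diagonal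
  \<open>a\<close>, \<open>b\<close> and off-diagonal entry \<open>c\<close> with Sigma; see
  \<open>block_form_block_cov\<close>.\<close>

definition block_form :: "nat \<Rightarrow> real \<Rightarrow> real \<Rightarrow> real \<Rightarrow> (nat + nat \<Rightarrow> real) \<Rightarrow> real" where
  "block_form N a c b \<theta> = a * sform N (\<theta> \<circ> Inl) (\<theta> \<circ> Inl) + 2 * c * sform N (\<theta> \<circ> Inl) (\<theta> \<circ> Inr)
     + b * sform N (\<theta> \<circ> Inr) (\<theta> \<circ> Inr)"

definition block_cov :: "real \<Rightarrow> real \<Rightarrow> real \<Rightarrow> nat + nat \<Rightarrow> nat + nat \<Rightarrow> real" where
  "block_cov a c b i j = (case (i, j) of
     (Inl n, Inl m) \<Rightarrow> a * Sigma_cov n m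
   | (Inr n, Inr m) \<Rightarrow> b * Sigma_cov n m
   | (Inl n, Inr m) \<Rightarrow> c * Sigma_cov n m
   | (Inr n, Inl m) \<Rightarrow> c * Sigma_cov n m)"

lemma block_form_block_cov:
  "(\<Sum>i\<in>{1..N} <+> {1..N}. \<Sum>j\<in>{1..N} <+> {1..N}. \<theta> i * block_cov a c b i j * \<theta> j) = block_form N a c b \<theta>"
proof -
  define p q where "p = \<theta> \<circ> Inl" and "q = \<theta> \<circ> Inr"
  have "(\<Sum>i\<in>{1..N} <+> {1..N}. \<Sum>j\<in>{1..N} <+> {1..N}. \<theta> i * block_cov a c b i j * \<theta> j)
    = (\<Sum>n=1..N. \<Sum>m=1..N. p n * (a * Sigma_cov n m) * p m)
    + (\<Sum>n=1..N. \<Sum>m=1..N. p n * (c * Sigma_cov n m) * q m)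
    + ((\<Sum>n=1..N. \<Sum>m=1..N. q n * (c * Sigma_cov n m) * p m)
    + (\<Sum>n=1..N. \<Sum>m=1..N. q n * (b * Sigma_cov n m) * q m))"
    by (simp add: sum.Plus block_cov_def sum.distrib p_def q_def)
  then show ?thesis
    unfolding sform_Sigma_cov sform_commute[of N q p] block_form_def p_def[symmetric] q_def[symmetric]
    by linarith
qed

lemma prob_space_noise_law: "prob_space (noise_law T N D)"
  unfolding noise_law_def using prob_space_Sigma_law by (intro prob_space_PiM)

lemma noise_coord_measurable:
  assumes "i \<in> {1..T} \<times> {1..D}" "n \<in> {1..N}"
  shows "(\<lambda>u. u i n) \<in> borel_measurable (noise_law T N D)"
  unfolding noise_law_def
  by (rule measurable_compose[OF measurable_component_singleton[OF assms(1)]])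
    (unfold measurable_cong_sets[OF sets_Sigma_law refl], rule measurable_component_singleton[OF assms(2)])

text \<open>Makes the positivity of the block covariance visible: for a Gram matrix the form splits
  over the coordinates \<open>d\<close> into values of the nonnegative form of Sigma.\<close>

lemma block_form_gram:
  fixes \<alpha> \<beta> :: "nat \<Rightarrow> real" and D :: nat
  shows
  "block_form N (\<Sum>d=1..D. (\<alpha> d)\<^sup>2) (\<Sum>d=1..D. \<alpha> d * \<beta> d) (\<Sum>d=1..D. (\<beta> d)\<^sup>2) \<theta>
    = (\<Sum>d=1..D. sform N (\<lambda>n. \<alpha> d * \<theta> (Inl n) + \<beta> d * \<theta> (Inr n)) (\<lambda>n. \<alpha> d * \<theta> (Inl n) + \<beta> d * \<theta> (Inr n)))"
  by (simp add: sform_add block_form_def sum.distrib sum_distrib_right sum_distrib_left o_def)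

text \<open>Independence over \<open>(t, d)\<close> factorises the expectation. The result contains
  the coefficients only through their Gram sums over \<open>d\<close>, which is why the dimension of
  the noise can later be changed.\<close>

lemma char_noise_lin:
  "(\<integral>u. iexp (\<Sum>(t, i)\<in>{1..T} \<times> ({1..N} <+> {1..N}). \<theta> (t, i) * (\<mu> t i + noise_lin D \<alpha> \<beta> u t i)) \<partial>noise_law T N D)
   = exp (\<i> * of_real (\<Sum>(t, i)\<in>{1..T} \<times> ({1..N} <+> {1..N}). \<theta> (t, i) * \<mu> t i)
       - of_real ((\<Sum>t=1..T. block_form N (\<Sum>d=1..D. (\<alpha> t d)\<^sup>2) (\<Sum>d=1..D. \<alpha> t d * \<beta> t d) (\<Sum>d=1..D. (\<beta> t d)\<^sup>2)
             (\<lambda>i. \<theta> (t, i))) / 2))"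
proof -
  let ?I = "{1..T} \<times> ({1..N} <+> {1..N})"
  let ?m = "\<Sum>(t, i)\<in>?I. \<theta> (t, i) * \<mu> t i"
  let ?S = "\<Sum>t=1..T. block_form N (\<Sum>d=1..D. (\<alpha> t d)\<^sup>2) (\<Sum>d=1..D. \<alpha> t d * \<beta> t d) (\<Sum>d=1..D. (\<beta> t d)\<^sup>2)
             (\<lambda>i. \<theta> (t, i))"
  interpret g: prob_space "Sigma_law N" by (rule prob_space_Sigma_law)
  interpret prod: product_prob_space "\<lambda>_. Sigma_law N" "{1..T} \<times> {1..D}" ..
  \<comment> \<open>What multiplies \<open>u (t, d) n\<close> after the sums over particles and
    coordinates have been exchanged; the \<open>V\<close> and \<open>W\<close> contributions of one
    noise variable merge here.\<close>
  define c where "c = (\<lambda>(t, d) n. \<alpha> t d * (\<theta> (t, Inl n)) + \<beta> t d * (\<theta> (t, Inr n)))"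
  have I: "(\<Sum>(t, i)\<in>?I. \<theta> (t, i) * (\<mu> t i + noise_lin D \<alpha> \<beta> u t i))
      = ?m + (\<Sum>td\<in>{1..T} \<times> {1..D}. \<Sum>n=1..N. c td n * u td n)" for u
  proof -
    have "(\<Sum>(t, i)\<in>?I. \<theta> (t, i) * noise_lin D \<alpha> \<beta> u t i)
      = (\<Sum>t=1..T. (\<Sum>n=1..N. \<Sum>d=1..D. \<theta> (t, Inl n) * (\<alpha> t d * u (t, d) n))
         + (\<Sum>n=1..N. \<Sum>d=1..D. \<theta> (t, Inr n) * (\<beta> t d * u (t, d) n)))"
      by (simp add: sum.cartesian_product[symmetric] sum.Plus noise_lin_def sum_distrib_left)
    also have "\<dots> = (\<Sum>t=1..T. \<Sum>d=1..D. \<Sum>n=1..N. c (t, d) n * u (t, d) n)"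
      unfolding sum.swap[of _ "{1..D}" "{1..N}"] by (simp add: c_def algebra_simps sum.distrib)
    also have "\<dots> = (\<Sum>td\<in>{1..T} \<times> {1..D}. \<Sum>n=1..N. c td n * u td n)"
      by (subst sum.cartesian_product) (simp add: case_prod_unfold)
    finally show ?thesis by (simp add: distrib_left sum.distrib case_prod_unfold)
  qed
  have e: "iexp (r + (\<Sum>td\<in>{1..T} \<times> {1..D}. s td)) = iexp r * (\<Prod>td\<in>{1..T} \<times> {1..D}. iexp (s td))" for r and s :: "nat \<times> nat \<Rightarrow> real"
    by (simp only: of_real_add distrib_left exp_add of_real_sum sum_distrib_left exp_sum finite_cartesian_product finite_atLeastAtMost)
  have "(\<integral>u. iexp (\<Sum>(t, i)\<in>?I. \<theta> (t, i) * (\<mu> t i + noise_lin D \<alpha> \<beta> u t i)) \<partial>noise_law T N D)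
     = (\<integral>u. iexp ?m * (\<Prod>td\<in>{1..T} \<times> {1..D}. iexp (\<Sum>n=1..N. c td n * u td n)) \<partial>noise_law T N D)"
    unfolding I e ..
  also have "\<dots> = iexp ?m * (\<integral>u. (\<Prod>td\<in>{1..T} \<times> {1..D}. iexp (\<Sum>n=1..N. c td n * u td n)) \<partial>noise_law T N D)"
    by (rule integral_mult_right_zero)
  also have "(\<integral>u. (\<Prod>td\<in>{1..T} \<times> {1..D}. iexp (\<Sum>n=1..N. c td n * u td n)) \<partial>noise_law T N D)
      = (\<Prod>td\<in>{1..T} \<times> {1..D}. (\<integral>v. iexp (\<Sum>n=1..N. c td n * v n) \<partial>Sigma_law N))"
    unfolding noise_law_def
  proof (rule prod.product_integral_prod)
    fix i
    have "(\<lambda>v. iexp (\<Sum>n=1..N. c i n * v n)) \<in> borel_measurable (Sigma_law N)" by measurable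
    then show "integrable (Sigma_law N) (\<lambda>v. iexp (\<Sum>n=1..N. c i n * v n))"
      by (intro g.integrable_const_bound[of _ 1] AE_I2) simp_all
  qed simp
  also have "\<dots> = (\<Prod>td\<in>{1..T} \<times> {1..D}. exp (of_real (- (sform N (c td) (c td) / 2))))"
    unfolding char_Sigma_law ..
  also have "\<dots> = exp (of_real (- (\<Sum>td\<in>{1..T} \<times> {1..D}. sform N (c td) (c td)) / 2))"
    by (simp add: exp_sum[symmetric] sum_negf sum_divide_distrib)
  also have "(\<Sum>td\<in>{1..T} \<times> {1..D}. sform N (c td) (c td)) = (\<Sum>t=1..T. \<Sum>d=1..D. sform N (c (t, d)) (c (t, d)))"
    by (simp add: sum.cartesian_product case_prod_unfold)
  also have "\<dots> = (\<Sum>t=1..T. block_form N (\<Sum>d=1..D. (\<alpha> t d)\<^sup>2) (\<Sum>d=1..D. \<alpha> t d * \<beta> t d) (\<Sum>d=1..D. (\<beta> t d)\<^sup>2)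
             (\<lambda>i. \<theta> (t, i)))"
    by (intro sum.cong refl) (simp only: c_def block_form_gram prod.case)
  also have "iexp ?m * exp (complex_of_real (- ?S / 2)) = exp (\<i> * of_real ?m - of_real (?S / 2))"
    unfolding mult_exp_exp by (rule arg_cong[of _ _ exp]) simp
  finally show ?thesis .
qed

lemma noise_lin_measurable:
  assumes "t \<in> {1..T}" "i \<in> {1..N} <+> {1..N}"
  shows "(\<lambda>u. noise_lin D \<alpha> \<beta> u t i) \<in> borel_measurable (noise_law T N D)"
  using assms unfolding noise_lin_def
  by (cases i) (auto intro!: borel_measurable_sum borel_measurable_times noise_coord_measurable)

text \<open>A covariance given by a Gram matrix is realised by linear images of noise at a single
  time, so the chosen law does satisfy its specification. The dimension \<open>D\<close> is free;
  two will be used.\<close>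

lemma is_gaussian_block_law:
  fixes \<alpha> \<beta> :: "nat \<Rightarrow> real" and D :: nat
  assumes "a = (\<Sum>d=1..D. (\<alpha> d)\<^sup>2)" "c = (\<Sum>d=1..D. \<alpha> d * \<beta> d)" "b = (\<Sum>d=1..D. (\<beta> d)\<^sup>2)"
  shows "is_gaussian_law ({1..N} <+> {1..N}) \<mu> (block_cov a c b)
    (gaussian_law ({1..N} <+> {1..N}) \<mu> (block_cov a c b))"
proof -
  let ?J = "{1..N} <+> {1..N}" and ?Q = "noise_law 1 N D"
  let ?f = "\<lambda>u. \<lambda>i\<in>?J. \<mu> i + noise_lin D (\<lambda>_. \<alpha>) (\<lambda>_. \<beta>) u 1 i"
  interpret Q: prob_space ?Q by (rule prob_space_noise_law)
  have m: "?f \<in> measurable ?Q (\<Pi>\<^sub>M i\<in>?J. borel)"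
    by (intro measurable_restrict borel_measurable_add borel_measurable_const noise_lin_measurable) auto
  have "is_gaussian_law ?J \<mu> (block_cov a c b) (distr ?Q (\<Pi>\<^sub>M i\<in>?J. borel) ?f)"
  proof (rule is_gaussian_lawI)
    show "prob_space (distr ?Q (\<Pi>\<^sub>M i\<in>?J. borel) ?f)"
      by (intro Q.prob_space_distr m)
    fix \<theta> :: "nat + nat \<Rightarrow> real"
    show "0 \<le> (\<Sum>i\<in>?J. \<Sum>j\<in>?J. \<theta> i * block_cov a c b i j * \<theta> j)"
      unfolding block_form_block_cov assms block_form_gram by (intro sum_nonneg sform_nonneg)
    have "(\<integral>x. iexp (\<Sum>i\<in>?J. \<theta> i * x i) \<partial>distr ?Q (\<Pi>\<^sub>M i\<in>?J. borel) ?f)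
        = (\<integral>u. iexp (\<Sum>i\<in>?J. \<theta> i * ?f u i) \<partial>?Q)"
      by (rule integral_distr[OF m]) measurable
    also have "\<dots> = (\<integral>u. iexp (\<Sum>(t, i)\<in>{1..1} \<times> ?J. (\<theta> \<circ> snd) (t, i) *
        (\<mu> i + noise_lin D (\<lambda>_. \<alpha>) (\<lambda>_. \<beta>) u t i)) \<partial>?Q)"
      by (simp add: sum.cartesian_product[symmetric])
    also have "\<dots> = exp (\<i> * of_real (\<Sum>i\<in>?J. \<theta> i * \<mu> i) - of_real ((\<Sum>i\<in>?J. \<Sum>j\<in>?J. \<theta> i * block_cov a c b i j * \<theta> j) / 2))"
      unfolding char_noise_lin[where \<theta>="\<theta> \<circ> snd" and \<mu>="\<lambda>_. \<mu>"] block_form_block_cov assms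
      by (simp add: sum.cartesian_product[symmetric])
    finally show "(\<integral>x. iexp (\<Sum>i\<in>?J. \<theta> i * x i) \<partial>distr ?Q (\<Pi>\<^sub>M i\<in>?J. borel) ?f)
        = exp (\<i> * of_real (\<Sum>i\<in>?J. \<theta> i * \<mu> i) - of_real ((\<Sum>i\<in>?J. \<Sum>j\<in>?J. \<theta> i * block_cov a c b i j * \<theta> j) / 2))" .
  qed simp
  then show ?thesis unfolding gaussian_law_def by (rule someI)
qed

section \<open>Joint laws over all times on one flat index set\<close>

abbreviation flat_index :: "nat \<Rightarrow> nat \<Rightarrow> (nat \<times> (nat + nat)) set" where
  "flat_index T N \<equiv> {1..T} \<times> ({1..N} <+> {1..N})"

text \<open>The uniqueness theorem concerns a single product over a finite index set, so times and
  components are merged into pairs. The restriction makes the value an element of that product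
  space.\<close>

definition flat_noise :: "nat \<Rightarrow> nat \<Rightarrow> nat \<Rightarrow> (nat \<Rightarrow> nat \<Rightarrow> real) \<Rightarrow> (nat \<Rightarrow> nat \<Rightarrow> real) \<Rightarrow>
    (nat \<Rightarrow> nat + nat \<Rightarrow> real) \<Rightarrow> (nat \<times> nat \<Rightarrow> nat \<Rightarrow> real) \<Rightarrow> nat \<times> (nat + nat) \<Rightarrow> real" where
  "flat_noise T N D \<alpha> \<beta> \<mu> u =
     (\<lambda>p\<in>flat_index T N. \<mu> (fst p) (snd p) + noise_lin D \<alpha> \<beta> u (fst p) (snd p))"

lemma flat_noise_measurable:
  "flat_noise T N D \<alpha> \<beta> \<mu> \<in> measurable (noise_law T N D) (\<Pi>\<^sub>M p\<in>flat_index T N. borel)"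
  unfolding flat_noise_def
  by (intro measurable_restrict borel_measurable_add borel_measurable_const noise_lin_measurable) auto

lemma char_flat_noise:
  "(\<integral>x. iexp (\<Sum>p\<in>flat_index T N. \<theta> p * x p)
      \<partial>distr (noise_law T N D) (\<Pi>\<^sub>M p\<in>flat_index T N. borel) (flat_noise T N D \<alpha> \<beta> \<mu>))
   = exp (\<i> * of_real (\<Sum>p\<in>flat_index T N. \<theta> p * \<mu> (fst p) (snd p))
       - of_real ((\<Sum>t=1..T. block_form N (\<Sum>d=1..D. (\<alpha> t d)\<^sup>2) (\<Sum>d=1..D. \<alpha> t d * \<beta> t d) (\<Sum>d=1..D. (\<beta> t d)\<^sup>2)
             (\<lambda>i. \<theta> (t, i))) / 2))"
proof -
  have "(\<integral>x. iexp (\<Sum>p\<in>flat_index T N. \<theta> p * x p)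
      \<partial>distr (noise_law T N D) (\<Pi>\<^sub>M p\<in>flat_index T N. borel) (flat_noise T N D \<alpha> \<beta> \<mu>))
    = (\<integral>u. iexp (\<Sum>p\<in>flat_index T N. \<theta> p * flat_noise T N D \<alpha> \<beta> \<mu> u p) \<partial>noise_law T N D)"
    by (rule integral_distr[OF flat_noise_measurable]) measurable
  also have "\<dots> = (\<integral>u. iexp (\<Sum>(t, i)\<in>flat_index T N. \<theta> (t, i) * (\<mu> t i + noise_lin D \<alpha> \<beta> u t i)) \<partial>noise_law T N D)"
  proof -
    have "(\<Sum>p\<in>flat_index T N. \<theta> p * flat_noise T N D \<alpha> \<beta> \<mu> u p)
       = (\<Sum>(t, i)\<in>flat_index T N. \<theta> (t, i) * (\<mu> t i + noise_lin D \<alpha> \<beta> u t i))" for u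
      by (intro sum.cong refl) (auto simp: flat_noise_def)
    then show ?thesis by simp
  qed
  finally show ?thesis unfolding char_noise_lin by (simp add: case_prod_unfold)
qed

text \<open>Both characteristic functions see only the Gram sums. The two dimensions may differ,
  which is how \<open>D\<close>-dimensional noise is reduced to two-dimensional noise.\<close>

lemma distr_flat_noise_eqI:
  assumes "\<And>t. t \<in> {1..T} \<Longrightarrow> (\<Sum>d=1..D. (\<alpha> t d)\<^sup>2) = (\<Sum>d=1..D'. (\<alpha>' t d)\<^sup>2)"
    and "\<And>t. t \<in> {1..T} \<Longrightarrow> (\<Sum>d=1..D. \<alpha> t d * \<beta> t d) = (\<Sum>d=1..D'. \<alpha>' t d * \<beta>' t d)"
    and "\<And>t. t \<in> {1..T} \<Longrightarrow> (\<Sum>d=1..D. (\<beta> t d)\<^sup>2) = (\<Sum>d=1..D'. (\<beta>' t d)\<^sup>2)"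
  shows "distr (noise_law T N D) (\<Pi>\<^sub>M p\<in>flat_index T N. borel) (flat_noise T N D \<alpha> \<beta> \<mu>)
       = distr (noise_law T N D') (\<Pi>\<^sub>M p\<in>flat_index T N. borel) (flat_noise T N D' \<alpha>' \<beta>' \<mu>)"
proof (rule PiM_borel_char_eqI[where I="flat_index T N"])
  show "prob_space (distr (noise_law T N D) (\<Pi>\<^sub>M p\<in>flat_index T N. borel) (flat_noise T N D \<alpha> \<beta> \<mu>))"
    by (intro prob_space.prob_space_distr prob_space_noise_law flat_noise_measurable)
  show "prob_space (distr (noise_law T N D') (\<Pi>\<^sub>M p\<in>flat_index T N. borel) (flat_noise T N D' \<alpha>' \<beta>' \<mu>))"
    by (intro prob_space.prob_space_distr prob_space_noise_law flat_noise_measurable)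
  fix \<theta> :: "nat \<times> (nat + nat) \<Rightarrow> real"
  show "(\<integral>x. iexp (\<Sum>p\<in>flat_index T N. \<theta> p * x p)
      \<partial>distr (noise_law T N D) (\<Pi>\<^sub>M p\<in>flat_index T N. borel) (flat_noise T N D \<alpha> \<beta> \<mu>))
    = (\<integral>x. iexp (\<Sum>p\<in>flat_index T N. \<theta> p * x p)
      \<partial>distr (noise_law T N D') (\<Pi>\<^sub>M p\<in>flat_index T N. borel) (flat_noise T N D' \<alpha>' \<beta>' \<mu>))"
    unfolding char_flat_noise using assms by simp
qed auto

abbreviation flatten :: "nat \<Rightarrow> nat \<Rightarrow> (nat \<Rightarrow> nat + nat \<Rightarrow> real) \<Rightarrow> nat \<times> (nat + nat) \<Rightarrow> real" where
  "flatten T N w \<equiv> (\<lambda>p\<in>flat_index T N. w (fst p) (snd p))"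

text \<open>Independent Gaussian blocks and the linear image of the noise have the same
  characteristic function. The Gram representation is assumed at every \<open>t\<close>, also
  outside \<open>{1..T}\<close>, so that each factor of the product is known to be a probability
  measure.\<close>

lemma distr_flatten_gaussian:
  fixes \<mu> :: "nat \<Rightarrow> nat + nat \<Rightarrow> real" and a b c :: "nat \<Rightarrow> real" and \<alpha> \<beta> :: "nat \<Rightarrow> nat \<Rightarrow> real" and N D T :: nat
  defines "G \<equiv> \<lambda>t. gaussian_law ({1..N} <+> {1..N}) (\<mu> t) (block_cov (a t) (c t) (b t))"
  assumes gram: "\<And>t. a t = (\<Sum>d=1..D. (\<alpha> t d)\<^sup>2)" "\<And>t. c t = (\<Sum>d=1..D. \<alpha> t d * \<beta> t d)"
    "\<And>t. b t = (\<Sum>d=1..D. (\<beta> t d)\<^sup>2)"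
  shows "prob_space (\<Pi>\<^sub>M t\<in>{1..T}. G t)"
    and "flatten T N \<in> measurable (\<Pi>\<^sub>M t\<in>{1..T}. G t) (\<Pi>\<^sub>M p\<in>flat_index T N. borel)"
    and "distr (\<Pi>\<^sub>M t\<in>{1..T}. G t) (\<Pi>\<^sub>M p\<in>flat_index T N. borel) (flatten T N)
       = distr (noise_law T N D) (\<Pi>\<^sub>M p\<in>flat_index T N. borel) (flat_noise T N D \<alpha> \<beta> \<mu>)"
proof -
  let ?J = "{1..N} <+> {1..N}"
  have G: "is_gaussian_law ?J (\<mu> t) (block_cov (a t) (c t) (b t)) (G t)" for t
    unfolding G_def by (rule is_gaussian_block_law[OF gram])
  have pG: "prob_space (G t)" for t by (rule is_gaussian_law_prob_space[OF G])
  have sG: "sets (G t) = sets (\<Pi>\<^sub>M i\<in>?J. borel)" for t using G[of t] by (simp add: is_gaussian_law_def)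
  show P: "prob_space (\<Pi>\<^sub>M t\<in>{1..T}. G t)" by (intro prob_space_PiM pG)
  have coord: "(\<lambda>w. w t i) \<in> borel_measurable (\<Pi>\<^sub>M t\<in>{1..T}. G t)" if "t \<in> {1..T}" "i \<in> ?J" for t i
    by (rule measurable_compose[OF measurable_component_singleton[OF that(1)]])
      (unfold measurable_cong_sets[OF sG refl], rule measurable_component_singleton[OF that(2)])
  show m: "flatten T N \<in> measurable (\<Pi>\<^sub>M t\<in>{1..T}. G t) (\<Pi>\<^sub>M p\<in>flat_index T N. borel)"
    by (intro measurable_restrict coord) auto
  show "distr (\<Pi>\<^sub>M t\<in>{1..T}. G t) (\<Pi>\<^sub>M p\<in>flat_index T N. borel) (flatten T N)
       = distr (noise_law T N D) (\<Pi>\<^sub>M p\<in>flat_index T N. borel) (flat_noise T N D \<alpha> \<beta> \<mu>)"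
  proof (rule PiM_borel_char_eqI[where I="flat_index T N"])
    show "prob_space (distr (\<Pi>\<^sub>M t\<in>{1..T}. G t) (\<Pi>\<^sub>M p\<in>flat_index T N. borel) (flatten T N))"
      by (intro prob_space.prob_space_distr P m)
    show "prob_space (distr (noise_law T N D) (\<Pi>\<^sub>M p\<in>flat_index T N. borel) (flat_noise T N D \<alpha> \<beta> \<mu>))"
      by (intro prob_space.prob_space_distr prob_space_noise_law flat_noise_measurable)
    fix \<theta> :: "nat \<times> (nat + nat) \<Rightarrow> real"
    let ?q = "\<lambda>t. block_form N (a t) (c t) (b t) (\<lambda>i. \<theta> (t, i))"
    interpret prod: product_prob_space G "{1..T}" using pG by (simp add: product_prob_spaceI)
    have q: "0 \<le> ?q t" for t
      unfolding gram block_form_gram by (intro sum_nonneg sform_nonneg)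
    have lin: "(\<Sum>p\<in>flat_index T N. \<theta> p * flatten T N w p) = (\<Sum>t=1..T. \<Sum>i\<in>?J. \<theta> (t, i) * w t i)" for w
      unfolding sum.cartesian_product by (intro sum.cong refl) auto
    have lin': "(\<Sum>p\<in>flat_index T N. \<theta> p * \<mu> (fst p) (snd p)) = (\<Sum>t=1..T. \<Sum>i\<in>?J. \<theta> (t, i) * \<mu> t i)"
      unfolding sum.cartesian_product by (intro sum.cong refl) auto
    have "(\<integral>x. iexp (\<Sum>p\<in>flat_index T N. \<theta> p * x p)
        \<partial>distr (\<Pi>\<^sub>M t\<in>{1..T}. G t) (\<Pi>\<^sub>M p\<in>flat_index T N. borel) (flatten T N))
      = (\<integral>w. iexp (\<Sum>p\<in>flat_index T N. \<theta> p * flatten T N w p) \<partial>(\<Pi>\<^sub>M t\<in>{1..T}. G t))"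
      by (rule integral_distr[OF m]) measurable
    also have "\<dots> = (\<integral>w. (\<Prod>t=1..T. iexp (\<Sum>i\<in>?J. \<theta> (t, i) * w t i)) \<partial>(\<Pi>\<^sub>M t\<in>{1..T}. G t))"
      unfolding lin of_real_sum[of _ "{1..T}"]
      by (simp only: sum_distrib_left[of _ _ "{1..T}"] exp_sum[of "{1..T}"] finite_atLeastAtMost)
    also have "\<dots> = (\<Prod>t=1..T. (\<integral>v. iexp (\<Sum>i\<in>?J. \<theta> (t, i) * v i) \<partial>G t))"
    proof (rule prod.product_integral_prod)
      fix t
      note [measurable_cong] = sG
      show "integrable (G t) (\<lambda>v. iexp (\<Sum>i\<in>?J. \<theta> (t, i) * v i))"
        by (intro finite_measure.integrable_const_bound[of _ _ 1] prob_space.finite_measure pG) auto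
    qed simp
    also have "\<dots> = (\<Prod>t=1..T. exp (\<i> * of_real (\<Sum>i\<in>?J. \<theta> (t, i) * \<mu> t i) - of_real (?q t / 2)))"
      by (intro prod.cong refl)
        (subst is_gaussian_lawD[OF G, of "\<lambda>i. \<theta> (_, i)"], unfold block_form_block_cov, auto intro: q)
    also have "\<dots> = exp (\<i> * of_real (\<Sum>p\<in>flat_index T N. \<theta> p * \<mu> (fst p) (snd p)) - of_real ((\<Sum>t=1..T. ?q t) / 2))"
      unfolding lin' exp_sum[OF finite_atLeastAtMost, symmetric]
      by (simp add: sum_subtractf sum_distrib_left sum_divide_distrib)
    finally show "(\<integral>x. iexp (\<Sum>p\<in>flat_index T N. \<theta> p * x p)
        \<partial>distr (\<Pi>\<^sub>M t\<in>{1..T}. G t) (\<Pi>\<^sub>M p\<in>flat_index T N. borel) (flatten T N))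
      = (\<integral>x. iexp (\<Sum>p\<in>flat_index T N. \<theta> p * x p)
      \<partial>distr (noise_law T N D) (\<Pi>\<^sub>M p\<in>flat_index T N. borel) (flat_noise T N D \<alpha> \<beta> \<mu>))"
      unfolding char_flat_noise gram .
  qed auto
qed

section \<open>Selection functions\<close>

text \<open>Changing all exponents by at most \<delta> changes the sum at most by the factor
  \<open>exp \<delta>\<close>. One nonnegative exponent keeps both sums above 1, so the reciprocals
  differ by at most \<open>1 - exp (- \<delta>)\<close>, which is at most \<delta>. No bound on the
  other exponents enters.\<close>

lemma inverse_exp_sum_lipschitz:
  fixes a b :: "'i \<Rightarrow> real"
  assumes S: "finite S" and i: "i \<in> S" "0 \<le> a i" "0 \<le> b i" and d: "\<And>m. m \<in> S \<Longrightarrow> \<bar>a m - b m\<bar> \<le> \<delta>"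
  shows "\<bar>1 / (\<Sum>m\<in>S. exp (a m)) - 1 / (\<Sum>m\<in>S. exp (b m))\<bar> \<le> \<delta>"
proof -
  have *: "1 / (\<Sum>m\<in>S. exp (a m)) - 1 / (\<Sum>m\<in>S. exp (b m)) \<le> \<delta>"
    if "0 \<le> a i" "0 \<le> b i" and d: "\<And>m. m \<in> S \<Longrightarrow> \<bar>a m - b m\<bar> \<le> \<delta>" for a b :: "'i \<Rightarrow> real"
  proof -
    let ?A = "\<Sum>m\<in>S. exp (a m)" and ?B = "\<Sum>m\<in>S. exp (b m)"
    have ge: "1 \<le> (\<Sum>m\<in>S. exp (c m))" if "0 \<le> c i" for c :: "'i \<Rightarrow> real"
    proof -
      have "1 \<le> exp (c i)" using that by simp
      also have "\<dots> \<le> (\<Sum>m\<in>S. exp (c m))" using i S by (intro member_le_sum) auto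
      finally show ?thesis .
    qed
    note A = ge[of a, OF that(1)] and B = ge[of b, OF that(2)]
    have "?B \<le> (\<Sum>m\<in>S. exp \<delta> * exp (a m))"
      by (intro sum_mono) (use d in \<open>force simp flip: exp_add\<close>)
    also have "\<dots> = exp \<delta> * ?A" by (simp add: sum_distrib_left)
    finally have "exp (- \<delta>) / ?A \<le> 1 / ?B"
      using A B by (simp add: field_simps exp_minus)
    then have "1 / ?A - 1 / ?B \<le> (1 - exp (- \<delta>)) / ?A" by (simp add: diff_divide_distrib)
    also have "\<dots> \<le> \<delta> / ?A"
      using exp_ge_add_one_self[of "- \<delta>"] A by (intro divide_right_mono) auto
    also have "\<dots> \<le> \<delta>"
      using A d[OF i(1)] abs_ge_zero[of "a i - b i"]
      by (intro order_trans[OF divide_left_mono[of 1 ?A \<delta>]]) linarith+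
    finally show ?thesis .
  qed
  show ?thesis using *[of a b] *[of b a] i d by (simp add: abs_le_iff abs_minus_commute)
qed

text \<open>Dividing by the numerator brings the selection probability into the form of
  \<open>inverse_exp_sum_lipschitz\<close>: the summand at \<open>m = n\<close> has exponent
  0.\<close>

lemma Psi_eq:
  assumes "n \<le> N"
  shows "Psi N h n = 1 / (\<Sum>m=0..N. exp ((h(0 := 0)) m - (h(0 := 0)) n))"
proof -
  have "(\<Sum>m=0..N. exp ((h(0 := 0)) m - (h(0 := 0)) n)) = (\<Sum>m=0..N. exp ((h(0 := 0)) m)) / exp ((h(0 := 0)) n)"
    by (simp only: exp_diff sum_divide_distrib)
  also have "(\<Sum>m=0..N. exp ((h(0 := 0)) m)) = 1 + (\<Sum>m=1..N. exp (h m))"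
    by (simp add: sum.atLeast_Suc_atMost)
  finally show ?thesis by (simp add: Psi_def)
qed

lemma Psi_nonneg: "0 \<le> Psi N h n"
  by (simp add: Psi_def sum_nonneg add_nonneg_nonneg)

lemma sum_Psi: "(\<Sum>n=0..N. Psi N h n) = 1"
proof -
  have "(\<Sum>m=0..N. exp ((h(0 := 0)) m)) = 1 + (\<Sum>m=1..N. exp (h m))"
    by (simp add: sum.atLeast_Suc_atMost)
  moreover have "0 < 1 + (\<Sum>m=1..N. exp (h m))" by (simp add: sum_nonneg add_pos_nonneg)
  ultimately show ?thesis by (simp add: Psi_def flip: sum_divide_distrib)
qed

lemma Psi_lipschitz:
  assumes "n \<le> N"
  shows "\<bar>Psi N h n - Psi N h' n\<bar> \<le> 2 * (\<Sum>m=1..N. \<bar>h m - h' m\<bar>)"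
  unfolding Psi_eq[OF assms]
proof (rule inverse_exp_sum_lipschitz)
  fix m assume m: "m \<in> {0..N}"
  have *: "\<bar>(h(0 := 0)) m - (h'(0 := 0)) m\<bar> \<le> (\<Sum>m=1..N. \<bar>h m - h' m\<bar>)" if "m \<le> N" for m
    using that member_le_sum[of m "{1..N}" "\<lambda>m. \<bar>h m - h' m\<bar>"] by (cases "m = 0") (auto simp: sum_nonneg)
  show "\<bar>(h(0 := 0)) m - (h(0 := 0)) n - ((h'(0 := 0)) m - (h'(0 := 0)) n)\<bar> \<le> 2 * (\<Sum>m=1..N. \<bar>h m - h' m\<bar>)"
    using *[OF assms] *[of m] m by (auto simp del: fun_upd_apply)
qed (use assms in auto)

text \<open>The own contribution \<open>1 - min 1 (exp (h n)) + exp (h n)\<close> to the denominator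
  is the maximum of 1 and \<open>exp (h n)\<close>. Divided by \<open>exp (h n)\<close> it is the
  exponential of \<open>max (- h n) 0\<close>, the nonnegative exponent that
  \<open>inverse_exp_sum_lipschitz\<close> asks for.\<close>

lemma Phi_pos_eq:
  assumes "n \<in> {1..N}"
  shows "Phi_pos N h n = 1 / (\<Sum>m=1..N. exp (if m = n then max (- h n) 0 else h m - h n))"
proof -
  have "(\<Sum>m=1..N. exp (if m = n then max (- h n) 0 else h m - h n))
    = exp (max (- h n) 0) + (\<Sum>m\<in>{1..N} - {n}. exp (h m - h n))"
    using assms by (subst sum.remove[of _ n]) auto
  also have "\<dots> = (exp (h n) * exp (max (- h n) 0) + (\<Sum>m\<in>{1..N} - {n}. exp (h m))) / exp (h n)"
    by (simp add: exp_diff add_divide_distrib sum_divide_distrib)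
  also have "exp (h n) * exp (max (- h n) 0) = 1 - min 1 (exp (h n)) + exp (h n)"
    by (auto simp: max_def min_def simp flip: exp_add)
  also have "1 - min 1 (exp (h n)) + exp (h n) + (\<Sum>m\<in>{1..N} - {n}. exp (h m))
     = 1 - min 1 (exp (h n)) + (\<Sum>m=1..N. exp (h m))"
    using assms by (subst (2) sum.remove[of _ n]) auto
  finally show ?thesis by (simp add: Phi_pos_def)
qed

lemma Phi_pos_nonneg: "0 \<le> Phi_pos N h n"
  by (auto simp: Phi_pos_def intro!: divide_nonneg_nonneg add_nonneg_nonneg sum_nonneg)

text \<open>Each denominator is at least the sum of the exponentials, so the forced-move
  probabilities lie below the normalised weights of the particles 1, ..., N. Hence the remaining
  mass at index 0 is nonnegative.\<close>

lemma sum_Phi_pos_le: "(\<Sum>n=1..N. Phi_pos N h n) \<le> 1"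
proof (cases "N = 0")
  case False
  let ?s = "\<Sum>m=1..N. exp (h m)"
  have "0 < ?s" using False by (intro sum_pos) auto
  then have "Phi_pos N h n \<le> exp (h n) / ?s" for n
    unfolding Phi_pos_def by (intro divide_left_mono mult_pos_pos) (auto simp: add_nonneg_pos)
  then have "(\<Sum>n=1..N. Phi_pos N h n) \<le> (\<Sum>n=1..N. exp (h n) / ?s)" by (intro sum_mono)
  also have "\<dots> = 1" using \<open>0 < ?s\<close> by (simp flip: sum_divide_distrib)
  finally show ?thesis .
qed simp

lemma Phi_pos_lipschitz:
  assumes "n \<in> {1..N}"
  shows "\<bar>Phi_pos N h n - Phi_pos N h' n\<bar> \<le> 2 * (\<Sum>m=1..N. \<bar>h m - h' m\<bar>)"
  unfolding Phi_pos_eq[OF assms]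
proof (rule inverse_exp_sum_lipschitz)
  fix m assume m: "m \<in> {1..N}"
  have *: "\<bar>h m - h' m\<bar> \<le> (\<Sum>m=1..N. \<bar>h m - h' m\<bar>)" if "m \<in> {1..N}" for m
    using that by (intro member_le_sum[of m "{1..N}" "\<lambda>m. \<bar>h m - h' m\<bar>"]) auto
  show "\<bar>(if m = n then max (- h n) 0 else h m - h n) - (if m = n then max (- h' n) 0 else h' m - h' n)\<bar>
       \<le> 2 * (\<Sum>m=1..N. \<bar>h m - h' m\<bar>)"
    using *[OF assms] *[OF m] by (auto simp: max_def)
qed (use assms in auto)

lemma Phi_nonneg: "0 \<le> Phi N h n"
  using sum_Phi_pos_le[of N h] Phi_pos_nonneg by (simp add: Phi_def)

lemma sum_Phi: "(\<Sum>n=0..N. Phi N h n) = 1"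
  by (simp add: sum.atLeast_Suc_atMost Phi_def)

text \<open>Index 0 receives what the others leave and accumulates their \<open>N\<close> Lipschitz
  constants; the constant is chosen to cover both cases.\<close>

lemma Phi_lipschitz:
  assumes "n \<le> N"
  shows "\<bar>Phi N h n - Phi N h' n\<bar> \<le> 2 * (real N + 1) * (\<Sum>m=1..N. \<bar>h m - h' m\<bar>)"
proof -
  let ?s = "\<Sum>m=1..N. \<bar>h m - h' m\<bar>"
  have s: "0 \<le> ?s" by (simp add: sum_nonneg)
  show ?thesis
  proof (cases "n = 0")
    case True
    have "\<bar>Phi N h n - Phi N h' n\<bar> = \<bar>\<Sum>k=1..N. (Phi_pos N h' k - Phi_pos N h k)\<bar>"
      using True by (simp add: Phi_def sum_subtractf)
    also have "\<dots> \<le> (\<Sum>k=1..N. \<bar>Phi_pos N h' k - Phi_pos N h k\<bar>)" by (rule sum_abs)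
    also have "\<dots> \<le> (\<Sum>k=1..N. 2 * ?s)"
      by (intro sum_mono) (use Phi_pos_lipschitz[of _ N h h'] in \<open>simp add: abs_minus_commute\<close>)
    also have "\<dots> \<le> 2 * (real N + 1) * ?s" using s by (simp add: algebra_simps)
    finally show ?thesis .
  next
    case False
    then have "\<bar>Phi N h n - Phi N h' n\<bar> \<le> 2 * ?s"
      using Phi_pos_lipschitz[of n N h h'] assms by (simp add: Phi_def)
    also have "\<dots> \<le> 2 * (real N + 1) * ?s" using s by (intro mult_right_mono) auto
    finally show ?thesis .
  qed
qed

lemma pmf_index_pmf:
  assumes "\<And>n. n \<le> N \<Longrightarrow> 0 \<le> p n" "(\<Sum>n=0..N. p n) = 1"
  shows "pmf (index_pmf N p) n = (if n \<le> N then p n else 0)"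
  unfolding index_pmf_def
proof (rule pmf_embed_pmf)
  show "0 \<le> (if n \<le> N then p n else 0)" for n using assms by simp
  have "(\<integral>\<^sup>+n. ennreal (if n \<le> N then p n else 0) \<partial>count_space UNIV) = (\<Sum>n=0..N. ennreal (p n))"
    by (subst nn_integral_count_space'[of "{0..N}"]) auto
  also have "\<dots> = ennreal (\<Sum>n=0..N. p n)" using assms by (intro sum_ennreal) auto
  finally show "(\<integral>\<^sup>+n. ennreal (if n \<le> N then p n else 0) \<partial>count_space UNIV) = 1"
    using assms by simp
qed

lemma pmf_Psi: "pmf (index_pmf N (Psi N h)) n = (if n \<le> N then Psi N h n else 0)"
  by (intro pmf_index_pmf Psi_nonneg sum_Psi)

lemma pmf_final: "pmf (final_pmf fm N h) n = (if n \<le> N then if fm then Phi N h n else Psi N h n else 0)"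
  unfolding final_pmf_def by (subst pmf_index_pmf) (auto simp: Psi_nonneg sum_Psi Phi_nonneg sum_Phi)

lemma pmf_Psi_lipschitz:
  "\<bar>pmf (index_pmf N (Psi N h)) n - pmf (index_pmf N (Psi N h')) n\<bar>
    \<le> 2 * (real N + 1) * (\<Sum>m=1..N. \<bar>h m - h' m\<bar>)"
proof -
  have s: "0 \<le> (\<Sum>m=1..N. \<bar>h m - h' m\<bar>)" by (simp add: sum_nonneg)
  then have "2 * (\<Sum>m=1..N. \<bar>h m - h' m\<bar>) \<le> 2 * (real N + 1) * (\<Sum>m=1..N. \<bar>h m - h' m\<bar>)"
    by (intro mult_right_mono) auto
  moreover have "0 \<le> 2 * (real N + 1) * (\<Sum>m=1..N. \<bar>h m - h' m\<bar>)" using s by simp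
  ultimately show ?thesis
    using Psi_lipschitz[of n N h h'] unfolding pmf_Psi by (cases "n \<le> N") (simp_all del: One_nat_def)
qed

lemma pmf_final_lipschitz:
  "\<bar>pmf (final_pmf fm N h) n - pmf (final_pmf fm N h') n\<bar>
    \<le> 2 * (real N + 1) * (\<Sum>m=1..N. \<bar>h m - h' m\<bar>)"
proof (cases fm)
  case True
  have "0 \<le> 2 * (real N + 1) * (\<Sum>m=1..N. \<bar>h m - h' m\<bar>)" by (simp add: sum_nonneg)
  with True show ?thesis
    using Phi_lipschitz[of n N h h'] unfolding pmf_final by (cases "n \<le> N") (simp_all del: One_nat_def)
next
  case False
  then show ?thesis using pmf_Psi_lipschitz[of N h n h'] by (simp add: final_pmf_def del: One_nat_def)
qed

lemma categorical_eq_Psi: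
  assumes "\<And>m. m \<le> N \<Longrightarrow> 0 < \<omega> m"
  shows "categorical_pmf N \<omega> = index_pmf N (Psi N (\<lambda>m. ln (\<omega> m) - ln (\<omega> 0)))"
proof -
  let ?h = "\<lambda>m. ln (\<omega> m) - ln (\<omega> 0)"
  have e: "exp ((?h(0 := 0)) n) = \<omega> n / \<omega> 0" if "n \<le> N" for n
    using assms[OF that] assms[of 0] by (auto simp: exp_diff)
  have "Psi N ?h n = \<omega> n / (\<Sum>m=0..N. \<omega> m)" if n: "n \<le> N" for n
  proof -
    have "1 + (\<Sum>m=1..N. exp (?h m)) = (\<Sum>m=0..N. exp ((?h(0 := 0)) m))"
      by (simp add: sum.atLeast_Suc_atMost)
    also have "\<dots> = (\<Sum>m=0..N. \<omega> m / \<omega> 0)"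
      by (intro sum.cong refl) (use e in auto)
    finally have "Psi N ?h n = (\<omega> n / \<omega> 0) / ((\<Sum>m=0..N. \<omega> m) / \<omega> 0)"
      unfolding Psi_def e[OF n] by (simp add: sum_divide_distrib)
    then show ?thesis using assms[of 0] by simp
  qed
  then show ?thesis
    unfolding categorical_pmf_def index_pmf_def by (intro arg_cong[of _ _ embed_pmf] ext) auto
qed

section \<open>The law of the indices\<close>

text \<open>Entry \<open>t\<close> has the fixed value \<open>z\<close> before it is overwritten, so
  only \<open>g(t := z)\<close> can lead to \<open>g\<close>. The sum over intermediate states has
  one term, and the probability of a full index configuration becomes a product of selection
  probabilities.\<close>

lemma pmf_bind_update:
  assumes "\<And>f. f \<in> set_pmf p \<Longrightarrow> f t = z"
  shows "pmf (bind_pmf p (\<lambda>f. bind_pmf (q f) (\<lambda>v. return_pmf (f(t := v))))) g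
       = pmf p (g(t := z)) * pmf (q (g(t := z))) (g t)"
proof -
  let ?F = "\<lambda>f. bind_pmf (q f) (\<lambda>v. return_pmf (f(t := v)))"
  let ?g = "g(t := z)"
  have F: "pmf (?F f) g = indicator {?g} f * pmf (q ?g) (g t)" if "f \<in> set_pmf p" for f
  proof (cases "f = ?g")
    case True
    have "inj (\<lambda>v. f(t := v))" by (auto intro!: injI dest: fun_cong[of _ _ t])
    then have "pmf (map_pmf (\<lambda>v. f(t := v)) (q f)) (f(t := g t)) = pmf (q f) (g t)"
      by (rule pmf_map_inj')
    moreover have "f(t := g t) = g" using True by auto
    ultimately show ?thesis using True by (simp add: map_pmf_def)
  next
    case False
    have "g \<notin> set_pmf (?F f)" using assms[OF that] False by auto
    then show ?thesis using False by (simp add: set_pmf_eq)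
  qed
  have "pmf (bind_pmf p ?F) g = (\<integral>f. indicator {?g} f * pmf (q ?g) (g t) \<partial>measure_pmf p)"
    unfolding pmf_bind[of p] by (intro integral_cong_AE) (auto simp: AE_measure_pmf_iff F)
  then show ?thesis by (simp add: measure_pmf_single)
qed

lemma pmf_bind_Pair:
  "pmf (bind_pmf p (\<lambda>x. bind_pmf (q x) (\<lambda>y. return_pmf (x, y)))) (a, b) = pmf p a * pmf (q a) b"
proof -
  let ?F = "\<lambda>x. bind_pmf (q x) (\<lambda>y. return_pmf (x, y))"
  have F: "pmf (?F x) (a, b) = indicator {a} x * pmf (q a) b" for x
  proof (cases "x = a")
    case True
    have "pmf (map_pmf (Pair x) (q x)) (x, b) = pmf (q x) b"
      by (rule pmf_map_inj') (auto intro: injI)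
    then show ?thesis using True by (simp add: map_pmf_def)
  next
    case False
    then have "(a, b) \<notin> set_pmf (?F x)" by auto
    then show ?thesis using False by (simp add: set_pmf_eq)
  qed
  show ?thesis unfolding pmf_bind[of p] F by (simp add: measure_pmf_single)
qed

lemma ancestor_pmf_support:
  assumes "\<And>t a. set_pmf (R t a) \<subseteq> {..N}" "A \<in> set_pmf (ancestor_pmf N R t)"
  shows "A s n \<le> N" and "s \<notin> {1..t} \<Longrightarrow> A s = (\<lambda>_. 0)" and "n \<notin> {1..N} \<Longrightarrow> A s n = 0"
proof -
  have "A s n \<le> N \<and> (s \<notin> {1..t} \<longrightarrow> A s = (\<lambda>_. 0)) \<and> (n \<notin> {1..N} \<longrightarrow> A s n = 0)"
    using assms(2)
  proof (induction t arbitrary: A)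
    case (Suc t)
    obtain A' a where A': "A' \<in> set_pmf (ancestor_pmf N R t)" and a: "a \<in> set_pmf (Pi_pmf {1..N} 0 (\<lambda>_. R (Suc t) (A' t)))"
      and A: "A = A'(Suc t := a)" using Suc.prems by auto
    have "a n \<le> N \<and> (n \<notin> {1..N} \<longrightarrow> a n = 0)"
      using a assms(1)[of "Suc t" "A' t"]
      by (cases "n \<in> {1..N}") (auto simp: set_Pi_pmf PiE_dflt_def)
    then show ?case using Suc.IH[OF A'] by (auto simp: A)
  qed simp
  then show "A s n \<le> N" "s \<notin> {1..t} \<Longrightarrow> A s = (\<lambda>_. 0)" "n \<notin> {1..N} \<Longrightarrow> A s n = 0" by auto
qed

lemma ancestor_pmf_eq_0:
  assumes "A \<in> set_pmf (ancestor_pmf N R t)"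
  shows "t < s \<Longrightarrow> A s = (\<lambda>_. 0)" and "A s 0 = 0"
proof -
  have "(t < s \<longrightarrow> A s = (\<lambda>_. 0)) \<and> A s 0 = 0" using assms
  proof (induction t arbitrary: A)
    case (Suc t)
    obtain A' a where A': "A' \<in> set_pmf (ancestor_pmf N R t)" and a: "a \<in> set_pmf (Pi_pmf {1..N} 0 (\<lambda>_. R (Suc t) (A' t)))"
      and A: "A = A'(Suc t := a)" using Suc.prems by auto
    have "a 0 = 0" using a by (auto simp: set_Pi_pmf PiE_dflt_def)
    then show ?case using Suc.IH[OF A'] by (auto simp: A)
  qed simp
  then show "t < s \<Longrightarrow> A s = (\<lambda>_. 0)" "A s 0 = 0" by auto
qed

lemma pmf_ancestor_Suc:
  "pmf (ancestor_pmf N R (Suc t)) A = pmf (ancestor_pmf N R t) (A(Suc t := (\<lambda>_. 0))) *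
     (if \<forall>n. n \<notin> {1..N} \<longrightarrow> A (Suc t) n = 0 then \<Prod>n=1..N. pmf (R (Suc t) (A t)) (A (Suc t) n) else 0)"
  by (simp add: pmf_bind_update[where z="\<lambda>_. 0"] ancestor_pmf_eq_0 pmf_Pi del: One_nat_def)

lemma abs_mult_diff_le:
  fixes x y x' y' :: real
  assumes "\<bar>x\<bar> \<le> 1" "\<bar>y'\<bar> \<le> 1"
  shows "\<bar>x * y - x' * y'\<bar> \<le> \<bar>x - x'\<bar> + \<bar>y - y'\<bar>"
proof -
  have "x * y - x' * y' = x * (y - y') + (x - x') * y'" by (simp add: algebra_simps)
  also have "\<bar>\<dots>\<bar> \<le> \<bar>x\<bar> * \<bar>y - y'\<bar> + \<bar>x - x'\<bar> * \<bar>y'\<bar>"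
    by (metis abs_triangle_ineq abs_mult)
  also have "\<dots> \<le> 1 * \<bar>y - y'\<bar> + \<bar>x - x'\<bar> * 1" using assms by (intro add_mono mult_mono) auto
  finally show ?thesis by simp
qed

lemma abs_pmf_le_1: "\<bar>pmf p x\<bar> \<le> 1"
  by (simp add: pmf_le_1)

text \<open>A product of numbers in [0, 1] changes at most by the sum of the changes of its factors.
  Both laws are evaluated at the same configuration \<open>A\<close>, so the ancestors that enter
  the weights agree on the two sides.\<close>

lemma ancestor_pmf_diff_le:
  "\<bar>pmf (ancestor_pmf N R t) A - pmf (ancestor_pmf N R' t) A\<bar>
    \<le> (\<Sum>s=1..t. \<Sum>n=1..N. \<bar>pmf (R s (A (s - 1))) (A s n) - pmf (R' s (A (s - 1))) (A s n)\<bar>)"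
proof (induction t arbitrary: A)
  case (Suc t)
  let ?A = "A(Suc t := (\<lambda>_. 0))"
  let ?P = "\<lambda>R. if \<forall>n. n \<notin> {1..N} \<longrightarrow> A (Suc t) n = 0 then \<Prod>n=1..N. pmf (R (Suc t) (A t)) (A (Suc t) n) else 0"
  have P1: "\<bar>?P R'\<bar> \<le> 1" by (auto simp: abs_prod pmf_le_1 intro!: prod_le_1)
  have "\<bar>pmf (ancestor_pmf N R (Suc t)) A - pmf (ancestor_pmf N R' (Suc t)) A\<bar>
    \<le> \<bar>pmf (ancestor_pmf N R t) ?A - pmf (ancestor_pmf N R' t) ?A\<bar> + \<bar>?P R - ?P R'\<bar>"
    unfolding pmf_ancestor_Suc by (rule abs_mult_diff_le[OF abs_pmf_le_1 P1])
  also have "\<bar>pmf (ancestor_pmf N R t) ?A - pmf (ancestor_pmf N R' t) ?A\<bar>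
     \<le> (\<Sum>s=1..t. \<Sum>n=1..N. \<bar>pmf (R s (?A (s - 1))) (?A s n) - pmf (R' s (?A (s - 1))) (?A s n)\<bar>)"
    by (rule Suc.IH)
  also have "\<dots> = (\<Sum>s=1..t. \<Sum>n=1..N. \<bar>pmf (R s (A (s - 1))) (A s n) - pmf (R' s (A (s - 1))) (A s n)\<bar>)"
    by (intro sum.cong refl) auto
  also have "\<bar>?P R - ?P R'\<bar> \<le> (\<Sum>n=1..N. \<bar>pmf (R (Suc t) (A t)) (A (Suc t) n) - pmf (R' (Suc t) (A t)) (A (Suc t) n)\<bar>)"
    using norm_prod_diff[of "{1..N}" "\<lambda>n. pmf (R (Suc t) (A t)) (A (Suc t) n)" "\<lambda>n. pmf (R' (Suc t) (A t)) (A (Suc t) n)"]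
    by (auto simp: pmf_le_1 sum_nonneg)
  finally show ?case by simp
qed simp

lemma backward_pmf_support:
  assumes "K \<in> set_pmf (backward_pmf bs T S B A j)" "j < T"
  shows "s < T - j \<or> T < s \<Longrightarrow> K s = 0"
proof -
  have "s < T - j \<or> T < s \<longrightarrow> K s = 0" using assms
  proof (induction j arbitrary: K)
    case (Suc j)
    then obtain K' k where "K' \<in> set_pmf (backward_pmf bs T S B A j)" "K = K'(T - Suc j := k)"
      by (auto simp: Let_def)
    then show ?case using Suc.IH[of K'] Suc.prems(2) by auto
  qed auto
  then show "s < T - j \<or> T < s \<Longrightarrow> K s = 0" by auto
qed

lemma backward_pmf_le:
  assumes "\<And>a. set_pmf (S a) \<subseteq> {..N}" "\<And>t a k. set_pmf (B t a k) \<subseteq> {..N}" "\<And>t n. A t n \<le> N"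
    and "K \<in> set_pmf (backward_pmf bs T S B A j)"
  shows "K s \<le> N"
  using assms(4)
proof (induction j arbitrary: K)
  case 0
  then show ?case using assms(1)[of "A (T - 1)"] by auto
next
  case (Suc j)
  then obtain K' k where "K' \<in> set_pmf (backward_pmf bs T S B A j)" and K: "K = K'(T - Suc j := k)"
    and k: "k \<in> set_pmf (if bs then B (T - Suc j) (A (T - Suc j - 1)) (K' (T - Suc j + 1))
        else return_pmf (A (T - Suc j) (K' (T - Suc j + 1))))"
    by (auto simp: Let_def)
  have "k \<le> N" using k assms(2)[of "T - Suc j" "A (T - Suc j - 1)" "K' (T - Suc j + 1)"] assms(3)
    by (auto split: if_splits)
  then show ?case using Suc.IH[of K'] \<open>K' \<in> _\<close> by (simp add: K)
qed

lemma pmf_backward_0: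
  "pmf (backward_pmf bs T S B A 0) K = pmf (return_pmf (\<lambda>_. 0)) (K(T := 0)) * pmf (S (A (T - 1))) (K T)"
  using pmf_bind_update[of "return_pmf (\<lambda>_. 0)" T 0 "\<lambda>_. S (A (T - 1))" K]
  by (simp add: bind_return_pmf map_pmf_def)

lemma pmf_backward_Suc:
  assumes "Suc j < T"
  shows "pmf (backward_pmf bs T S B A (Suc j)) K = pmf (backward_pmf bs T S B A j) (K(T - Suc j := 0)) *
     pmf (if bs then B (T - Suc j) (A (T - Suc j - 1)) (K (T - Suc j + 1)) else return_pmf (A (T - Suc j) (K (T - Suc j + 1)))) (K (T - Suc j))"
proof -
  have s: "f (T - Suc j) = 0" if "f \<in> set_pmf (backward_pmf bs T S B A j)" for f
    by (rule backward_pmf_support[OF that]) (use assms in auto)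
  show ?thesis
    unfolding backward_pmf.simps Let_def
    by (subst pmf_bind_update[where z=0]) (use assms s in auto)
qed

text \<open>The same telescoping as for the ancestors. Without backward sampling the step is
  deterministic and common to both laws; the terms with \<open>B\<close> then merely enlarge the
  bound, and one estimate serves both versions.\<close>

lemma backward_pmf_diff_le:
  assumes "j < T"
  shows "\<bar>pmf (backward_pmf bs T S B A j) K - pmf (backward_pmf bs T S' B' A j) K\<bar>
    \<le> \<bar>pmf (S (A (T - 1))) (K T) - pmf (S' (A (T - 1))) (K T)\<bar> +
      (\<Sum>t=T-j..<T. \<bar>pmf (B t (A (t - 1)) (K (t + 1))) (K t) - pmf (B' t (A (t - 1)) (K (t + 1))) (K t)\<bar>)"
  using assms
proof (induction j arbitrary: K)
  case 0
  show ?case unfolding pmf_backward_0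
    by (rule order_trans[OF abs_mult_diff_le[OF abs_pmf_le_1 abs_pmf_le_1]]) simp
next
  case (Suc j)
  let ?t = "T - Suc j"
  let ?K = "K(?t := 0)"
  let ?d = "\<lambda>K t. \<bar>pmf (B t (A (t - 1)) (K (t + 1))) (K t) - pmf (B' t (A (t - 1)) (K (t + 1))) (K t)\<bar>"
  have set: "{?t..<T} = insert ?t {T-j..<T}" using Suc.prems by auto
  have "\<bar>pmf (backward_pmf bs T S B A (Suc j)) K - pmf (backward_pmf bs T S' B' A (Suc j)) K\<bar>
    \<le> \<bar>pmf (backward_pmf bs T S B A j) ?K - pmf (backward_pmf bs T S' B' A j) ?K\<bar> + ?d K ?t"
    unfolding pmf_backward_Suc[OF Suc.prems]
    by (rule order_trans[OF abs_mult_diff_le[OF abs_pmf_le_1 abs_pmf_le_1]]) auto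
  also have "\<bar>pmf (backward_pmf bs T S B A j) ?K - pmf (backward_pmf bs T S' B' A j) ?K\<bar>
     \<le> \<bar>pmf (S (A (T - 1))) (?K T) - pmf (S' (A (T - 1))) (?K T)\<bar> + (\<Sum>t=T-j..<T. ?d ?K t)"
    using Suc.prems by (intro Suc.IH) auto
  also have "(\<Sum>t=T-j..<T. ?d ?K t) = (\<Sum>t=T-j..<T. ?d K t)"
    using Suc.prems by (intro sum.cong refl) auto
  finally have 1: "\<bar>pmf (backward_pmf bs T S B A (Suc j)) K - pmf (backward_pmf bs T S' B' A (Suc j)) K\<bar>
    \<le> \<bar>pmf (S (A (T - 1))) (?K T) - pmf (S' (A (T - 1))) (?K T)\<bar> + (\<Sum>t=T-j..<T. ?d K t) + ?d K ?t"
    by (simp only: add_right_mono)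
  have 2: "?K T = K T" using Suc.prems by auto
  have 3: "(\<Sum>t=?t..<T. ?d K t) = ?d K ?t + (\<Sum>t=T-j..<T. ?d K t)"
    unfolding set by (rule sum.insert) (use Suc.prems in auto)
  show ?case using 1 unfolding 2 3 by (simp only: add_ac)
qed

lemma pmf_indices:
  "pmf (indices_pmf bs T N R S B) (A, K) = pmf (ancestor_pmf N R (T - 1)) A * pmf (backward_pmf bs T S B A (T - 1)) K"
  unfolding indices_pmf_def by (rule pmf_bind_Pair)

text \<open>Only ancestor vectors with \<open>a 0 = 0\<close> are ever reached. This is what makes
  the weight of particle 0 the weight of the current state, and it is used when the algorithm is
  rewritten relative to that state.\<close>

lemma indices_pmf_cong:
  assumes "\<And>t a. \<lbrakk>t \<in> {1..T - 1}; a 0 = 0\<rbrakk> \<Longrightarrow> R t a = R' t a"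
    and "\<And>a. a 0 = 0 \<Longrightarrow> S a = S' a"
    and "\<And>t a k. \<lbrakk>t \<in> {1..T - 1}; a 0 = 0\<rbrakk> \<Longrightarrow> B t a k = B' t a k"
  shows "indices_pmf bs T N R S B = indices_pmf bs T N R' S' B'"
proof -
  have a: "ancestor_pmf N R t = ancestor_pmf N R' t" if "t \<le> T - 1" for t
    using that
  proof (induction t)
    case (Suc t)
    have "R (Suc t) (A t) = R' (Suc t) (A t)" if "A \<in> set_pmf (ancestor_pmf N R' t)" for A
      using ancestor_pmf_eq_0(2)[OF that, of t] Suc.prems by (intro assms(1)) auto
    then show ?case using Suc by (auto intro!: bind_pmf_cong)
  qed simp
  have b: "backward_pmf bs T S B A j = backward_pmf bs T S' B' A j"
    if A: "A \<in> set_pmf (ancestor_pmf N R' (T - 1))" and "j \<le> T - 1" for A j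
    using that(2)
  proof (induction j)
    case 0
    then show ?case using assms(2)[of "A (T - 1)"] ancestor_pmf_eq_0(2)[OF A] by simp
  next
    case (Suc j)
    have "T - Suc j \<in> {1..T - 1}" using Suc.prems by auto
    from assms(3)[OF this, of "A (T - Suc j - 1)"] show ?case
      using Suc ancestor_pmf_eq_0(2)[OF A] by (auto simp: Let_def intro!: bind_pmf_cong)
  qed
  show ?thesis
    unfolding indices_pmf_def a[OF order_refl] by (intro bind_pmf_cong refl) (use b in auto)
qed

text \<open>\<open>\<delta> t a l\<close> stands for the log-weight at time \<open>t\<close> of particle \<open>l\<close> with ancestor \<open>a\<close>, relative to the reference
  particles. The backward weights contain the transition density at time \<open>t + 1\<close> but not the potential, which
  cancels in the difference \<open>\<delta> (t + 1) m k - \<delta> (t + 1) 0 k\<close>.\<close>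

definition scheme_pmf ::
  "bool \<Rightarrow> bool \<Rightarrow> nat \<Rightarrow> nat \<Rightarrow> (nat \<Rightarrow> nat \<Rightarrow> nat \<Rightarrow> real) \<Rightarrow> ((nat \<Rightarrow> nat \<Rightarrow> nat) \<times> (nat \<Rightarrow> nat)) pmf" where
  "scheme_pmf bs fm T N \<delta> = indices_pmf bs T N
     (\<lambda>t a. index_pmf N (Psi N (\<lambda>m. \<delta> t (a m) m)))
     (\<lambda>a. final_pmf fm N (\<lambda>m. \<delta> T (a m) m))
     (\<lambda>t a k. index_pmf N (Psi N (\<lambda>m. \<delta> t (a m) m + \<delta> (t + 1) m k - \<delta> (t + 1) 0 k)))"

text \<open>A finite set that carries all laws involved, thanks to the default 0 outside the index
  ranges. Total variation thus becomes a finite sum.\<close>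

definition index_range :: "nat \<Rightarrow> nat \<Rightarrow> ((nat \<Rightarrow> nat \<Rightarrow> nat) \<times> (nat \<Rightarrow> nat)) set" where
  "index_range T N = PiE_dflt {1..T - 1} (\<lambda>_. 0) (\<lambda>_. PiE_dflt {1..N} 0 (\<lambda>_. {..N})) \<times> PiE_dflt {1..T} 0 (\<lambda>_. {..N})"

lemma finite_index_range: "finite (index_range T N)"
  unfolding index_range_def by (intro finite_cartesian_product finite_PiE_dflt) auto

lemma index_rangeD:
  assumes "(A, K) \<in> index_range T N"
  shows "A t n \<le> N" "K t \<le> N"
  using assms unfolding index_range_def PiE_dflt_def
  by (auto, metis le0 atMost_iff, metis le0)

lemma set_index_pmf_Psi: "set_pmf (index_pmf N (Psi N h)) \<subseteq> {..N}"
  by (auto simp: set_pmf_eq pmf_Psi split: if_splits)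

lemma set_final_pmf: "set_pmf (final_pmf fm N h) \<subseteq> {..N}"
  by (auto simp: set_pmf_eq pmf_final split: if_splits)

lemma set_scheme_pmf:
  assumes "1 \<le> T"
  shows "set_pmf (scheme_pmf bs fm T N \<delta>) \<subseteq> index_range T N"
proof
  fix AK assume "AK \<in> set_pmf (scheme_pmf bs fm T N \<delta>)"
  let ?R = "\<lambda>t a. index_pmf N (Psi N (\<lambda>m. \<delta> t (a m) m))"
  let ?S = "\<lambda>a. final_pmf fm N (\<lambda>m. \<delta> T (a m) m)"
  let ?B = "\<lambda>t a k. index_pmf N (Psi N (\<lambda>m. \<delta> t (a m) m + \<delta> (t + 1) m k - \<delta> (t + 1) 0 k))"
  obtain A K where AK: "AK = (A, K)" by (cases AK)
  with \<open>AK \<in> _\<close> have A: "A \<in> set_pmf (ancestor_pmf N ?R (T - 1))"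
    and K: "K \<in> set_pmf (backward_pmf bs T ?S ?B A (T - 1))"
    by (auto simp: scheme_pmf_def indices_pmf_def)
  note a = ancestor_pmf_support[OF set_index_pmf_Psi A]
  have "K s = 0" if "s \<notin> {1..T}" for s
    using that assms by (intro backward_pmf_support[OF K]) auto
  moreover have "K s \<le> N" for s
    by (rule backward_pmf_le[OF set_final_pmf set_index_pmf_Psi a(1) K])
  ultimately show "AK \<in> index_range T N"
    using a unfolding AK index_range_def PiE_dflt_def by auto
qed

text \<open>The total over all times, ancestors and particles dominates every sum that occurs along
  a particular configuration. This removes the configuration from the Lipschitz bound.\<close>

lemma single_slice_le:
  fixes f :: "nat \<Rightarrow> nat \<Rightarrow> nat \<Rightarrow> real"
  assumes "\<And>t a l. 0 \<le> f t a l" "t \<in> {1..T}" "\<And>m. a m \<le> N"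
  shows "(\<Sum>m=1..N. f t (a m) m) \<le> (\<Sum>t=1..T. \<Sum>a\<le>N. \<Sum>l\<le>N. f t a l)"
    and "k \<le> N \<Longrightarrow> (\<Sum>m=1..N. f t m k) \<le> (\<Sum>t=1..T. \<Sum>a\<le>N. \<Sum>l\<le>N. f t a l)"
    and "\<lbrakk>i \<le> N; k \<le> N\<rbrakk> \<Longrightarrow> f t i k \<le> (\<Sum>t=1..T. \<Sum>a\<le>N. \<Sum>l\<le>N. f t a l)"
proof -
  have t: "(\<Sum>a\<le>N. \<Sum>l\<le>N. f t a l) \<le> (\<Sum>t=1..T. \<Sum>a\<le>N. \<Sum>l\<le>N. f t a l)"
    using assms(1,2) by (intro member_le_sum sum_nonneg) auto
  have "(\<Sum>m=1..N. f t (a m) m) \<le> (\<Sum>m=1..N. \<Sum>a\<le>N. f t a m)"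
    by (intro sum_mono member_le_sum) (use assms in auto)
  also have "\<dots> \<le> (\<Sum>m\<le>N. \<Sum>a\<le>N. f t a m)"
    using assms(1) by (intro sum_mono2 sum_nonneg) auto
  also have "\<dots> = (\<Sum>a\<le>N. \<Sum>l\<le>N. f t a l)" by (rule sum.swap)
  finally show "(\<Sum>m=1..N. f t (a m) m) \<le> (\<Sum>t=1..T. \<Sum>a\<le>N. \<Sum>l\<le>N. f t a l)" using t by simp
  show "(\<Sum>m=1..N. f t m k) \<le> (\<Sum>t=1..T. \<Sum>a\<le>N. \<Sum>l\<le>N. f t a l)" if "k \<le> N"
  proof -
    have "(\<Sum>m=1..N. f t m k) \<le> (\<Sum>m=1..N. \<Sum>l\<le>N. f t m l)"
      by (intro sum_mono member_le_sum) (use assms that in auto)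
    also have "\<dots> \<le> (\<Sum>m\<le>N. \<Sum>l\<le>N. f t m l)"
      using assms(1) by (intro sum_mono2 sum_nonneg) auto
    finally show ?thesis using t by simp
  qed
  show "f t i k \<le> (\<Sum>t=1..T. \<Sum>a\<le>N. \<Sum>l\<le>N. f t a l)" if "i \<le> N" "k \<le> N"
  proof -
    have "f t i k \<le> (\<Sum>l\<le>N. f t i l)" by (intro member_le_sum) (use assms that in auto)
    also have "\<dots> \<le> (\<Sum>a\<le>N. \<Sum>l\<le>N. f t a l)"
      by (rule member_le_sum) (use assms that in \<open>auto intro: sum_nonneg\<close>)
    finally show ?thesis using t by simp
  qed
qed

text \<open>\<open>2 * (N + 1)\<close> is the Lipschitz constant of a selection. It is incurred at
  most \<open>T * N\<close> times by ancestors, once by the final index, and at most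
  \<open>T\<close> times by backward draws, each of which counts \<open>N + 2\<close> fold.\<close>

definition scheme_const :: "nat \<Rightarrow> nat \<Rightarrow> real" where
  "scheme_const T N = 2 * (real N + 1) * (real T * real N + 1 + real T * (real N + 2))"

lemma scheme_const_nonneg: "0 \<le> scheme_const T N"
  by (simp add: scheme_const_def)

lemma scheme_pmf_lipschitz:
  assumes T: "1 \<le> T" and AK: "(A, K) \<in> index_range T N"
  shows "\<bar>pmf (scheme_pmf bs fm T N \<delta>) (A, K) - pmf (scheme_pmf bs fm T N \<delta>') (A, K)\<bar>
    \<le> scheme_const T N * (\<Sum>t=1..T. \<Sum>a\<le>N. \<Sum>l\<le>N. \<bar>\<delta> t a l - \<delta>' t a l\<bar>)" (is "_ \<le> _ * ?S")
proof -
  define f where "f t a l = \<bar>\<delta> t a l - \<delta>' t a l\<bar>" for t a l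
  define L where "L = 2 * (real N + 1)"
  have L: "0 \<le> L" by (simp add: L_def)
  have S: "?S = (\<Sum>t=1..T. \<Sum>a\<le>N. \<Sum>l\<le>N. f t a l)" by (simp add: f_def)
  have S0: "0 \<le> ?S" by (intro sum_nonneg) auto
  have f0: "0 \<le> f t a l" for t a l by (simp add: f_def)
  note rng = index_rangeD[OF AK]
  note slice = single_slice_le[of f, OF f0]
  let ?R = "\<lambda>\<delta> t a. index_pmf N (Psi N (\<lambda>m. \<delta> t (a m) m))"
  let ?F = "\<lambda>\<delta> a. final_pmf fm N (\<lambda>m. \<delta> T (a m) m)"
  let ?B = "\<lambda>\<delta> t a k. index_pmf N (Psi N (\<lambda>m. \<delta> t (a m) m + \<delta> (t + 1) m k - \<delta> (t + 1) 0 k))"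
  have R: "\<bar>pmf (?R \<delta> t (A (t - 1))) n - pmf (?R \<delta>' t (A (t - 1))) n\<bar> \<le> L * ?S" if "t \<in> {1..T}" for t n
  proof -
    have "\<bar>pmf (?R \<delta> t (A (t - 1))) n - pmf (?R \<delta>' t (A (t - 1))) n\<bar> \<le> L * (\<Sum>m=1..N. f t (A (t - 1) m) m)"
      unfolding L_def f_def by (rule pmf_Psi_lipschitz)
    also have "\<dots> \<le> L * ?S" using slice(1)[where a="A (t - 1)", OF that rng(1)] unfolding S by (intro mult_left_mono L)
    finally show ?thesis .
  qed
  have F: "\<bar>pmf (?F \<delta> (A (T - 1))) n - pmf (?F \<delta>' (A (T - 1))) n\<bar> \<le> L * ?S" for n
  proof -
    have "\<bar>pmf (?F \<delta> (A (T - 1))) n - pmf (?F \<delta>' (A (T - 1))) n\<bar> \<le> L * (\<Sum>m=1..N. f T (A (T - 1) m) m)"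
      unfolding L_def f_def by (rule pmf_final_lipschitz)
    also have "\<dots> \<le> L * ?S" using slice(1)[where a="A (T - 1)", OF _ rng(1), of T] T unfolding S by (intro mult_left_mono L) auto
    finally show ?thesis .
  qed
  have B: "\<bar>pmf (?B \<delta> t (A (t - 1)) (K (t + 1))) n - pmf (?B \<delta>' t (A (t - 1)) (K (t + 1))) n\<bar> \<le> L * ((real N + 2) * ?S)"
    if "t \<in> {1..<T}" for t n
  proof -
    let ?k = "K (t + 1)"
    have t: "t \<in> {1..T}" "t + 1 \<in> {1..T}" using that by auto
    have "\<bar>pmf (?B \<delta> t (A (t - 1)) ?k) n - pmf (?B \<delta>' t (A (t - 1)) ?k) n\<bar>
      \<le> L * (\<Sum>m=1..N. \<bar>(\<delta> t (A (t - 1) m) m + \<delta> (t + 1) m ?k - \<delta> (t + 1) 0 ?k) - (\<delta>' t (A (t - 1) m) m + \<delta>' (t + 1) m ?k - \<delta>' (t + 1) 0 ?k)\<bar>)"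
      unfolding L_def by (rule pmf_Psi_lipschitz)
    \<comment> \<open>A backward log-weight contains three increments. Summed over \<open>m\<close>,
      the first two are each dominated by the total; the third does not depend on \<open>m\<close>
      and is counted \<open>N\<close> times, whence \<open>N + 2\<close>.\<close>
    also have "\<dots> \<le> L * (\<Sum>m=1..N. f t (A (t - 1) m) m + f (t + 1) m ?k + f (t + 1) 0 ?k)"
      by (intro mult_left_mono L sum_mono) (simp add: f_def)
    also have "(\<Sum>m=1..N. f t (A (t - 1) m) m + f (t + 1) m ?k + f (t + 1) 0 ?k)
       = (\<Sum>m=1..N. f t (A (t - 1) m) m) + (\<Sum>m=1..N. f (t + 1) m ?k) + real N * f (t + 1) 0 ?k"
      by (simp add: sum.distrib)
    also have "L * \<dots> \<le> L * (?S + ?S + real N * ?S)"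
      unfolding S by (intro mult_left_mono L add_mono slice(1)[OF t(1)] slice(2)[where a=K, OF t(2)] slice(3)[where a=K, OF t(2)] rng) auto
    also have "\<dots> = L * ((real N + 2) * ?S)" by (simp add: algebra_simps)
    finally show ?thesis .
  qed
  have "\<bar>pmf (scheme_pmf bs fm T N \<delta>) (A, K) - pmf (scheme_pmf bs fm T N \<delta>') (A, K)\<bar>
    \<le> (\<Sum>t=1..T - 1. \<Sum>n=1..N. \<bar>pmf (?R \<delta> t (A (t - 1))) (A t n) - pmf (?R \<delta>' t (A (t - 1))) (A t n)\<bar>)
      + (\<bar>pmf (?F \<delta> (A (T - 1))) (K T) - pmf (?F \<delta>' (A (T - 1))) (K T)\<bar> +
      (\<Sum>t=T-(T - 1)..<T. \<bar>pmf (?B \<delta> t (A (t - 1)) (K (t + 1))) (K t) - pmf (?B \<delta>' t (A (t - 1)) (K (t + 1))) (K t)\<bar>))"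
    unfolding scheme_pmf_def pmf_indices
    using T by (intro order_trans[OF abs_mult_diff_le[OF abs_pmf_le_1 abs_pmf_le_1]] add_mono ancestor_pmf_diff_le backward_pmf_diff_le) auto
  also have "\<dots> \<le> (\<Sum>t=1..T - 1. \<Sum>n=1..N. L * ?S) + (L * ?S + (\<Sum>t=T-(T - 1)..<T. L * ((real N + 2) * ?S)))"
    by (intro add_mono sum_mono R F B) auto
  also have "\<dots> = real (T - 1) * real N * (L * ?S) + (L * ?S + real (T - 1) * (L * ((real N + 2) * ?S)))"
    using T by simp
  also have "\<dots> \<le> real T * real N * (L * ?S) + (L * ?S + real T * (L * ((real N + 2) * ?S)))"
    using L S0 by (intro add_mono mult_right_mono order_refl mult_nonneg_nonneg) auto
  also have "\<dots> = scheme_const T N * ?S" by (simp add: scheme_const_def L_def algebra_simps)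
  finally show ?thesis .
qed

section \<open>Measurability of the index probabilities as functions of the noise\<close>

lemma Psi_measurable:
  assumes h: "\<And>m. m \<in> {1..N} \<Longrightarrow> (\<lambda>u. h u m) \<in> borel_measurable M" and n: "n \<le> N"
  shows "(\<lambda>u. Psi N (h u) n) \<in> borel_measurable M"
proof -
  have "(\<lambda>u. ((h u)(0 := 0)) n) \<in> borel_measurable M"
    using h[of n] n by (cases "n = 0") auto
  moreover have "(\<lambda>u. \<Sum>m=1..N. exp (h u m)) \<in> borel_measurable M"
    by (intro borel_measurable_sum measurable_compose[OF h borel_measurable_exp]) auto
  ultimately show ?thesis unfolding Psi_def by measurable
qed

lemma Phi_measurable:
  assumes h: "\<And>m. m \<in> {1..N} \<Longrightarrow> (\<lambda>u. h u m) \<in> borel_measurable M" and n: "n \<le> N"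
  shows "(\<lambda>u. Phi N (h u) n) \<in> borel_measurable M"
proof -
  have s: "(\<lambda>u. \<Sum>m=1..N. exp (h u m)) \<in> borel_measurable M"
    by (intro borel_measurable_sum measurable_compose[OF h borel_measurable_exp]) auto
  have p: "(\<lambda>u. Phi_pos N (h u) k) \<in> borel_measurable M" if "k \<in> {1..N}" for k
    using h[OF that] s unfolding Phi_pos_def by measurable
  show ?thesis
  proof (cases "n = 0")
    case True
    then show ?thesis unfolding Phi_def
      by (simp del: One_nat_def) (intro borel_measurable_diff borel_measurable_const borel_measurable_sum p)
  next
    case False
    then show ?thesis using p[of n] n unfolding Phi_def by simp
  qed
qed

lemma scheme_pmf_measurable:
  assumes T: "1 \<le> T" and AK: "(A, K) \<in> index_range T N"
    and \<delta>: "\<And>t a l. \<lbrakk>t \<in> {1..T}; a \<le> N; l \<le> N\<rbrakk> \<Longrightarrow> (\<lambda>u. \<delta> u t a l) \<in> borel_measurable M"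
  shows "(\<lambda>u. pmf (scheme_pmf bs fm T N (\<delta> u)) (A, K)) \<in> borel_measurable M"
proof -
  note rng = index_rangeD[OF AK]
  let ?R = "\<lambda>\<delta> t a. index_pmf N (Psi N (\<lambda>m. \<delta> t (a m) m))"
  let ?F = "\<lambda>\<delta> a. final_pmf fm N (\<lambda>m. \<delta> T (a m) m)"
  let ?B = "\<lambda>\<delta> t a k. index_pmf N (Psi N (\<lambda>m. \<delta> t (a m) m + \<delta> (t + 1) m k - \<delta> (t + 1) 0 k))"
  have anc: "(\<lambda>u. pmf (ancestor_pmf N (?R (\<delta> u)) t) A) \<in> borel_measurable M"
    if "t < T" "\<And>t n. A t n \<le> N" for t A
    using that
  proof (induction t arbitrary: A)
    case (Suc t)
    have "(\<lambda>u. pmf (ancestor_pmf N (?R (\<delta> u)) t) (A(Suc t := (\<lambda>_. 0)))) \<in> borel_measurable M"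
      using Suc.prems by (intro Suc.IH) auto
    moreover have "(\<lambda>u. \<Prod>n=1..N. pmf (?R (\<delta> u) (Suc t) (A t)) (A (Suc t) n)) \<in> borel_measurable M"
      using Suc.prems by (intro borel_measurable_prod) (auto simp: pmf_Psi intro!: Psi_measurable \<delta>)
    ultimately show ?case unfolding pmf_ancestor_Suc by (auto simp del: One_nat_def)
  qed simp
  have bwd: "(\<lambda>u. pmf (backward_pmf bs T (?F (\<delta> u)) (?B (\<delta> u)) A j) K) \<in> borel_measurable M"
    if "j < T" "\<And>t. K t \<le> N" for j K
    using that
  proof (induction j arbitrary: K)
    case 0
    then show ?case unfolding pmf_backward_0 pmf_final
      using T by (cases fm) (auto intro!: Psi_measurable Phi_measurable \<delta> rng borel_measurable_times)
  next
    case (Suc j)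
    have "(\<lambda>u. pmf (backward_pmf bs T (?F (\<delta> u)) (?B (\<delta> u)) A j) (K(T - Suc j := 0))) \<in> borel_measurable M"
      using Suc.prems by (intro Suc.IH) auto
    moreover have "(\<lambda>u. pmf (if bs then ?B (\<delta> u) (T - Suc j) (A (T - Suc j - 1)) (K (T - Suc j + 1))
        else return_pmf (A (T - Suc j) (K (T - Suc j + 1)))) (K (T - Suc j))) \<in> borel_measurable M"
    proof (cases bs)
      case True
      show ?thesis unfolding if_P[OF True] pmf_Psi if_P[OF Suc.prems(2)]
        using Suc.prems by (intro Psi_measurable borel_measurable_add borel_measurable_diff \<delta> rng) auto
    qed simp
    ultimately show ?case unfolding pmf_backward_Suc[OF Suc.prems(1)] by (rule borel_measurable_times)
  qed
  show ?thesis unfolding scheme_pmf_def pmf_indices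
    by (intro borel_measurable_times anc bwd rng) (use T in auto)
qed

text \<open>In the backward weights \<open>V\<close> at time \<open>t + 1\<close> cancels from the
  difference, and \<open>W\<close> of the reference particle is 0, so exactly \<open>W\<close> of
  particle \<open>m\<close> at time \<open>t\<close> remains.\<close>

lemma limit_indices_eq_scheme:
  "limit_indices_pmf bs fm T N vw = scheme_pmf bs fm T N (\<lambda>t a l. Vpart vw t l + Wpart vw (t - 1) a)"
proof -
  have "Vpart vw t l + Wpart vw (t - 1) a + (Vpart vw (t + 1) k + Wpart vw (t + 1 - 1) l) - (Vpart vw (t + 1) k + Wpart vw (t + 1 - 1) 0)
     = Vpart vw t l + Wpart vw t l + Wpart vw (t - 1) a" for t a l k
    by (simp add: Wpart_def)
  then show ?thesis unfolding limit_indices_pmf_def scheme_pmf_def by (simp only:)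
qed

text \<open>On a common finite support, the probability of an event under a mixture is a finite sum
  of expected point probabilities. Nonnegativity is recorded as well, since the distance is defined
  as a real supremum and needs boundedness for that.\<close>

lemma tv_dist_le_sum:
  fixes p :: "'b \<Rightarrow> 'a pmf" and q :: "'c \<Rightarrow> 'a pmf" and \<epsilon> :: real
  assumes "finite \<Omega>"
    and p: "prob_space \<mu>" "\<And>u. set_pmf (p u) \<subseteq> \<Omega>" "\<And>\<omega>. \<omega> \<in> \<Omega> \<Longrightarrow> (\<lambda>u. pmf (p u) \<omega>) \<in> borel_measurable \<mu>"
    and q: "prob_space \<nu>" "\<And>v. set_pmf (q v) \<subseteq> \<Omega>" "\<And>\<omega>. \<omega> \<in> \<Omega> \<Longrightarrow> (\<lambda>v. pmf (q v) \<omega>) \<in> borel_measurable \<nu>"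
    and le: "\<And>\<omega>. \<omega> \<in> \<Omega> \<Longrightarrow> \<bar>(\<integral>u. pmf (p u) \<omega> \<partial>\<mu>) - (\<integral>v. pmf (q v) \<omega> \<partial>\<nu>)\<bar> \<le> \<epsilon>"
  shows "tv_dist (\<mu> \<bind> (\<lambda>u. measure_pmf (p u))) (\<nu> \<bind> (\<lambda>v. measure_pmf (q v))) \<le> card \<Omega> * \<epsilon>"
    and "0 \<le> tv_dist (\<mu> \<bind> (\<lambda>u. measure_pmf (p u))) (\<nu> \<bind> (\<lambda>v. measure_pmf (q v)))"
proof -
  have meas: "measure (measure_pmf (r :: 'a pmf)) E = (\<Sum>\<omega>\<in>\<Omega> \<inter> E. pmf r \<omega>)" if "set_pmf r \<subseteq> \<Omega>" for r E
  proof -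
    have "measure (measure_pmf r) E = measure (measure_pmf r) (\<Omega> \<inter> E)"
      by (rule measure_pmf.finite_measure_eq_AE) (use that in \<open>auto simp: AE_measure_pmf_iff\<close>)
    then show ?thesis using \<open>finite \<Omega>\<close> by (simp add: measure_measure_pmf_finite)
  qed
  have bind: "sets (\<mu> \<bind> (\<lambda>u. measure_pmf (p u))) = UNIV \<and>
      measure (\<mu> \<bind> (\<lambda>u. measure_pmf (p u))) E = (\<Sum>\<omega>\<in>\<Omega> \<inter> E. (\<integral>u. pmf (p u) \<omega> \<partial>\<mu>))"
    if \<mu>: "prob_space \<mu>" and p: "\<And>u. set_pmf (p u) \<subseteq> \<Omega>" "\<And>\<omega>. \<omega> \<in> \<Omega> \<Longrightarrow> (\<lambda>u. pmf (p u) \<omega>) \<in> borel_measurable \<mu>"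
    for \<mu> :: "'d measure" and p :: "'d \<Rightarrow> 'a pmf" and E
  proof -
    interpret \<mu>: prob_space \<mu> by fact
    have K: "(\<lambda>u. measure_pmf (p u)) \<in> measurable \<mu> (subprob_algebra (count_space UNIV))"
    proof (rule measurable_subprob_algebra)
      fix A :: "'a set"
      have "(\<lambda>u. \<Sum>\<omega>\<in>\<Omega> \<inter> A. pmf (p u) \<omega>) \<in> borel_measurable \<mu>"
        by (intro borel_measurable_sum p) auto
      then show "(\<lambda>u. emeasure (measure_pmf (p u)) A) \<in> borel_measurable \<mu>"
        by (simp add: measure_pmf.emeasure_eq_measure meas[OF p(1)])
    qed (auto simp: measure_pmf.subprob_space_axioms)
    have "measure (\<mu> \<bind> (\<lambda>u. measure_pmf (p u))) E = (\<integral>u. (\<Sum>\<omega>\<in>\<Omega> \<inter> E. pmf (p u) \<omega>) \<partial>\<mu>)"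
      by (subst \<mu>.measure_bind[OF K]) (auto simp: meas[OF p(1)])
    also have "\<dots> = (\<Sum>\<omega>\<in>\<Omega> \<inter> E. (\<integral>u. pmf (p u) \<omega> \<partial>\<mu>))"
      by (intro Bochner_Integration.integral_sum \<mu>.integrable_const_bound[of _ 1] AE_I2 p) (auto simp: pmf_le_1)
    finally show ?thesis using sets_bind[of \<mu> "\<lambda>u. measure_pmf (p u)" "count_space UNIV"] \<mu>.not_empty by simp
  qed
  let ?P = "\<mu> \<bind> (\<lambda>u. measure_pmf (p u))" and ?Q = "\<nu> \<bind> (\<lambda>v. measure_pmf (q v))"
  have tv: "tv_dist ?P ?Q = (SUP E. \<bar>measure ?P E - measure ?Q E\<bar>)"
    unfolding tv_dist_def using bind[OF p] by simp
  have b: "\<bar>measure ?P E - measure ?Q E\<bar> \<le> card \<Omega> * \<epsilon>" for E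
  proof -
    have "\<bar>measure ?P E - measure ?Q E\<bar> \<le> (\<Sum>\<omega>\<in>\<Omega> \<inter> E. \<bar>(\<integral>u. pmf (p u) \<omega> \<partial>\<mu>) - (\<integral>v. pmf (q v) \<omega> \<partial>\<nu>)\<bar>)"
      using bind[OF p] bind[OF q] by (simp add: sum_abs flip: sum_subtractf)
    also have "\<dots> \<le> (\<Sum>\<omega>\<in>\<Omega>. \<bar>(\<integral>u. pmf (p u) \<omega> \<partial>\<mu>) - (\<integral>v. pmf (q v) \<omega> \<partial>\<nu>)\<bar>)"
      using \<open>finite \<Omega>\<close> by (intro sum_mono2) auto
    also have "\<dots> \<le> card \<Omega> * \<epsilon>" using le by (rule sum_bounded_above)
    finally show ?thesis .
  qed
  show "tv_dist ?P ?Q \<le> card \<Omega> * \<epsilon>" unfolding tv by (rule cSUP_least) (auto intro: b)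
  have "bdd_above (range (\<lambda>E. \<bar>measure ?P E - measure ?Q E\<bar>))" using b by (auto intro!: bdd_aboveI)
  from cSUP_upper[OF UNIV_I this, of "{}"] show "0 \<le> tv_dist ?P ?Q" unfolding tv by simp
qed

section \<open>Square roots of positive semidefinite matrices\<close>

text \<open>The entries of the positive semidefinite square root \<open>(M + s I) / \<tau>\<close> of the matrix \<open>M\<close> with diagonal
  \<open>a, b\<close> and off-diagonal entry \<open>c\<close>, where \<open>s\<^sup>2 = det M\<close> and \<open>\<tau>\<^sup>2 = tr M + 2 s\<close>; for \<open>M = 0\<close>
  they vanish, as \<open>x / 0 = 0\<close>.\<close>

definition sqrt_det :: "real \<times> real \<times> real \<Rightarrow> real" where
  "sqrt_det = (\<lambda>(a, c, b). sqrt (a * b - c\<^sup>2))"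

definition sqrt_tr :: "real \<times> real \<times> real \<Rightarrow> real" where
  "sqrt_tr = (\<lambda>(a, c, b). sqrt (a + b + 2 * sqrt_det (a, c, b)))"

definition sqrt11 :: "real \<times> real \<times> real \<Rightarrow> real" where
  "sqrt11 = (\<lambda>(a, c, b). (a + sqrt_det (a, c, b)) / sqrt_tr (a, c, b))"

definition sqrt12 :: "real \<times> real \<times> real \<Rightarrow> real" where
  "sqrt12 = (\<lambda>(a, c, b). c / sqrt_tr (a, c, b))"

definition sqrt22 :: "real \<times> real \<times> real \<Rightarrow> real" where
  "sqrt22 = (\<lambda>(a, c, b). (b + sqrt_det (a, c, b)) / sqrt_tr (a, c, b))"

definition psd2 :: "(real \<times> real \<times> real) set" where
  "psd2 = {(a, c, b). 0 \<le> a \<and> 0 \<le> b \<and> c\<^sup>2 \<le> a * b}"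

text \<open>By Cayley-Hamilton the square of \<open>M + s I\<close> is
  \<open>(tr M + 2 s) M + (s^2 - det M) I\<close>, which for \<open>s^2 = det M\<close> is a
  multiple of \<open>M\<close>; the trace factor is \<open>r^2\<close>.\<close>

lemma psd_sqrt:
  assumes "(a, c, b) \<in> psd2"
  defines "p \<equiv> (a, c, b)"
  shows "(sqrt11 p)\<^sup>2 + (sqrt12 p)\<^sup>2 = a"
    and "sqrt11 p * sqrt12 p + sqrt12 p * sqrt22 p = c"
    and "(sqrt12 p)\<^sup>2 + (sqrt22 p)\<^sup>2 = b"
proof -
  have ab: "0 \<le> a" "0 \<le> b" "c\<^sup>2 \<le> a * b" using assms(1) by (auto simp: psd2_def)
  define s where "s = sqrt_det p"
  have s: "0 \<le> s" "s\<^sup>2 = a * b - c\<^sup>2" using ab by (auto simp: s_def sqrt_det_def p_def)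
  define r where "r = sqrt_tr p"
  have r: "r\<^sup>2 = a + b + 2 * s" using ab s(1) by (simp add: r_def sqrt_tr_def p_def s_def[unfolded p_def])
  have B: "sqrt11 p = (a + s) / r" "sqrt12 p = c / r" "sqrt22 p = (b + s) / r"
    by (simp_all add: sqrt11_def sqrt12_def sqrt22_def p_def s_def r_def)
  have "(sqrt11 p)\<^sup>2 + (sqrt12 p)\<^sup>2 = a \<and> sqrt11 p * sqrt12 p + sqrt12 p * sqrt22 p = c \<and> (sqrt12 p)\<^sup>2 + (sqrt22 p)\<^sup>2 = b"
  proof (cases "r = 0")
    \<comment> \<open>On \<open>psd2\<close>, \<open>r\<close> vanishes only together with both
      diagonal entries, hence for the zero matrix, whose root is what division by 0 returns.\<close>
    case True
    then have "a = 0" "b = 0" using r ab s(1) by auto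
    then show ?thesis using ab True unfolding B by auto
  next
    case False
    have "(sqrt11 p)\<^sup>2 + (sqrt12 p)\<^sup>2 = ((a + s)\<^sup>2 + c\<^sup>2) / r\<^sup>2"
      unfolding B by (simp add: power_divide flip: add_divide_distrib)
    also have "(a + s)\<^sup>2 + c\<^sup>2 = a * r\<^sup>2" using s(2) r by (simp add: power2_eq_square algebra_simps)
    finally have 1: "(sqrt11 p)\<^sup>2 + (sqrt12 p)\<^sup>2 = a" using False by simp
    have "(sqrt12 p)\<^sup>2 + (sqrt22 p)\<^sup>2 = (c\<^sup>2 + (b + s)\<^sup>2) / r\<^sup>2"
      unfolding B by (simp add: power_divide flip: add_divide_distrib)
    also have "c\<^sup>2 + (b + s)\<^sup>2 = b * r\<^sup>2" using s(2) r by (simp add: power2_eq_square algebra_simps)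
    finally have 2: "(sqrt12 p)\<^sup>2 + (sqrt22 p)\<^sup>2 = b" using False by simp
    have "sqrt11 p * sqrt12 p + sqrt12 p * sqrt22 p = c * (a + b + 2 * s) / r\<^sup>2"
      unfolding B by (simp add: power2_eq_square add_divide_distrib[symmetric] algebra_simps)
    then have "sqrt11 p * sqrt12 p + sqrt12 p * sqrt22 p = c" using False unfolding r[symmetric] by simp
    with 1 2 show ?thesis by simp
  qed
  then show "(sqrt11 p)\<^sup>2 + (sqrt12 p)\<^sup>2 = a" "sqrt11 p * sqrt12 p + sqrt12 p * sqrt22 p = c"
    "(sqrt12 p)\<^sup>2 + (sqrt22 p)\<^sup>2 = b" by auto
qed

text \<open>Away from the zero matrix the entries are quotients with nonzero denominator, also at
  matrices of rank one. At the zero matrix the formula is 0/0, and continuity comes from the size of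
  the root instead.\<close>

lemma continuous_on_psd_sqrt:
  "continuous_on psd2 sqrt11" "continuous_on psd2 sqrt12" "continuous_on psd2 sqrt22"
proof -
  have "(sqrt11 \<longlongrightarrow> sqrt11 p) (at p within psd2) \<and> (sqrt12 \<longlongrightarrow> sqrt12 p) (at p within psd2) \<and>
    (sqrt22 \<longlongrightarrow> sqrt22 p) (at p within psd2)" if p: "p \<in> psd2" for p
  proof (cases "sqrt_tr p = 0")
    case False
    have t: "sqrt_tr \<midarrow>p\<rightarrow> sqrt_tr p"
      unfolding sqrt_tr_def sqrt_det_def case_prod_unfold by (intro tendsto_intros)
    then have t: "(sqrt_tr \<longlongrightarrow> sqrt_tr p) (at p within psd2)" by (rule tendsto_within_subset) simp
    have e: "sqrt11 q = (fst q + sqrt_det q) / sqrt_tr q" "sqrt12 q = fst (snd q) / sqrt_tr q"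
       "sqrt22 q = (snd (snd q) + sqrt_det q) / sqrt_tr q" for q
      by (auto simp: sqrt11_def sqrt12_def sqrt22_def case_prod_unfold)
    have d: "(sqrt_det \<longlongrightarrow> sqrt_det p) (at p within psd2)"
      unfolding sqrt_det_def case_prod_unfold by (intro tendsto_intros)
    show ?thesis unfolding e[abs_def] by (intro conjI tendsto_intros d t False)
  next
    case True
    obtain a c b where pe: "p = (a, c, b)" by (cases p) auto
    have ab: "0 \<le> a" "0 \<le> b" "c\<^sup>2 \<le> a * b" using p by (auto simp: psd2_def pe)
    then have "a + b + 2 * sqrt_det (a, c, b) = 0" "0 \<le> sqrt_det (a, c, b)"
      using True by (auto simp: sqrt_tr_def pe sqrt_det_def)
    then have z: "a = 0" "b = 0" using ab by auto
    \<comment> \<open>Diagonal entries of the matrix are sums of squares of entries of its root, so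
      the latter are bounded by the root of a diagonal entry, which tends to 0.\<close>
    have bd: "\<bar>sqrt11 q\<bar> \<le> sqrt (fst q) \<and> \<bar>sqrt12 q\<bar> \<le> sqrt (fst q) \<and> \<bar>sqrt22 q\<bar> \<le> sqrt (snd (snd q))"
      if "q \<in> psd2" for q
    proof -
      obtain a c b where q: "q = (a, c, b)" by (cases q) auto
      note e = psd_sqrt[OF that[unfolded q]]
      have "(sqrt11 q)\<^sup>2 \<le> a" "(sqrt12 q)\<^sup>2 \<le> a" "(sqrt22 q)\<^sup>2 \<le> b"
        using e(1,3) by (smt (verit) q zero_le_power2)+
      then show ?thesis by (auto simp: q intro!: real_le_rsqrt)
    qed
    have f: "((\<lambda>q. sqrt (fst q)) \<longlongrightarrow> 0) (at p within psd2)" "((\<lambda>q. sqrt (snd (snd q))) \<longlongrightarrow> 0) (at p within psd2)"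
      using z by (auto intro!: tendsto_eq_intros simp: pe)
    have ev: "\<forall>\<^sub>F q in at p within psd2. q \<in> psd2" by (auto simp: eventually_at_topological)
    have "(sqrt11 \<longlongrightarrow> 0) (at p within psd2)" "(sqrt12 \<longlongrightarrow> 0) (at p within psd2)" "(sqrt22 \<longlongrightarrow> 0) (at p within psd2)"
      by (rule Lim_null_comparison[OF eventually_mono[OF ev] f(1)] Lim_null_comparison[OF eventually_mono[OF ev] f(2)];
          use bd in force)+
    moreover have "sqrt11 p = 0" "sqrt12 p = 0" "sqrt22 p = 0" using True
      by (auto simp: sqrt11_def sqrt12_def sqrt22_def pe)
    ultimately show ?thesis by simp
  qed
  then show "continuous_on psd2 sqrt11" "continuous_on psd2 sqrt12" "continuous_on psd2 sqrt22"
    by (auto simp: continuous_on_def)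
qed

section \<open>Taylor expansion\<close>

lemma partial_has_real_derivative:
  fixes F :: "real \<times> real \<Rightarrow> real"
  assumes "(F has_derivative D) (at (x, y))"
  shows "((\<lambda>x. F (x, y)) has_real_derivative D (1, 0)) (at x)"
    and "((\<lambda>y. F (x, y)) has_real_derivative D (0, 1)) (at y)"
proof -
  have D: "bounded_linear D" using assms by (rule has_derivative_bounded_linear)
  then have s: "D (h, 0) = D (1, 0) * h" "D (0, h) = D (0, 1) * h" for h
    using linear_scale[OF bounded_linear.linear[OF D], of h "(1, 0)"] linear_scale[OF bounded_linear.linear[OF D], of h "(0, 1)"]
    by (simp_all add: mult.commute)
  have "((\<lambda>x. F (x, y)) has_derivative (\<lambda>h. D (h, 0))) (at x)"
    by (rule has_derivative_compose[of "\<lambda>x. (x, y)" "\<lambda>h. (h, 0)" x UNIV F D, OF _ assms]) (auto intro!: derivative_eq_intros)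
  then show "((\<lambda>x. F (x, y)) has_real_derivative D (1, 0)) (at x)"
    using ext[of "\<lambda>h. D (h, 0)", OF s(1)] by (simp add: has_field_derivative_def)
  have "((\<lambda>y. F (x, y)) has_derivative (\<lambda>h. D (0, h))) (at y)"
    by (rule has_derivative_compose[of "\<lambda>y. (x, y)" "\<lambda>h. (0, h)" y UNIV F D, OF _ assms]) (auto intro!: derivative_eq_intros)
  then show "((\<lambda>y. F (x, y)) has_real_derivative D (0, 1)) (at y)"
    using ext[of "\<lambda>h. D (0, h)", OF s(2)] by (simp add: has_field_derivative_def)
qed

lemma twice_cont_diff_partials:
  fixes f :: "real \<Rightarrow> real \<Rightarrow> real"
  assumes "twice_cont_diff (\<lambda>(x, y). f x y)"
  shows "((\<lambda>x. f x y) has_real_derivative partial1 f x y) (at x)"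
    and "((\<lambda>y. f x y) has_real_derivative partial2 f x y) (at y)"
    and "((\<lambda>x. partial1 f x y) has_real_derivative partial1 (partial1 f) x y) (at x)"
    and "((\<lambda>x. partial2 f x y) has_real_derivative partial1 (partial2 f) x y) (at x)"
    and "((\<lambda>y. partial2 f x y) has_real_derivative partial2 (partial2 f) x y) (at y)"
    and "continuous_on UNIV (\<lambda>(x, y). f x y)"
    and "continuous_on UNIV (\<lambda>(x, y). partial1 f x y)"
    and "continuous_on UNIV (\<lambda>(x, y). partial2 f x y)"
proof -
  let ?F = "\<lambda>(x, y). f x y"
  obtain f' :: "real \<times> real \<Rightarrow> (real \<times> real) \<Rightarrow>\<^sub>L real" and f'' :: "real \<times> real \<Rightarrow> (real \<times> real) \<Rightarrow>\<^sub>L ((real \<times> real) \<Rightarrow>\<^sub>L real)"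
    where f': "\<And>z. (?F has_derivative blinfun_apply (f' z)) (at z)"
      and f'': "\<And>z. (f' has_derivative blinfun_apply (f'' z)) (at z)"
    using assms unfolding twice_cont_diff_def by blast
  note d1 = partial_has_real_derivative[OF f', of x y for x y, simplified]
  have p: "partial1 f x y = f' (x, y) (1, 0)" "partial2 f x y = f' (x, y) (0, 1)" for x y
    unfolding partial1_def partial2_def by (auto intro!: DERIV_imp_deriv d1)
  have G: "((\<lambda>z. f' z v) has_derivative (\<lambda>h. f'' z h v)) (at z)" for z v
    by (rule bounded_linear.has_derivative[OF blinfun.bounded_linear_left f''])
  note d2 = partial_has_real_derivative[OF G, of v x y for v x y]
  show 1: "((\<lambda>x. f x y) has_real_derivative partial1 f x y) (at x)"
    and 2: "((\<lambda>y. f x y) has_real_derivative partial2 f x y) (at y)"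
    using d1 by (auto simp: p)
  have pp: "partial1 (partial1 f) x y = f'' (x, y) (1, 0) (1, 0)" 
    "partial1 (partial2 f) x y = f'' (x, y) (1, 0) (0, 1)"
    "partial2 (partial2 f) x y = f'' (x, y) (0, 1) (0, 1)" for x y
    unfolding partial1_def[of "partial1 f"] partial1_def[of "partial2 f"] partial2_def[of "partial2 f"] p
    by (auto intro!: DERIV_imp_deriv d2)
  show "((\<lambda>x. partial1 f x y) has_real_derivative partial1 (partial1 f) x y) (at x)"
    "((\<lambda>x. partial2 f x y) has_real_derivative partial1 (partial2 f) x y) (at x)"
    "((\<lambda>y. partial2 f x y) has_real_derivative partial2 (partial2 f) x y) (at y)"
    unfolding pp p by (rule d2)+
  have "(\<lambda>(x, y). partial1 f x y) = (\<lambda>z. f' z (1, 0))" "(\<lambda>(x, y). partial2 f x y) = (\<lambda>z. f' z (0, 1))"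
    by (auto simp: p)
  moreover have "continuous_on UNIV (\<lambda>z. f' z v)" for v
    by (rule has_derivative_continuous_on[where f'="\<lambda>z h. f'' z h v"]) (rule has_derivative_at_withinI[OF G])
  ultimately show "continuous_on UNIV (\<lambda>(x, y). partial1 f x y)" "continuous_on UNIV (\<lambda>(x, y). partial2 f x y)"
    by simp_all
  show "continuous_on UNIV (\<lambda>(x, y). f x y)"
    by (rule has_derivative_continuous_on) (use f' in auto)
qed

lemma taylor_order1:
  fixes g g' :: "real \<Rightarrow> real"
  assumes "\<And>t. (g has_real_derivative g' t) (at t)" and "\<And>t. \<bar>t - c\<bar> \<le> \<bar>k\<bar> \<Longrightarrow> \<bar>g' t - g' c\<bar> \<le> B"
  shows "\<bar>g (c + k) - g c - g' c * k\<bar> \<le> B * \<bar>k\<bar>"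
proof (cases "k = 0")
  case False
  let ?d = "\<lambda>m::nat. if m = 0 then g else g'"
  have "\<exists>t. (if c + k < c then c + k < t \<and> t < c else c < t \<and> t < c + k) \<and>
     g (c + k) = (\<Sum>m<1::nat. ?d m c / fact m * (c + k - c) ^ m) + ?d 1 t / fact 1 * (c + k - c) ^ 1"
    by (rule Taylor[where n=1 and diff="?d" and a="c - \<bar>k\<bar>" and b="c + \<bar>k\<bar>"]) (use assms(1) False in auto)
  then obtain t where "if c + k < c then c + k < t \<and> t < c else c < t \<and> t < c + k" "g (c + k) = g c + g' t * k"
    by auto
  then have t: "\<bar>t - c\<bar> \<le> \<bar>k\<bar>" "g (c + k) = g c + g' t * k" by (auto split: if_splits)
  then have "g (c + k) - g c - g' c * k = (g' t - g' c) * k" by (simp add: algebra_simps)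
  then show ?thesis using assms(2)[OF t(1)] by (simp add: abs_mult mult_right_mono)
qed simp

lemma taylor_order2:
  fixes g g' g'' :: "real \<Rightarrow> real"
  assumes "\<And>t. (g has_real_derivative g' t) (at t)" "\<And>t. (g' has_real_derivative g'' t) (at t)"
    and "\<And>t. \<bar>t - c\<bar> \<le> \<bar>k\<bar> \<Longrightarrow> \<bar>g'' t - g'' c\<bar> \<le> B"
  shows "\<bar>g (c + k) - g c - g' c * k - 1/2 * g'' c * k\<^sup>2\<bar> \<le> 1/2 * B * k\<^sup>2"
proof (cases "k = 0")
  case False
  let ?d = "\<lambda>m::nat. if m = 0 then g else if m = 1 then g' else g''"
  have "\<exists>t. (if c + k < c then c + k < t \<and> t < c else c < t \<and> t < c + k) \<and>
     g (c + k) = (\<Sum>m<2::nat. ?d m c / fact m * (c + k - c) ^ m) + ?d 2 t / fact 2 * (c + k - c) ^ 2"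
    by (rule Taylor[where n=2 and diff="?d" and a="c - \<bar>k\<bar>" and b="c + \<bar>k\<bar>"]) (use assms(1,2) False in \<open>auto simp: less_2_cases_iff\<close>)
  then obtain t where "if c + k < c then c + k < t \<and> t < c else c < t \<and> t < c + k"
      "g (c + k) = g c + g' c * k + g'' t / 2 * k\<^sup>2"
    by (auto simp: numeral_2_eq_2)
  then have t: "\<bar>t - c\<bar> \<le> \<bar>k\<bar>" "g (c + k) = g c + g' c * k + g'' t / 2 * k\<^sup>2"
    by (auto split: if_splits)
  then have "g (c + k) - g c - g' c * k - 1/2 * g'' c * k\<^sup>2 = 1/2 * (g'' t - g'' c) * k\<^sup>2" by (simp add: algebra_simps)
  moreover have "\<bar>1/2 * (g'' t - g'' c) * k\<^sup>2\<bar> \<le> 1/2 * B * k\<^sup>2"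
    using assms(3)[OF t(1)] by (simp add: abs_mult mult_right_mono)
  ultimately show ?thesis by (simp only:)
qed simp

text \<open>One constant for both the Lipschitz property and the bound can be enlarged freely, so
  finitely many functions share one. The sum of coordinate distances fits increments taken along one
  axis at a time.\<close>

definition lip2 :: "real \<Rightarrow> (real \<Rightarrow> real \<Rightarrow> real) \<Rightarrow> bool" where
  "lip2 L f \<longleftrightarrow> (\<forall>x y x' y'. \<bar>f x y - f x' y'\<bar> \<le> L * (\<bar>x - x'\<bar> + \<bar>y - y'\<bar>)) \<and> (\<forall>x y. \<bar>f x y\<bar> \<le> L)"

lemma lip2_mono: "lip2 L f \<Longrightarrow> L \<le> L' \<Longrightarrow> lip2 L' f"
  unfolding lip2_def by (meson abs_ge_zero add_nonneg_nonneg mult_right_mono order_trans)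

lemma lipschitz_bounded_lip2:
  assumes "lipschitz_bounded f"
  shows "\<exists>L\<ge>0. lip2 L f"
proof -
  obtain C where C: "C-lipschitz_on UNIV (\<lambda>(x, y). f x y)" using assms by (auto simp: lipschitz_bounded_def)
  obtain b where b: "\<And>x y. \<bar>f x y\<bar> \<le> b" using assms by (auto simp: lipschitz_bounded_def bounded_iff)
  have C0: "0 \<le> C" by (rule lipschitz_on_nonneg[OF C])
  have "\<bar>f x y - f x' y'\<bar> \<le> C * (\<bar>x - x'\<bar> + \<bar>y - y'\<bar>)" for x y x' y'
  proof -
    have "\<bar>f x y - f x' y'\<bar> \<le> C * dist (x, y) (x', y')"
      using lipschitz_onD[OF C, of "(x, y)" "(x', y')"] by (simp add: dist_real_def)
    also have "\<dots> \<le> C * (\<bar>x - x'\<bar> + \<bar>y - y'\<bar>)"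
      using C0 sqrt_sum_squares_le_sum_abs[of "x - x'" "y - y'"] by (simp add: dist_Pair_Pair dist_real_def mult_left_mono)
    finally show ?thesis .
  qed
  then have "lip2 (max C b) f"
    unfolding lip2_def using b
    by (meson abs_ge_zero add_nonneg_nonneg max.cobounded1 max.coboundedI2 mult_right_mono order_trans)
  moreover have "0 \<le> max C b" using C0 by simp
  ultimately show ?thesis by blast
qed

text \<open>The increment is taken along the axes, first in \<open>x\<close>, then in
  \<open>y\<close>. The \<open>y\<close>-derivatives, met at the shifted point \<open>x + h\<close>,
  are moved back to \<open>x\<close>, which brings in the mixed derivative. Each of the four errors
  is of third order by the Lipschitz property.\<close>

lemma taylor2:
  fixes f :: "real \<Rightarrow> real \<Rightarrow> real"
  assumes f: "twice_cont_diff (\<lambda>(x, y). f x y)"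
    and "lip2 L (partial1 (partial1 f))" "lip2 L (partial1 (partial2 f))" "lip2 L (partial2 (partial2 f))"
  shows "\<bar>f (x + h) (y + k) - f x y - (partial1 f x y * h + partial2 f x y * k
      + 1/2 * partial1 (partial1 f) x y * h\<^sup>2 + partial1 (partial2 f) x y * h * k + 1/2 * partial2 (partial2 f) x y * k\<^sup>2)\<bar>
    \<le> 2 * L * (\<bar>h\<bar> + \<bar>k\<bar>) ^ 3" (is "\<bar>?e\<bar> \<le> _")
proof -
  note d = twice_cont_diff_partials[OF f]
  have lip: "\<bar>partial1 (partial1 f) x y - partial1 (partial1 f) x' y'\<bar> \<le> L * (\<bar>x - x'\<bar> + \<bar>y - y'\<bar>)"
    "\<bar>partial1 (partial2 f) x y - partial1 (partial2 f) x' y'\<bar> \<le> L * (\<bar>x - x'\<bar> + \<bar>y - y'\<bar>)"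
    "\<bar>partial2 (partial2 f) x y - partial2 (partial2 f) x' y'\<bar> \<le> L * (\<bar>x - x'\<bar> + \<bar>y - y'\<bar>)" for x y x' y'
    using assms(2-4) by (auto simp: lip2_def)
  have L: "0 \<le> L" using assms(2) abs_ge_zero order_trans unfolding lip2_def by blast
  let ?s = "\<bar>h\<bar> + \<bar>k\<bar>"
  have 1: "\<bar>f (x + h) y - f x y - partial1 f x y * h - 1/2 * partial1 (partial1 f) x y * h\<^sup>2\<bar> \<le> 1/2 * (L * \<bar>h\<bar>) * h\<^sup>2"
    by (rule taylor_order2[OF d(1) d(3)])
      (use lip(1)[of _ y x y] L in \<open>force intro: order_trans mult_left_mono\<close>)
  have 2: "\<bar>f (x + h) (y + k) - f (x + h) y - partial2 f (x + h) y * k - 1/2 * partial2 (partial2 f) (x + h) y * k\<^sup>2\<bar> \<le> 1/2 * (L * \<bar>k\<bar>) * k\<^sup>2"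
    by (rule taylor_order2[OF d(2) d(5)])
      (use lip(3)[of "x + h" _ "x + h" y] L in \<open>force intro: order_trans mult_left_mono\<close>)
  have 3: "\<bar>partial2 f (x + h) y - partial2 f x y - partial1 (partial2 f) x y * h\<bar> \<le> (L * \<bar>h\<bar>) * \<bar>h\<bar>"
    by (rule taylor_order1[OF d(4)])
      (use lip(2)[of _ y x y] L in \<open>force intro: order_trans mult_left_mono\<close>)
  have 4: "\<bar>partial2 (partial2 f) (x + h) y - partial2 (partial2 f) x y\<bar> \<le> L * \<bar>h\<bar>"
    using lip(3)[of "x + h" y x y] by simp
  let ?r1 = "f (x + h) y - f x y - partial1 f x y * h - 1/2 * partial1 (partial1 f) x y * h\<^sup>2"
  let ?r2 = "f (x + h) (y + k) - f (x + h) y - partial2 f (x + h) y * k - 1/2 * partial2 (partial2 f) (x + h) y * k\<^sup>2"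
  let ?r3 = "partial2 f (x + h) y - partial2 f x y - partial1 (partial2 f) x y * h"
  let ?r4 = "partial2 (partial2 f) (x + h) y - partial2 (partial2 f) x y"
  \<comment> \<open>\<open>f1\<close>, \<open>b'\<close> and \<open>g'\<close> stand for values at
    the corner \<open>(x + h, y)\<close>; the four summands are the two one-dimensional remainders
    and the errors of moving the derivatives back.\<close>
  have split: "f3 - f0 - (a * h + b * k + 1/2 * c * h\<^sup>2 + d * h * k + 1/2 * g * k\<^sup>2)
      = (f1 - f0 - a * h - 1/2 * c * h\<^sup>2) + (f3 - f1 - b' * k - 1/2 * g' * k\<^sup>2) + (b' - b - d * h) * k + 1/2 * (g' - g) * k\<^sup>2"
    for f0 f1 f3 a b b' c d g g' :: real
    by (simp add: field_simps)
  have tri: "\<bar>a + b + c + d\<bar> \<le> \<bar>a\<bar> + \<bar>b\<bar> + \<bar>c\<bar> + \<bar>d\<bar>" for a b c d :: real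
    by (intro order_trans[OF abs_triangle_ineq] add_mono order_refl)
  have "\<bar>?e\<bar> \<le> \<bar>?r1\<bar> + \<bar>?r2\<bar> + \<bar>?r3 * k\<bar> + \<bar>1/2 * ?r4 * k\<^sup>2\<bar>"
    by (subst split[where ?f1.0="f (x + h) y" and b'="partial2 f (x + h) y" and g'="partial2 (partial2 f) (x + h) y"])
      (rule tri)
  also have "\<dots> = \<bar>?r1\<bar> + \<bar>?r2\<bar> + \<bar>?r3\<bar> * \<bar>k\<bar> + 1/2 * \<bar>?r4\<bar> * k\<^sup>2"
    unfolding abs_mult by simp
  also have "\<dots> \<le> 1/2 * (L * \<bar>h\<bar>) * h\<^sup>2 + 1/2 * (L * \<bar>k\<bar>) * k\<^sup>2 + (L * \<bar>h\<bar>) * \<bar>h\<bar> * \<bar>k\<bar> + 1/2 * (L * \<bar>h\<bar>) * k\<^sup>2"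
    by (intro add_mono 1 2 3 mult_right_mono mult_left_mono 4) auto
  also have "\<dots> = L * (1/2 * \<bar>h\<bar> ^ 3 + 1/2 * \<bar>k\<bar> ^ 3 + \<bar>h\<bar>\<^sup>2 * \<bar>k\<bar> + 1/2 * \<bar>h\<bar> * \<bar>k\<bar>\<^sup>2)"
  proof -
    have e: "h\<^sup>2 = \<bar>h\<bar>\<^sup>2" "k\<^sup>2 = \<bar>k\<bar>\<^sup>2" by simp_all
    have "1/2 * (L * p) * p\<^sup>2 + 1/2 * (L * q) * q\<^sup>2 + (L * p) * p * q + 1/2 * (L * p) * q\<^sup>2
        = L * (1/2 * p ^ 3 + 1/2 * q ^ 3 + p\<^sup>2 * q + 1/2 * p * q\<^sup>2)" for p q :: real
      by (simp add: power2_eq_square power3_eq_cube algebra_simps)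
    then show ?thesis unfolding e by (simp only:)
  qed
  also have "\<dots> \<le> L * (2 * ?s ^ 3)"
  proof (intro mult_left_mono L)
    have "?s ^ 3 = \<bar>h\<bar> ^ 3 + \<bar>k\<bar> ^ 3 + 3 * (\<bar>h\<bar>\<^sup>2 * \<bar>k\<bar>) + 3 * (\<bar>h\<bar> * \<bar>k\<bar>\<^sup>2)"
    proof -
      have "(p + q) ^ 3 = p ^ 3 + q ^ 3 + 3 * (p\<^sup>2 * q) + 3 * (p * q\<^sup>2)" for p q :: real
        by (simp add: power2_eq_square power3_eq_cube algebra_simps)
      then show ?thesis by (simp only:)
    qed
    moreover have "0 \<le> \<bar>h\<bar> ^ 3" "0 \<le> \<bar>k\<bar> ^ 3" "0 \<le> \<bar>h\<bar>\<^sup>2 * \<bar>k\<bar>" "0 \<le> \<bar>h\<bar> * \<bar>k\<bar>\<^sup>2" by simp_all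
    ultimately show "1/2 * \<bar>h\<bar> ^ 3 + 1/2 * \<bar>k\<bar> ^ 3 + \<bar>h\<bar>\<^sup>2 * \<bar>k\<bar> + 1/2 * \<bar>h\<bar> * \<bar>k\<bar>\<^sup>2 \<le> 2 * ?s ^ 3"
      by linarith
  qed
  also have "\<dots> = 2 * L * ?s ^ 3" by simp
  finally show ?thesis .
qed

lemma partial1_const [simp]: "partial1 (\<lambda>x y. g y) = (\<lambda>_ _. 0)"
  by (simp add: partial1_def fun_eq_iff)

lemma partial2_zero [simp]: "partial2 (\<lambda>_ _. 0) = (\<lambda>_ _. 0)"
  by (simp add: partial2_def fun_eq_iff)

lemma twice_cont_diff_zero: "twice_cont_diff (\<lambda>_. 0)"
  unfolding twice_cont_diff_def by (intro exI[of _ "\<lambda>_. 0"]) (auto simp: zero_blinfun.rep_eq)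

section \<open>Moments of the noise\<close>

text \<open>Missing coordinates are padded with the constant 1, which integrates to 1. Moments of a
  few coordinates are thus computed inside the large product.\<close>

lemma PiM_prod_subset:
  fixes f :: "'i \<Rightarrow> 'a \<Rightarrow> real"
  assumes M: "\<And>i. prob_space (M i)" and I: "finite I" "J \<subseteq> I" and f: "\<And>j. j \<in> J \<Longrightarrow> integrable (M j) (f j)"
  shows "integrable (\<Pi>\<^sub>M i\<in>I. M i) (\<lambda>x. \<Prod>j\<in>J. f j (x j))"
    and "(\<integral>x. (\<Prod>j\<in>J. f j (x j)) \<partial>(\<Pi>\<^sub>M i\<in>I. M i)) = (\<Prod>j\<in>J. \<integral>v. f j v \<partial>M j)"
proof -
  interpret product_prob_space M I using M by (rule product_prob_spaceI)
  let ?g = "\<lambda>i. if i \<in> J then f i else (\<lambda>_. 1)"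
  have J: "finite J" using I finite_subset by blast
  have g: "(\<Prod>i\<in>I. ?g i (x i)) = (\<Prod>j\<in>J. f j (x j))" for x
    using I by (intro prod.mono_neutral_cong_right) auto
  have i: "integrable (M i) (?g i)" for i
    using f prob_space.finite_measure[OF M] by (auto intro: finite_measure.integrable_const)
  show "integrable (\<Pi>\<^sub>M i\<in>I. M i) (\<lambda>x. \<Prod>j\<in>J. f j (x j))"
    using product_integrable_prod[OF I(1), of ?g, OF i] unfolding g .
  have "(\<integral>x. (\<Prod>i\<in>I. ?g i (x i)) \<partial>(\<Pi>\<^sub>M i\<in>I. M i)) = (\<Prod>i\<in>I. \<integral>v. ?g i v \<partial>M i)"
    by (rule product_integral_prod[OF I(1) i])
  also have "\<dots> = (\<Prod>j\<in>J. \<integral>v. f j v \<partial>M j)"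
    using I prob_space.prob_space[OF M] by (intro prod.mono_neutral_cong_right) auto
  finally show "(\<integral>x. (\<Prod>j\<in>J. f j (x j)) \<partial>(\<Pi>\<^sub>M i\<in>I. M i)) = (\<Prod>j\<in>J. \<integral>v. f j v \<partial>M j)"
    unfolding g .
qed

text \<open>Off-diagonal terms vanish, so the second moment grows linearly, not quadratically, in
  the number of terms. It serves both the concentration of the second-order terms and the weak
  law.\<close>

lemma orthogonal_sum_second_moment:
  fixes Y :: "'d \<Rightarrow> 'a \<Rightarrow> real"
  assumes S: "finite S" and int: "\<And>d e. \<lbrakk>d \<in> S; e \<in> S\<rbrakk> \<Longrightarrow> integrable M (\<lambda>u. Y d u * Y e u)"
    and orth: "\<And>d e. \<lbrakk>d \<in> S; e \<in> S; d \<noteq> e\<rbrakk> \<Longrightarrow> (\<integral>u. Y d u * Y e u \<partial>M) = 0"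
    and K: "\<And>d. d \<in> S \<Longrightarrow> (\<integral>u. Y d u * Y d u \<partial>M) \<le> K" and c: "\<And>d. d \<in> S \<Longrightarrow> \<bar>c d\<bar> \<le> C"
  shows "integrable M (\<lambda>u. (\<Sum>d\<in>S. c d * Y d u)\<^sup>2)"
    and "(\<integral>u. (\<Sum>d\<in>S. c d * Y d u)\<^sup>2 \<partial>M) \<le> C\<^sup>2 * K * card S"
proof -
  have sq: "(\<Sum>d\<in>S. c d * Y d u)\<^sup>2 = (\<Sum>d\<in>S. \<Sum>e\<in>S. c d * c e * (Y d u * Y e u))" for u
    unfolding power2_eq_square sum_product by (simp add: mult_ac)
  show "integrable M (\<lambda>u. (\<Sum>d\<in>S. c d * Y d u)\<^sup>2)"
    unfolding sq by (intro Bochner_Integration.integrable_sum integrable_mult_right int)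
  have "(\<integral>u. (\<Sum>d\<in>S. c d * Y d u)\<^sup>2 \<partial>M) = (\<Sum>d\<in>S. \<Sum>e\<in>S. c d * c e * (\<integral>u. Y d u * Y e u \<partial>M))"
    unfolding sq by (simp add: int)
  also have "\<dots> = (\<Sum>d\<in>S. (c d)\<^sup>2 * (\<integral>u. Y d u * Y d u \<partial>M))"
  proof (intro sum.cong refl)
    fix d assume d: "d \<in> S"
    have "(\<Sum>e\<in>S. c d * c e * (\<integral>u. Y d u * Y e u \<partial>M)) = (\<Sum>e\<in>S. if e = d then (c d)\<^sup>2 * (\<integral>u. Y d u * Y d u \<partial>M) else 0)"
      using orth[OF d] by (intro sum.cong refl) (auto simp: power2_eq_square)
    then show "(\<Sum>e\<in>S. c d * c e * (\<integral>u. Y d u * Y e u \<partial>M)) = (c d)\<^sup>2 * (\<integral>u. Y d u * Y d u \<partial>M)"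
      using S d by simp
  qed
  also have "\<dots> \<le> (\<Sum>d\<in>S. C\<^sup>2 * K)"
  proof (intro sum_mono mult_mono K)
    fix d assume "d \<in> S"
    then show "(c d)\<^sup>2 \<le> C\<^sup>2" using c[of d] abs_le_square_iff[of "c d" C] by auto
    show "0 \<le> (\<integral>u. Y d u * Y d u \<partial>M)" by simp
  qed auto
  finally show "(\<integral>u. (\<Sum>d\<in>S. c d * Y d u)\<^sup>2 \<partial>M) \<le> C\<^sup>2 * K * card S" by (simp add: mult_ac)
qed

lemma (in prob_space) expectation_abs_le_sqrt:
  assumes [measurable]: "random_variable borel X" and int: "integrable M (\<lambda>u. (X u)\<^sup>2)" and le: "expectation (\<lambda>u. (X u)\<^sup>2) \<le> B"
  shows "integrable M X" "expectation (\<lambda>u. \<bar>X u\<bar>) \<le> sqrt B"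
proof -
  show i: "integrable M X" by (rule square_integrable_imp_integrable[OF assms(1) int])
  then have ia: "integrable M (\<lambda>u. \<bar>X u\<bar>)" by simp
  have "0 \<le> variance (\<lambda>u. \<bar>X u\<bar>)" by simp
  also have "\<dots> = expectation (\<lambda>u. \<bar>X u\<bar>\<^sup>2) - (expectation (\<lambda>u. \<bar>X u\<bar>))\<^sup>2"
    by (rule variance_eq[OF ia]) (use int in simp)
  finally have "(expectation (\<lambda>u. \<bar>X u\<bar>))\<^sup>2 \<le> B" using le by simp
  then show "expectation (\<lambda>u. \<bar>X u\<bar>) \<le> sqrt B" by (rule real_le_rsqrt)
qed

section \<open>Moments of single noise variables and of sums over coordinates\<close>

lemma std_normal_moments:
  "integrable std_normal_distribution (\<lambda>x. x ^ k)"
  "(\<integral>x. x \<partial>std_normal_distribution) = 0"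
  "(\<integral>x. x\<^sup>2 \<partial>std_normal_distribution) = 1"
  "(\<integral>x. x ^ 4 \<partial>std_normal_distribution) = 3"
proof -
  show "integrable std_normal_distribution (\<lambda>x. x ^ k)"
    by (subst integrable_density) (auto simp: integrable_std_normal_moment)
  show "(\<integral>x. x \<partial>std_normal_distribution) = 0"
    using integral_std_normal_moment_odd[of 0] by (subst integral_density) auto
  show "(\<integral>x. x\<^sup>2 \<partial>std_normal_distribution) = 1"
    using integral_std_normal_moment_even[of 1] by (subst integral_density) auto
  show "(\<integral>x. x ^ 4 \<partial>std_normal_distribution) = 3"
    using integral_std_normal_moment_even[of 2] by (subst integral_density) (auto simp: fact_numeral)
qed

lemma distr_Sigma_coord:
  assumes n: "n \<in> {1..N}"
  shows "distr (Sigma_law N) borel (\<lambda>v. v n) = std_normal_distribution"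
proof -
  let ?\<theta> = "\<lambda>i. if i = n then 1 else 0 :: real"
  have 1: "(\<Sum>i=1..N. ?\<theta> i * x i) = x n" for x :: "nat \<Rightarrow> real"
  proof -
    have "(\<Sum>i=1..N. ?\<theta> i * x i) = (\<Sum>i=1..N. if i = n then x i else 0)" by (intro sum.cong) auto
    then show ?thesis using n by (simp del: One_nat_def)
  qed
  have 2: "(\<Sum>i=1..N. \<Sum>j=1..N. ?\<theta> i * Sigma_cov i j * ?\<theta> j) = 1"
  proof -
    have "(\<Sum>i=1..N. \<Sum>j=1..N. ?\<theta> i * Sigma_cov i j * ?\<theta> j) = (\<Sum>i=1..N. \<Sum>j=1..N. ?\<theta> i * (1 * Sigma_cov i j) * ?\<theta> j)" by simp
    also have "\<dots> = 1 * sform N ?\<theta> ?\<theta>" by (rule sform_Sigma_cov)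
    also have "\<dots> = 1" using 1[of ?\<theta>] 1[of "\<lambda>_. 1"] unfolding sform_def by simp
    finally show ?thesis .
  qed
  have "distr (Sigma_law N) borel (\<lambda>v. \<Sum>i=1..N. ?\<theta> i * v i) = normal_law (\<Sum>i=1..N. ?\<theta> i * 0) (\<Sum>i=1..N. \<Sum>j=1..N. ?\<theta> i * Sigma_cov i j * ?\<theta> j)"
    by (rule is_gaussian_Sigma_law[of N, unfolded is_gaussian_law_def, THEN conjunct2, THEN spec])
  then show ?thesis unfolding 1 2 by (simp add: normal_law_def)
qed

lemma Sigma_coord_measurable: "n \<in> {1..N} \<Longrightarrow> (\<lambda>v. v n) \<in> borel_measurable (Sigma_law N)"
  by (unfold measurable_cong_sets[OF sets_Sigma_law refl]) (rule measurable_component_singleton)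

lemma Sigma_coord_integral:
  fixes g :: "real \<Rightarrow> real"
  assumes n: "n \<in> {1..N}" and g: "g \<in> borel_measurable borel"
  shows "(\<integral>v. g (v n) \<partial>Sigma_law N) = (\<integral>x. g x \<partial>std_normal_distribution)"
    and "integrable (Sigma_law N) (\<lambda>v. g (v n)) \<longleftrightarrow> integrable std_normal_distribution g"
  using integral_distr[OF Sigma_coord_measurable[OF n] g] integrable_distr_eq[OF Sigma_coord_measurable[OF n] g]
  unfolding distr_Sigma_coord[OF n] by auto

lemma Sigma_coord_moments:
  assumes n: "n \<in> {1..N}"
  shows "integrable (Sigma_law N) (\<lambda>v. (v n) ^ k)" "integrable (Sigma_law N) (\<lambda>v. v n)"
    and "(\<integral>v. v n \<partial>Sigma_law N) = 0" "(\<integral>v. (v n)\<^sup>2 \<partial>Sigma_law N) = 1" "(\<integral>v. (v n) ^ 4 \<partial>Sigma_law N) = 3"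
proof -
  show "integrable (Sigma_law N) (\<lambda>v. (v n) ^ k)" for k
    using Sigma_coord_integral(2)[OF n, of "\<lambda>x. x ^ k"] std_normal_moments(1)[of k] by simp
  from this[of 1] show "integrable (Sigma_law N) (\<lambda>v. v n)" by simp
  show "(\<integral>v. v n \<partial>Sigma_law N) = 0" "(\<integral>v. (v n)\<^sup>2 \<partial>Sigma_law N) = 1" "(\<integral>v. (v n) ^ 4 \<partial>Sigma_law N) = 3"
    using Sigma_coord_integral(1)[OF n, of "\<lambda>x. x"] Sigma_coord_integral(1)[OF n, of "\<lambda>x. x\<^sup>2"]
      Sigma_coord_integral(1)[OF n, of "\<lambda>x. x ^ 4"] std_normal_moments(2-4) by simp_all
qed

lemma noise_prod:
  assumes J: "J \<subseteq> {1..T} \<times> {1..D}" and f: "\<And>j. j \<in> J \<Longrightarrow> integrable (Sigma_law N) (f j :: (nat \<Rightarrow> real) \<Rightarrow> real)"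
  shows "integrable (noise_law T N D) (\<lambda>u. \<Prod>j\<in>J. f j (u j))"
    and "(\<integral>u. (\<Prod>j\<in>J. f j (u j)) \<partial>noise_law T N D) = (\<Prod>j\<in>J. \<integral>v. f j v \<partial>Sigma_law N)"
  unfolding noise_law_def using J f prob_space_Sigma_law by (intro PiM_prod_subset; auto)+

text \<open>The centred squares are independent over \<open>d\<close> with second moment
  \<open>3 - 2 + 1 = 2\<close>, the 3 being the fourth moment of a standard normal.\<close>

lemma noise_square_sum:
  assumes t: "t \<in> {1..T}" and l: "l \<in> {1..N}" and c: "\<And>d. d \<in> {1..D} \<Longrightarrow> \<bar>c d\<bar> \<le> C" and C: "0 \<le> C"
  shows "integrable (noise_law T N D) (\<lambda>u. \<Sum>d=1..D. c d * ((u (t, d) l)\<^sup>2 - 1))"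
    and "(\<integral>u. \<bar>\<Sum>d=1..D. c d * ((u (t, d) l)\<^sup>2 - 1)\<bar> \<partial>noise_law T N D) \<le> C * sqrt (2 * D)"
proof -
  interpret prob_space "noise_law T N D" by (rule prob_space_noise_law)
  interpret g: prob_space "Sigma_law N" by (rule prob_space_Sigma_law)
  note mom = Sigma_coord_moments[OF l]
  let ?f = "\<lambda>v :: nat \<Rightarrow> real. (v l)\<^sup>2 - 1"
  have f: "integrable (Sigma_law N) ?f" "(\<integral>v. ?f v \<partial>Sigma_law N) = 0"
    using mom(1)[of 2] mom(4) g.prob_space by (simp_all del: One_nat_def)
  have ff: "?f v * ?f v = v l ^ 4 - 2 * (v l)\<^sup>2 + 1" for v :: "nat \<Rightarrow> real"
    by (simp add: power2_eq_square power4_eq_xxxx algebra_simps)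
  have f2: "integrable (Sigma_law N) (\<lambda>v. ?f v * ?f v)" "(\<integral>v. ?f v * ?f v \<partial>Sigma_law N) = 2"
    unfolding ff using mom(1)[of 2] mom(1)[of 4] mom(4,5) g.prob_space by (simp_all del: One_nat_def)
  have Y: "integrable (noise_law T N D) (\<lambda>u. ?f (u (t, d)) * ?f (u (t, e))) \<and>
      (\<integral>u. ?f (u (t, d)) * ?f (u (t, e)) \<partial>noise_law T N D) = (if d = e then 2 else 0)"
    if "d \<in> {1..D}" "e \<in> {1..D}" for d e
  proof (cases "d = e")
    case True
    then show ?thesis
      using noise_prod[of "{(t, d)}" T D N "\<lambda>_ v. ?f v * ?f v"] that t f2 by (simp del: One_nat_def)
  next
    case False
    then show ?thesis
      using noise_prod[of "{(t, d), (t, e)}" T D N "\<lambda>_. ?f"] that t f by (simp del: One_nat_def)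
  qed
  note sm = orthogonal_sum_second_moment[of "{1..D}" "noise_law T N D" "\<lambda>d u. ?f (u (t, d))" 2 c C]
  have "(\<lambda>u. \<Sum>d=1..D. c d * ?f (u (t, d))) \<in> borel_measurable (noise_law T N D)"
    using t l by (intro borel_measurable_sum borel_measurable_times borel_measurable_const borel_measurable_diff
      borel_measurable_power noise_coord_measurable) auto
  note es = expectation_abs_le_sqrt[OF this, of "C\<^sup>2 * 2 * real (card {1..D})"]
  show "integrable (noise_law T N D) (\<lambda>u. \<Sum>d=1..D. c d * ((u (t, d) l)\<^sup>2 - 1))"
    by (rule es(1); rule sm) (use Y c in auto)
  have "expectation (\<lambda>u. \<bar>\<Sum>d=1..D. c d * ((u (t, d) l)\<^sup>2 - 1)\<bar>) \<le> sqrt (C\<^sup>2 * 2 * real (card {1..D}))"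
    by (rule es(2); rule sm) (use Y c in auto)
  then show "(\<integral>u. \<bar>\<Sum>d=1..D. c d * ((u (t, d) l)\<^sup>2 - 1)\<bar> \<partial>noise_law T N D) \<le> C * sqrt (2 * D)"
    using C by (simp add: real_sqrt_mult)
qed

text \<open>Noise at different times is independent, so the products are centred with second moment
  1 and orthogonal over \<open>d\<close>. Particles at equal times would be correlated through
  Sigma; in the Taylor expansion \<open>s = t - 1\<close>.\<close>

lemma noise_mixed_sum:
  assumes t: "s \<in> {1..T}" "t \<in> {1..T}" "s \<noteq> t" and l: "a \<in> {1..N}" "l \<in> {1..N}"
    and c: "\<And>d. d \<in> {1..D} \<Longrightarrow> \<bar>c d\<bar> \<le> C" and C: "0 \<le> C"
  shows "integrable (noise_law T N D) (\<lambda>u. \<Sum>d=1..D. c d * (u (s, d) a * u (t, d) l))"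
    and "(\<integral>u. \<bar>\<Sum>d=1..D. c d * (u (s, d) a * u (t, d) l)\<bar> \<partial>noise_law T N D) \<le> C * sqrt D"
proof -
  interpret prob_space "noise_law T N D" by (rule prob_space_noise_law)
  let ?y = "\<lambda>d u. u (s, d) a * u (t, d) l :: real"
  note mom = Sigma_coord_moments[OF l(1)] Sigma_coord_moments[OF l(2)]
  have Y: "integrable (noise_law T N D) (\<lambda>u. ?y d u * ?y e u) \<and>
      (\<integral>u. ?y d u * ?y e u \<partial>noise_law T N D) = (if d = e then 1 else 0)"
    if "d \<in> {1..D}" "e \<in> {1..D}" for d e
  proof (cases "d = e")
    case True
    have "?y d u * ?y d u = (u (s, d) a)\<^sup>2 * (u (t, d) l)\<^sup>2" for u :: "nat \<times> nat \<Rightarrow> nat \<Rightarrow> real"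
      by (simp add: power2_eq_square)
    moreover define f where "f j = (if fst j = s then (\<lambda>v :: nat \<Rightarrow> real. (v a)\<^sup>2) else (\<lambda>v. (v l)\<^sup>2))"
      for j :: "nat \<times> nat"
    have fi: "integrable (Sigma_law N) (f j)" for j
      using mom(1)[of 2] mom(6)[of 2] by (simp add: f_def del: One_nat_def)
    have "{(s, d), (t, d)} \<subseteq> {1..T} \<times> {1..D}" using t that by simp
    from noise_prod[OF this, of N f, OF fi] have "integrable (noise_law T N D) (\<lambda>u. (u (s, d) a)\<^sup>2 * (u (t, d) l)\<^sup>2)"
      "(\<integral>u. (u (s, d) a)\<^sup>2 * (u (t, d) l)\<^sup>2 \<partial>noise_law T N D) = 1"
      using t mom(4) mom(9) by (simp_all add: f_def del: One_nat_def)
    ultimately show ?thesis using True by simp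
  next
    case False
    have "?y d u * ?y e u = u (s, d) a * (u (t, d) l * (u (s, e) a * u (t, e) l))" for u :: "nat \<times> nat \<Rightarrow> nat \<Rightarrow> real"
      by simp
    moreover define f where "f j = (if fst j = s then (\<lambda>v :: nat \<Rightarrow> real. v a) else (\<lambda>v. v l))"
      for j :: "nat \<times> nat"
    have fi: "integrable (Sigma_law N) (f j)" for j
      using mom(2) mom(7) by (simp add: f_def del: One_nat_def)
    have "{(s, d), (t, d), (s, e), (t, e)} \<subseteq> {1..T} \<times> {1..D}" using t that by simp
    from noise_prod[OF this, of N f, OF fi] have
      "integrable (noise_law T N D) (\<lambda>u. u (s, d) a * (u (t, d) l * (u (s, e) a * u (t, e) l)))"
      "(\<integral>u. u (s, d) a * (u (t, d) l * (u (s, e) a * u (t, e) l)) \<partial>noise_law T N D) = 0"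
      using t False mom(3) mom(8) by (simp_all add: f_def del: One_nat_def)
    ultimately show ?thesis using False by (simp add: mult.assoc)
  qed
  note sm = orthogonal_sum_second_moment[of "{1..D}" "noise_law T N D" "\<lambda>d u. ?y d u" 1 c C]
  have "(\<lambda>u. \<Sum>d=1..D. c d * ?y d u) \<in> borel_measurable (noise_law T N D)"
    using t l by (intro borel_measurable_sum borel_measurable_times borel_measurable_const
       noise_coord_measurable) auto
  note es = expectation_abs_le_sqrt[OF this, of "C\<^sup>2 * 1 * real (card {1..D})"]
  show "integrable (noise_law T N D) (\<lambda>u. \<Sum>d=1..D. c d * (u (s, d) a * u (t, d) l))"
    by (rule es(1); rule sm) (use Y c in auto)
  have "expectation (\<lambda>u. \<bar>\<Sum>d=1..D. c d * (u (s, d) a * u (t, d) l)\<bar>) \<le> sqrt (C\<^sup>2 * 1 * real (card {1..D}))"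
    by (rule es(2); rule sm) (use Y c in auto)
  then show "(\<integral>u. \<bar>\<Sum>d=1..D. c d * (u (s, d) a * u (t, d) l)\<bar> \<partial>noise_law T N D) \<le> C * sqrt D"
    using C by (simp add: real_sqrt_mult)
qed

text \<open>Odd absolute moments are dominated by even ones: \<open>4 = 1 + 3\<close> and
  \<open>2 = 1 + 1\<close>. The cubic bound is for the Taylor remainder, the first-order one for the
  coupling of two linear images.\<close>

lemma noise_abs_moments:
  assumes "i \<in> {1..T} \<times> {1..D}" and n: "n \<in> {1..N}"
  shows "integrable (noise_law T N D) (\<lambda>u. \<bar>u i n\<bar> ^ 3)" "(\<integral>u. \<bar>u i n\<bar> ^ 3 \<partial>noise_law T N D) \<le> 4"
    and "integrable (noise_law T N D) (\<lambda>u. \<bar>u i n\<bar>)" "(\<integral>u. \<bar>u i n\<bar> \<partial>noise_law T N D) \<le> 2"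
proof -
  interpret prob_space "noise_law T N D" by (rule prob_space_noise_law)
  note mom = Sigma_coord_moments[OF n]
  have k: "integrable (noise_law T N D) (\<lambda>u. (u i n) ^ k)"
     "(\<integral>u. (u i n) ^ k \<partial>noise_law T N D) = (\<integral>v. (v n) ^ k \<partial>Sigma_law N)" for k
    using noise_prod[of "{i}" T D N "\<lambda>_ v. (v n) ^ k"] assms(1) mom(1)[of k] by simp_all
  note m = noise_coord_measurable[OF assms]
  have 3: "\<bar>x\<bar> ^ 3 \<le> 1 + x ^ 4" for x :: real
  proof (cases "\<bar>x\<bar> \<le> 1")
    case True
    then have "\<bar>x\<bar> ^ 3 \<le> 1" by (simp add: power_le_one)
    then show ?thesis by (simp add: add_increasing2)
  next
    case False
    then have "\<bar>x\<bar> ^ 3 \<le> \<bar>x\<bar> ^ 4" by (intro power_increasing) auto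
    then show ?thesis by simp
  qed
  have 1: "\<bar>x\<bar> \<le> 1 + x\<^sup>2" for x :: real
  proof -
    have "0 \<le> (\<bar>x\<bar> - 1)\<^sup>2" by simp
    then show ?thesis by (simp add: power2_diff)
  qed
  have i4: "integrable (noise_law T N D) (\<lambda>u. 1 + (u i n) ^ 4)" and i2: "integrable (noise_law T N D) (\<lambda>u. 1 + (u i n)\<^sup>2)"
    using k(1)[of 4] k(1)[of 2] by simp_all
  show i3: "integrable (noise_law T N D) (\<lambda>u. \<bar>u i n\<bar> ^ 3)"
    by (rule Bochner_Integration.integrable_bound[OF i4]) (use m 3 in \<open>auto intro!: AE_I2 order_trans[OF 3]\<close>)
  show i1: "integrable (noise_law T N D) (\<lambda>u. \<bar>u i n\<bar>)" using k(1)[of 1] by simp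
  have "(\<integral>u. \<bar>u i n\<bar> ^ 3 \<partial>noise_law T N D) \<le> (\<integral>u. 1 + (u i n) ^ 4 \<partial>noise_law T N D)"
    by (intro integral_mono i3 i4 3)
  also have "\<dots> = 4" using k[of 4] mom(5) prob_space by simp
  finally show "(\<integral>u. \<bar>u i n\<bar> ^ 3 \<partial>noise_law T N D) \<le> 4" .
  have "(\<integral>u. \<bar>u i n\<bar> \<partial>noise_law T N D) \<le> (\<integral>u. 1 + (u i n)\<^sup>2 \<partial>noise_law T N D)"
    by (intro integral_mono i1 i2 1)
  also have "\<dots> = 2" using k[of 2] mom(4) prob_space by simp
  finally show "(\<integral>u. \<bar>u i n\<bar> \<partial>noise_law T N D) \<le> 2" .
qed

section \<open>Linearisation of the log-weights\<close>

lemma integral_add_le: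
  fixes f g :: "'a \<Rightarrow> real"
  assumes "integrable M f \<and> (\<integral>u. f u \<partial>M) \<le> b" "integrable M g \<and> (\<integral>u. g u \<partial>M) \<le> c"
  shows "integrable M (\<lambda>u. f u + g u) \<and> (\<integral>u. f u + g u \<partial>M) \<le> b + c"
  using assms by auto

lemma integral_divide_le:
  fixes f :: "'a \<Rightarrow> real"
  assumes "integrable M f \<and> (\<integral>u. f u \<partial>M) \<le> b" "0 \<le> c"
  shows "integrable M (\<lambda>u. f u / c) \<and> (\<integral>u. f u / c \<partial>M) \<le> b / c"
  using assms by (auto intro: divide_right_mono)

text \<open>The functions \<open>w t\<close> abstract the log-weights. Time \<open>T + 1\<close> is
  included since \<open>W\<close> at time \<open>T\<close> is built from it, and \<open>w1\<close>
  expresses that the initial weight ignores a predecessor.\<close>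

locale smooth_weights =
  fixes T N :: nat and ell :: "nat \<Rightarrow> real" and w :: "nat \<Rightarrow> real \<Rightarrow> real \<Rightarrow> real" and L :: real
  assumes T: "1 \<le> T" and ell: "\<And>t. t \<in> {1..T} \<Longrightarrow> 0 < ell t"
    and tcd: "\<And>t. t \<in> {1..T + 1} \<Longrightarrow> twice_cont_diff (\<lambda>(x, y). w t x y)"
    and lip: "\<And>t. t \<in> {1..T + 1} \<Longrightarrow> lip2 L (partial1 (partial1 (w t)))"
      "\<And>t. t \<in> {1..T + 1} \<Longrightarrow> lip2 L (partial1 (partial2 (w t)))"
      "\<And>t. t \<in> {1..T + 1} \<Longrightarrow> lip2 L (partial2 (partial2 (w t)))"
    and w1: "\<And>x x' y. w 1 x y = w 1 x' y" and L0: "0 \<le> L"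
begin

definition delta :: "nat \<Rightarrow> (nat \<Rightarrow> nat \<Rightarrow> real) \<Rightarrow> (nat \<times> nat \<Rightarrow> nat \<Rightarrow> real) \<Rightarrow> nat \<Rightarrow> nat \<Rightarrow> nat \<Rightarrow> real" where
  "delta D x u t a l = (\<Sum>d=1..D. w t (particle D ell x u (t - 1) a d) (particle D ell x u t l d)
     - w t (x (t - 1) d) (x t d))"

definition alpha :: "nat \<Rightarrow> (nat \<Rightarrow> nat \<Rightarrow> real) \<Rightarrow> nat \<Rightarrow> nat \<Rightarrow> real" where
  "alpha D x t d = sqrt (ell t / D) * partial2 (w t) (x (t - 1) d) (x t d)"

definition beta :: "nat \<Rightarrow> (nat \<Rightarrow> nat \<Rightarrow> real) \<Rightarrow> nat \<Rightarrow> nat \<Rightarrow> real" where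
  "beta D x t d = sqrt (ell t / D) * partial1 (w (t + 1)) (x t d) (x (t + 1) d)"

definition mu :: "nat \<Rightarrow> (nat \<Rightarrow> nat \<Rightarrow> real) \<Rightarrow> nat \<Rightarrow> nat + nat \<Rightarrow> real" where
  "mu D x t i = (case i of
     Inl n \<Rightarrow> 1/2 * ell t * ((\<Sum>d=1..D. partial2 (partial2 (w t)) (x (t - 1) d) (x t d)) / D)
   | Inr n \<Rightarrow> 1/2 * ell t * ((\<Sum>d=1..D. partial1 (partial1 (w (t + 1))) (x t d) (x (t + 1) d)) / D))"

definition linear_vw :: "nat \<Rightarrow> (nat \<Rightarrow> nat \<Rightarrow> real) \<Rightarrow> (nat \<times> nat \<Rightarrow> nat \<Rightarrow> real) \<Rightarrow> nat \<Rightarrow> nat + nat \<Rightarrow> real" where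
  "linear_vw D x u t i = mu D x t i + noise_lin D (alpha D x) (beta D x) u t i"

text \<open>The displacement of particle \<open>n\<close> at time \<open>s\<close>, scaled up by
  \<open>sqrt D\<close>. Zero for the reference particle and at the fictitious time 0, it lets one
  expansion cover all cases; \<open>xi_var\<close> is its variance.\<close>

definition xi :: "nat \<Rightarrow> nat \<Rightarrow> (nat \<times> nat \<Rightarrow> nat \<Rightarrow> real) \<Rightarrow> nat \<Rightarrow> real" where
  "xi s n u d = (if n = 0 \<or> s = 0 then 0 else sqrt (ell s) * u (s, d) n)"

definition xi_var :: "nat \<Rightarrow> nat \<Rightarrow> real" where
  "xi_var s n = (if n = 0 \<or> s = 0 then 0 else ell s)"

text \<open>The first two lines are fluctuations of the pure second-order terms about the drifts,
  with the factor 1/2 dropped. The mixed term has mean zero and hence no drift. The last line is the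
  cubic Taylor error, with \<open>8 = 2 * 4\<close> from \<open>taylor2\<close> and
  \<open>cube_sum_le\<close>.\<close>

definition remainder_bound :: "nat \<Rightarrow> (nat \<Rightarrow> nat \<Rightarrow> real) \<Rightarrow> (nat \<times> nat \<Rightarrow> nat \<Rightarrow> real) \<Rightarrow> nat \<Rightarrow> nat \<Rightarrow> nat \<Rightarrow> real" where
  "remainder_bound D x u t a l =
     \<bar>\<Sum>d=1..D. partial2 (partial2 (w t)) (x (t - 1) d) (x t d) * ((xi t l u d)\<^sup>2 - xi_var t l)\<bar> / D
   + \<bar>\<Sum>d=1..D. partial1 (partial1 (w t)) (x (t - 1) d) (x t d) * ((xi (t - 1) a u d)\<^sup>2 - xi_var (t - 1) a)\<bar> / D
   + \<bar>\<Sum>d=1..D. partial1 (partial2 (w t)) (x (t - 1) d) (x t d) * (xi (t - 1) a u d * xi t l u d)\<bar> / D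
   + (\<Sum>d=1..D. 8 * L * (\<bar>xi (t - 1) a u d\<bar> ^ 3 + \<bar>xi t l u d\<bar> ^ 3)) / (D * sqrt D)"

lemma delta_measurable:
  assumes t: "t \<in> {1..T}" and al: "a \<le> N" "l \<le> N"
  shows "(\<lambda>u. delta D x u t a l) \<in> borel_measurable (noise_law T N D)"
proof -
  have p: "(\<lambda>u. particle D ell x u s n d) \<in> borel_measurable (noise_law T N D)"
    if "s \<in> {1..T}" "n \<le> N" "d \<in> {1..D}" for s n d
    unfolding particle_def using that
    by (cases "n = 0") (auto intro!: borel_measurable_times borel_measurable_add noise_coord_measurable)
  have w: "(\<lambda>(x, y). w t x y) \<in> borel_measurable borel"
    using t by (intro borel_measurable_continuous_onI twice_cont_diff_partials(6) tcd) auto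
  have "(\<lambda>u. w t (particle D ell x u (t - 1) a d) (particle D ell x u t l d)) \<in> borel_measurable (noise_law T N D)"
    if d: "d \<in> {1..D}" for d
  \<comment> \<open>At \<open>t = 1\<close> the predecessor would read noise at time 0, outside the
    product space. Since it has no influence on the weight, it is replaced by the constant
    0.\<close>
  proof (cases "t = 1")
    case True
    have "(\<lambda>u. (0 :: real, particle D ell x u t l d)) \<in> borel_measurable (noise_law T N D)"
      by (intro borel_measurable_Pair borel_measurable_const p t al d)
    from measurable_compose[OF this w]
    have "(\<lambda>u. w 1 0 (particle D ell x u t l d)) \<in> borel_measurable (noise_law T N D)"
      using True by simp
    then show ?thesis unfolding True using w1[of "particle D ell x _ (1 - 1) a d" _ 0] True by simp
  next
    case False
    have "(\<lambda>u. (particle D ell x u (t - 1) a d, particle D ell x u t l d)) \<in> borel_measurable (noise_law T N D)"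
      using False t by (intro borel_measurable_Pair p t al d) auto
    from measurable_compose[OF this w] show ?thesis by simp
  qed
  then show ?thesis unfolding delta_def by (intro borel_measurable_sum borel_measurable_diff borel_measurable_const) auto
qed

lemma cube_sum_le: "(\<bar>a\<bar> + \<bar>b\<bar>) ^ 3 \<le> 4 * (\<bar>a\<bar> ^ 3 + \<bar>b\<bar> ^ 3)" for a b :: real
proof -
  have "4 * (p ^ 3 + q ^ 3) - (p + q) ^ 3 = 3 * ((p + q) * (p - q)\<^sup>2)" for p q :: real
    by (simp add: power2_eq_square power3_eq_cube algebra_simps)
  from this[of "\<bar>a\<bar>" "\<bar>b\<bar>"] have "0 \<le> 4 * (\<bar>a\<bar> ^ 3 + \<bar>b\<bar> ^ 3) - (\<bar>a\<bar> + \<bar>b\<bar>) ^ 3"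
    by (simp only:) (intro mult_nonneg_nonneg, auto)
  then show ?thesis by simp
qed

text \<open>First-order Taylor terms are exactly the linear images of the noise, and second-order
  terms with the squared displacements replaced by their variances are exactly the drifts in
  \<open>mu\<close>. The estimate is pathwise in \<open>u\<close>.\<close>

lemma delta_linear_diff:
  assumes t: "t \<in> {1..T}" and D: "1 \<le> D"
  shows "\<bar>delta D x u t a l - (Vpart (linear_vw D x u) t l + Wpart (linear_vw D x u) (t - 1) a)\<bar>
    \<le> remainder_bound D x u t a l"
proof -
  define h k where "h d = xi (t - 1) a u d" and "k d = xi t l u d" for d
  let ?r = "sqrt (real D)"
  have r: "?r > 0" "?r * ?r = D" using D by simp_all
  let ?p = "\<lambda>f d. f (w t) (x (t - 1) d) (x t d)"
  let ?p1 = "\<lambda>d. partial1 (w t) (x (t - 1) d) (x t d)"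
  let ?p2 = "\<lambda>d. partial2 (w t) (x (t - 1) d) (x t d)"
  let ?p11 = "\<lambda>d. partial1 (partial1 (w t)) (x (t - 1) d) (x t d)"
  let ?p12 = "\<lambda>d. partial1 (partial2 (w t)) (x (t - 1) d) (x t d)"
  let ?p22 = "\<lambda>d. partial2 (partial2 (w t)) (x (t - 1) d) (x t d)"
  let ?dw = "\<lambda>d. w t (particle D ell x u (t - 1) a d) (particle D ell x u t l d) - w t (x (t - 1) d) (x t d)"
  define R where "R d = ?dw d - (?p1 d * (h d / ?r) + ?p2 d * (k d / ?r)
      + 1/2 * ?p11 d * (h d / ?r)\<^sup>2 + ?p12 d * (h d / ?r) * (k d / ?r) + 1/2 * ?p22 d * (k d / ?r)\<^sup>2)" for d
  have part: "particle D ell x u s n d = x s d + xi s n u d / ?r" if "s \<noteq> 0" for s n d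
    using that by (simp add: particle_def xi_def real_sqrt_divide)
  have Rb: "\<bar>R d\<bar> \<le> 8 * L * (\<bar>h d\<bar> ^ 3 + \<bar>k d\<bar> ^ 3) / (D * ?r)" for d
  proof -
    have "?dw d = w t (x (t - 1) d + h d / ?r) (x t d + k d / ?r) - w t (x (t - 1) d) (x t d)"
    \<comment> \<open>Here \<open>h d\<close> is 0 by the convention at time 0, while the particle
      at time 0 need not equal the state; \<open>w1\<close> reconciles the two.\<close>
    proof (cases "t = 1")
      case True
      then show ?thesis using w1[of _ _ "x (t - 1) d + h d / ?r"] part[of t l d] by (simp add: k_def)
    next
      case False
      then show ?thesis using part[of t l d] part[of "t - 1" a d] t by (simp add: k_def h_def)
    qed
    then have "\<bar>R d\<bar> \<le> 2 * L * (\<bar>h d / ?r\<bar> + \<bar>k d / ?r\<bar>) ^ 3"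
      unfolding R_def by (simp only:) (rule taylor2; use t in \<open>auto intro!: tcd lip\<close>)
    also have "\<dots> \<le> 2 * L * (4 * (\<bar>h d / ?r\<bar> ^ 3 + \<bar>k d / ?r\<bar> ^ 3))"
      using L0 by (intro mult_left_mono cube_sum_le) auto
    also have "\<dots> = 8 * L * (\<bar>h d\<bar> ^ 3 + \<bar>k d\<bar> ^ 3) / ?r ^ 3"
      using r(1) by (simp add: power_divide field_simps)
    also have "?r ^ 3 = D * ?r" using r by (simp add: power3_eq_cube)
    finally show ?thesis .
  qed
  have V: "Vpart (linear_vw D x u) t l = (\<Sum>d=1..D. ?p2 d * (k d / ?r)) + 1/2 * xi_var t l * ((\<Sum>d=1..D. ?p22 d) / D)"
    using t by (simp add: Vpart_def linear_vw_def mu_def noise_lin_def alpha_def k_def xi_def xi_var_def real_sqrt_divide mult_ac)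
  have W: "Wpart (linear_vw D x u) (t - 1) a = (\<Sum>d=1..D. ?p1 d * (h d / ?r)) + 1/2 * xi_var (t - 1) a * ((\<Sum>d=1..D. ?p11 d) / D)"
    using t by (simp add: Wpart_def linear_vw_def mu_def noise_lin_def beta_def h_def xi_def xi_var_def real_sqrt_divide mult_ac)
  have sq: "(z / ?r)\<^sup>2 = z\<^sup>2 / D" for z using D by (simp add: power_divide)
  have dw: "?dw d = ?p1 d * (h d / ?r) + ?p2 d * (k d / ?r)
      + 1/2 * (?p11 d * (h d)\<^sup>2) / D + ?p12 d * (h d * k d) / D + 1/2 * (?p22 d * (k d)\<^sup>2) / D + R d" for d
    unfolding R_def sq using r by (simp add: field_simps)
  let ?S2 = "\<Sum>d=1..D. ?p22 d * ((k d)\<^sup>2 - xi_var t l)"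
  let ?S1 = "\<Sum>d=1..D. ?p11 d * ((h d)\<^sup>2 - xi_var (t - 1) a)"
  let ?S3 = "\<Sum>d=1..D. ?p12 d * (h d * k d)"
  have tri: "\<bar>a + b + c + d\<bar> \<le> \<bar>a\<bar> + \<bar>b\<bar> + \<bar>c\<bar> + \<bar>d\<bar>" for a b c d :: real
    by (intro order_trans[OF abs_triangle_ineq] add_mono order_refl)
  \<comment> \<open>\<open>S2\<close> and \<open>S1\<close> are the quadratic sums \<open>Q2\<close>
    and \<open>Q1\<close> minus their means \<open>v * Z2\<close> and \<open>v' * Z1\<close>; these
    means cancel against the drifts of \<open>V\<close> and \<open>W\<close>.\<close>
  have alg: "\<lbrakk>e = P1 + P2 + 1/2 * Q1 / c + S3 / c + 1/2 * Q2 / c + r; S2 = Q2 - v * Z2; S1 = Q1 - v' * Z1\<rbrakk>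
      \<Longrightarrow> e - ((P2 + 1/2 * v * (Z2 / c)) + (P1 + 1/2 * v' * (Z1 / c))) = 1/2 * S2 / c + 1/2 * S1 / c + S3 / c + r"
    for e P1 P2 Q1 Q2 S1 S2 S3 r v v' Z1 Z2 c :: real
    by (simp add: diff_divide_distrib)
  have "delta D x u t a l = (\<Sum>d=1..D. ?p1 d * (h d / ?r)) + (\<Sum>d=1..D. ?p2 d * (k d / ?r))
     + 1/2 * (\<Sum>d=1..D. ?p11 d * (h d)\<^sup>2) / D + ?S3 / D
     + 1/2 * (\<Sum>d=1..D. ?p22 d * (k d)\<^sup>2) / D + (\<Sum>d=1..D. R d)"
    unfolding delta_def dw by (simp add: sum.distrib sum_divide_distrib sum_distrib_left)
  moreover have "?S2 = (\<Sum>d=1..D. ?p22 d * (k d)\<^sup>2) - xi_var t l * (\<Sum>d=1..D. ?p22 d)"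
    "?S1 = (\<Sum>d=1..D. ?p11 d * (h d)\<^sup>2) - xi_var (t - 1) a * (\<Sum>d=1..D. ?p11 d)"
    by (simp_all add: algebra_simps sum_subtractf sum_distrib_left)
  ultimately have eq: "delta D x u t a l - (Vpart (linear_vw D x u) t l + Wpart (linear_vw D x u) (t - 1) a)
     = 1/2 * ?S2 / D + 1/2 * ?S1 / D + ?S3 / D + (\<Sum>d=1..D. R d)"
    unfolding V W by (rule alg)
  have "\<bar>delta D x u t a l - (Vpart (linear_vw D x u) t l + Wpart (linear_vw D x u) (t - 1) a)\<bar>
    \<le> \<bar>1/2 * ?S2 / D\<bar> + \<bar>1/2 * ?S1 / D\<bar> + \<bar>?S3 / D\<bar> + \<bar>\<Sum>d=1..D. R d\<bar>"
    unfolding eq by (rule tri)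
  also have "\<dots> \<le> \<bar>?S2\<bar> / D + \<bar>?S1\<bar> / D + \<bar>?S3\<bar> / D + (\<Sum>d=1..D. 8 * L * (\<bar>h d\<bar> ^ 3 + \<bar>k d\<bar> ^ 3)) / (D * ?r)"
  proof -
    have one: "\<bar>s / c\<bar> \<le> \<bar>s\<bar> / c" if "0 < c" for s c :: real
      using that by simp
    have half: "\<bar>1/2 * s / c\<bar> \<le> \<bar>s\<bar> / c" if "0 < c" for s c :: real
    proof -
      have "\<bar>s\<bar> / (2 * c) \<le> \<bar>s\<bar> / c" using that by (intro divide_left_mono) auto
      then show ?thesis using that by simp
    qed
    have c: "0 < real D" using D by simp
    have "\<bar>\<Sum>d=1..D. R d\<bar> \<le> (\<Sum>d=1..D. \<bar>R d\<bar>)" by (rule sum_abs)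
    also have "\<dots> \<le> (\<Sum>d=1..D. 8 * L * (\<bar>h d\<bar> ^ 3 + \<bar>k d\<bar> ^ 3) / (D * ?r))" by (rule sum_mono) (rule Rb)
    also have "\<dots> = (\<Sum>d=1..D. 8 * L * (\<bar>h d\<bar> ^ 3 + \<bar>k d\<bar> ^ 3)) / (D * ?r)" by (rule sum_divide_distrib[symmetric])
    finally show ?thesis by (rule add_mono[OF add_mono[OF add_mono[OF half[OF c] half[OF c]] one[OF c]]])
  qed
  finally show ?thesis unfolding remainder_bound_def h_def k_def .
qed

text \<open>A common upper bound of the step sizes that is also at least 1, so that
  \<open>ell s * sqrt (ell s)\<close> is bounded by \<open>Lam^2\<close> in the cubic terms.\<close>

definition Lam :: real where "Lam = 1 + (\<Sum>s=1..T. ell s)"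

lemma Lam: "1 \<le> Lam" "s \<in> {1..T} \<Longrightarrow> ell s \<le> Lam"
proof -
  show "1 \<le> Lam" unfolding Lam_def by (simp del: One_nat_def) (intro sum_nonneg less_imp_le ell)
  show "ell s \<le> Lam" if "s \<in> {1..T}"
    using member_le_sum[of s "{1..T}" ell] that ell unfolding Lam_def by (force intro: less_imp_le)
qed

lemma xi_square_sum:
  assumes s: "s \<le> T" and n: "n \<le> N" and c: "\<And>d. d \<in> {1..D} \<Longrightarrow> \<bar>c d\<bar> \<le> L"
  shows "integrable (noise_law T N D) (\<lambda>u. \<bar>\<Sum>d=1..D. c d * ((xi s n u d)\<^sup>2 - xi_var s n)\<bar>)"
    and "(\<integral>u. \<bar>\<Sum>d=1..D. c d * ((xi s n u d)\<^sup>2 - xi_var s n)\<bar> \<partial>noise_law T N D) \<le> 2 * L * Lam * sqrt D"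
proof -
  have "integrable (noise_law T N D) (\<lambda>u. \<bar>\<Sum>d=1..D. c d * ((xi s n u d)\<^sup>2 - xi_var s n)\<bar>) \<and>
    (\<integral>u. \<bar>\<Sum>d=1..D. c d * ((xi s n u d)\<^sup>2 - xi_var s n)\<bar> \<partial>noise_law T N D) \<le> 2 * L * Lam * sqrt D"
  proof (cases "n = 0 \<or> s = 0")
    case True
    then show ?thesis using L0 Lam(1) by (simp add: xi_def xi_var_def)
  next
    case False
    then have sn: "s \<in> {1..T}" "n \<in> {1..N}" using s n by auto
    have e: "(\<Sum>d=1..D. c d * ((xi s n u d)\<^sup>2 - xi_var s n)) = ell s * (\<Sum>d=1..D. c d * ((u (s, d) n)\<^sup>2 - 1))" for u
      using False ell[OF sn(1)] unfolding xi_def xi_var_def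
      by (simp add: power_mult_distrib sum_distrib_left algebra_simps)
    note sq = noise_square_sum[OF sn c L0]
    have "(\<integral>u. \<bar>ell s * (\<Sum>d=1..D. c d * ((u (s, d) n)\<^sup>2 - 1))\<bar> \<partial>noise_law T N D)
       = ell s * (\<integral>u. \<bar>\<Sum>d=1..D. c d * ((u (s, d) n)\<^sup>2 - 1)\<bar> \<partial>noise_law T N D)"
      using ell[OF sn(1)] by (simp add: abs_mult)
    also have "\<dots> \<le> Lam * (L * sqrt (2 * D))"
      using Lam(1) by (intro mult_mono Lam(2) sn(1) sq(2)) auto
    also have "\<dots> \<le> Lam * (L * (2 * sqrt D))"
      using Lam(1) L0 by (intro mult_left_mono) (auto simp: real_sqrt_mult intro!: mult_right_mono real_le_lsqrt)
    finally show ?thesis unfolding e using sq(1) by (auto simp: mult_ac)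
  qed
  then show "integrable (noise_law T N D) (\<lambda>u. \<bar>\<Sum>d=1..D. c d * ((xi s n u d)\<^sup>2 - xi_var s n)\<bar>)"
    "(\<integral>u. \<bar>\<Sum>d=1..D. c d * ((xi s n u d)\<^sup>2 - xi_var s n)\<bar> \<partial>noise_law T N D) \<le> 2 * L * Lam * sqrt D"
    by auto
qed

lemma xi_mixed_sum:
  assumes st: "s \<le> T" "t \<le> T" "s \<noteq> t" and n: "a \<le> N" "l \<le> N" and c: "\<And>d. d \<in> {1..D} \<Longrightarrow> \<bar>c d\<bar> \<le> L"
  shows "integrable (noise_law T N D) (\<lambda>u. \<bar>\<Sum>d=1..D. c d * (xi s a u d * xi t l u d)\<bar>)"
    and "(\<integral>u. \<bar>\<Sum>d=1..D. c d * (xi s a u d * xi t l u d)\<bar> \<partial>noise_law T N D) \<le> 2 * L * Lam * sqrt D"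
proof -
  have "integrable (noise_law T N D) (\<lambda>u. \<bar>\<Sum>d=1..D. c d * (xi s a u d * xi t l u d)\<bar>) \<and>
    (\<integral>u. \<bar>\<Sum>d=1..D. c d * (xi s a u d * xi t l u d)\<bar> \<partial>noise_law T N D) \<le> 2 * L * Lam * sqrt D"
  proof (cases "a = 0 \<or> s = 0 \<or> l = 0 \<or> t = 0")
    case True
    then have z: "xi s a u d * xi t l u d = 0" for u d by (auto simp: xi_def)
    show ?thesis unfolding z using L0 Lam(1) by simp
  next
    case False
    then have sn: "s \<in> {1..T}" "t \<in> {1..T}" "a \<in> {1..N}" "l \<in> {1..N}" using st n by auto
    let ?e = "sqrt (ell s) * sqrt (ell t)"
    have e: "(\<Sum>d=1..D. c d * (xi s a u d * xi t l u d)) = ?e * (\<Sum>d=1..D. c d * (u (s, d) a * u (t, d) l))" for u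
      using False unfolding xi_def by (simp add: sum_distrib_left mult_ac)
    have "sqrt (ell s) \<le> sqrt Lam" "sqrt (ell t) \<le> sqrt Lam" using Lam(2) sn by auto
    then have "?e \<le> sqrt Lam * sqrt Lam" using ell[OF sn(1)] ell[OF sn(2)] Lam(1) by (intro mult_mono) auto
    then have le: "?e \<le> Lam" "0 \<le> ?e" using Lam(1) ell[OF sn(1)] ell[OF sn(2)] by auto
    note sq = noise_mixed_sum[OF sn(1,2) st(3) sn(3,4) c L0]
    have "(\<integral>u. \<bar>?e * (\<Sum>d=1..D. c d * (u (s, d) a * u (t, d) l))\<bar> \<partial>noise_law T N D)
       = ?e * (\<integral>u. \<bar>\<Sum>d=1..D. c d * (u (s, d) a * u (t, d) l)\<bar> \<partial>noise_law T N D)"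
      using ell[OF sn(1)] ell[OF sn(2)] by (simp add: abs_mult)
    also have "\<dots> \<le> Lam * (L * sqrt D)"
      using Lam(1) by (intro mult_mono le(1) sq(2)) auto
    also have "\<dots> \<le> 2 * L * Lam * sqrt D" using Lam(1) L0 by simp
    finally show ?thesis unfolding e using sq(1) by auto
  qed
  then show "integrable (noise_law T N D) (\<lambda>u. \<bar>\<Sum>d=1..D. c d * (xi s a u d * xi t l u d)\<bar>)"
    "(\<integral>u. \<bar>\<Sum>d=1..D. c d * (xi s a u d * xi t l u d)\<bar> \<partial>noise_law T N D) \<le> 2 * L * Lam * sqrt D"
    by auto
qed

lemma xi_cube:
  assumes "s \<le> T" "n \<le> N" "d \<in> {1..D}"
  shows "integrable (noise_law T N D) (\<lambda>u. \<bar>xi s n u d\<bar> ^ 3)"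
    and "(\<integral>u. \<bar>xi s n u d\<bar> ^ 3 \<partial>noise_law T N D) \<le> 4 * Lam\<^sup>2"
proof -
  have "integrable (noise_law T N D) (\<lambda>u. \<bar>xi s n u d\<bar> ^ 3) \<and> (\<integral>u. \<bar>xi s n u d\<bar> ^ 3 \<partial>noise_law T N D) \<le> 4 * Lam\<^sup>2"
  proof (cases "n = 0 \<or> s = 0")
    case False
    then have sn: "s \<in> {1..T}" "n \<in> {1..N}" and i: "(s, d) \<in> {1..T} \<times> {1..D}" using assms by auto
    have e: "\<bar>xi s n u d\<bar> ^ 3 = (ell s * sqrt (ell s)) * \<bar>u (s, d) n\<bar> ^ 3" for u
    proof -
      have "sqrt (ell s) ^ 3 = ell s * sqrt (ell s)" using ell[OF sn(1)] by (simp add: power3_eq_cube)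
      then show ?thesis using False ell[OF sn(1)] by (simp add: xi_def abs_mult power_mult_distrib)
    qed
    have "sqrt (ell s) \<le> Lam"
      using Lam sn(1) by (intro real_le_lsqrt) (auto simp: power2_eq_square intro: order_trans[OF Lam(2)[OF sn(1)]] mult_right_mono[of 1 Lam Lam, simplified])
    then have le: "ell s * sqrt (ell s) \<le> Lam\<^sup>2" "0 \<le> ell s * sqrt (ell s)"
      using Lam sn(1) ell[OF sn(1)] by (auto simp: power2_eq_square intro!: mult_mono)
    have "(ell s * sqrt (ell s)) * (\<integral>u. \<bar>u (s, d) n\<bar> ^ 3 \<partial>noise_law T N D) \<le> Lam\<^sup>2 * 4"
      by (intro mult_mono le(1) noise_abs_moments(2)[OF i sn(2)]) auto
    then show ?thesis unfolding e using noise_abs_moments(1)[OF i sn(2)] by simp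
  qed (simp add: xi_def)
  then show "integrable (noise_law T N D) (\<lambda>u. \<bar>xi s n u d\<bar> ^ 3)" "(\<integral>u. \<bar>xi s n u d\<bar> ^ 3 \<partial>noise_law T N D) \<le> 4 * Lam\<^sup>2"
    by auto
qed

text \<open>Three fluctuation terms contribute \<open>2 * L * Lam\<close> each; the cubic term
  contributes \<open>8 * L\<close> times two third moments of at most
  \<open>4 * Lam^2\<close>.\<close>

definition remainder_const :: real where
  "remainder_const = 6 * L * Lam + 64 * L * Lam\<^sup>2"

text \<open>The state occurs only inside second derivatives, which are bounded by \<open>L\<close>.
  Hence the bound is uniform over all states, with no restriction to good sets.\<close>

lemma remainder_bound_integral:
  assumes t: "t \<in> {1..T}" and n: "a \<le> N" "l \<le> N" and D: "1 \<le> D"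
  shows "integrable (noise_law T N D) (\<lambda>u. remainder_bound D x u t a l)"
    and "(\<integral>u. remainder_bound D x u t a l \<partial>noise_law T N D) \<le> remainder_const / sqrt D"
proof -
  have t': "t \<in> {1..T + 1}" "t \<le> T" "t - 1 \<le> T" "t - 1 \<noteq> t" using t by auto
  have b: "\<bar>partial1 (partial1 (w t)) x y\<bar> \<le> L" "\<bar>partial1 (partial2 (w t)) x y\<bar> \<le> L" "\<bar>partial2 (partial2 (w t)) x y\<bar> \<le> L" for x y
    using lip(1)[OF t'(1)] lip(2)[OF t'(1)] lip(3)[OF t'(1)] by (auto simp: lip2_def)
  note s1 = xi_square_sum[OF t'(2) n(2), of D "\<lambda>d. partial2 (partial2 (w t)) (x (t - 1) d) (x t d)", OF b(3)]
  note s2 = xi_square_sum[OF t'(3) n(1), of D "\<lambda>d. partial1 (partial1 (w t)) (x (t - 1) d) (x t d)", OF b(1)]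
  note s3 = xi_mixed_sum[OF t'(3) t'(2) t'(4) n, of D "\<lambda>d. partial1 (partial2 (w t)) (x (t - 1) d) (x t d)", OF b(2)]
  let ?c = "\<lambda>u d. 8 * L * (\<bar>xi (t - 1) a u d\<bar> ^ 3 + \<bar>xi t l u d\<bar> ^ 3)"
  have c: "integrable (noise_law T N D) (\<lambda>u. ?c u d)" "(\<integral>u. ?c u d \<partial>noise_law T N D) \<le> 64 * L * Lam\<^sup>2"
    if "d \<in> {1..D}" for d
  proof -
    note c1 = xi_cube[OF t'(3) n(1) that] and c2 = xi_cube[OF t'(2) n(2) that]
    show "integrable (noise_law T N D) (\<lambda>u. ?c u d)" using c1(1) c2(1) by simp
    have "(\<integral>u. ?c u d \<partial>noise_law T N D) = 8 * L * ((\<integral>u. \<bar>xi (t - 1) a u d\<bar> ^ 3 \<partial>noise_law T N D) + (\<integral>u. \<bar>xi t l u d\<bar> ^ 3 \<partial>noise_law T N D))"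
      using c1(1) c2(1) by simp
    also have "\<dots> \<le> 8 * L * (4 * Lam\<^sup>2 + 4 * Lam\<^sup>2)"
      using L0 by (intro mult_left_mono add_mono c1(2) c2(2)) auto
    finally show "(\<integral>u. ?c u d \<partial>noise_law T N D) \<le> 64 * L * Lam\<^sup>2" by simp
  qed
  have ci: "integrable (noise_law T N D) (\<lambda>u. \<Sum>d=1..D. ?c u d)" by (intro Bochner_Integration.integrable_sum c(1))
  have cs: "(\<integral>u. (\<Sum>d=1..D. ?c u d) \<partial>noise_law T N D) \<le> D * (64 * L * Lam\<^sup>2)"
  proof -
    have "(\<integral>u. (\<Sum>d=1..D. ?c u d) \<partial>noise_law T N D) = (\<Sum>d=1..D. (\<integral>u. ?c u d \<partial>noise_law T N D))"
      by (rule Bochner_Integration.integral_sum) (rule c(1))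
    also have "\<dots> \<le> (\<Sum>d=1..D. 64 * L * Lam\<^sup>2)" by (intro sum_mono c(2))
    finally show ?thesis by simp
  qed
  have 1: "integrable (noise_law T N D) (\<lambda>u. remainder_bound D x u t a l) \<and>
    (\<integral>u. remainder_bound D x u t a l \<partial>noise_law T N D) \<le>
      (2 * L * Lam * sqrt D) / D + (2 * L * Lam * sqrt D) / D + (2 * L * Lam * sqrt D) / D + (D * (64 * L * Lam\<^sup>2)) / (D * sqrt D)"
    unfolding remainder_bound_def
    by (intro integral_add_le integral_divide_le conjI s1 s2 s3 ci cs) auto
  then show "integrable (noise_law T N D) (\<lambda>u. remainder_bound D x u t a l)" ..
  have "(\<integral>u. remainder_bound D x u t a l \<partial>noise_law T N D) \<le>
      (2 * L * Lam * sqrt D) / D + (2 * L * Lam * sqrt D) / D + (2 * L * Lam * sqrt D) / D + (D * (64 * L * Lam\<^sup>2)) / (D * sqrt D)"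
    using 1 ..
  also have "\<dots> = remainder_const / sqrt D"
  proof -
    have "sqrt D / D = 1 / sqrt D" using D by (simp add: field_simps)
    then have "(2 * L * Lam * sqrt D) / D = 2 * L * Lam / sqrt D" by (metis times_divide_eq_right mult.right_neutral)
    then show ?thesis using D by (simp add: remainder_const_def add_divide_distrib)
  qed
  finally show "(\<integral>u. remainder_bound D x u t a l \<partial>noise_law T N D) \<le> remainder_const / sqrt D" .
qed

end

section \<open>Law of large numbers for the target\<close>

abbreviation lborel_on :: "'i set \<Rightarrow> ('i \<Rightarrow> real) measure" where
  "lborel_on I \<equiv> (\<Pi>\<^sub>M i\<in>I. lborel)"

lemma sigma_finite_lborel_on: "finite I \<Longrightarrow> sigma_finite_measure (lborel_on I)"
  using product_sigma_finite.sigma_finite[of "\<lambda>_. lborel"]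
  by (simp add: product_sigma_finite_def sigma_finite_lborel)

section \<open>Exchanging times and coordinates in products of Lebesgue measure\<close>

lemma measurable_coord_compose:
  assumes "i \<in> I" "f \<in> measurable (M i) N"
  shows "(\<lambda>x. f (x i)) \<in> measurable (PiM I M) N"
  by (rule measurable_compose[where f="\<lambda>x. x i" and g=f and N="M i"])
    (rule measurable_component_singleton[OF assms(1)], rule assms(2))

lemma measurable_coord2:
  assumes "i \<in> I" "j \<in> J"
  shows "(\<lambda>x. x i j) \<in> measurable (\<Pi>\<^sub>M i\<in>I. \<Pi>\<^sub>M j\<in>J. N) N"
  by (rule measurable_coord_compose[OF assms(1), of "\<lambda>v. v j"]) (rule measurable_component_singleton[OF assms(2)])

text \<open>Any relabelling \<open>K\<close> of the pairs turns the iterated product into a single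
  one. Applied with both orders of iteration over the same \<open>K\<close>, it gives the
  transposition.\<close>

lemma distr_flatten_lborel:
  assumes I: "finite I" and J: "finite J" and b: "bij_betw (\<lambda>p. (r p, s p)) K (I \<times> J)"
  shows "(\<lambda>x. \<lambda>p\<in>K. x (r p) (s p)) \<in> measurable (\<Pi>\<^sub>M i\<in>I. lborel_on J) (lborel_on K)"
    and "distr (\<Pi>\<^sub>M i\<in>I. lborel_on J) (lborel_on K) (\<lambda>x. \<lambda>p\<in>K. x (r p) (s p)) = lborel_on K"
proof -
  let ?f = "\<lambda>x. \<lambda>p\<in>K. x (r p) (s p)" and ?M = "\<Pi>\<^sub>M i\<in>I. lborel_on J"
  have rs: "r p \<in> I" "s p \<in> J" if "p \<in> K" for p using bij_betwE[OF b] that by auto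
  have K: "finite K" using bij_betw_finite[OF b] I J by simp
  interpret k: product_sigma_finite "\<lambda>_. lborel :: real measure" by (simp add: product_sigma_finite_def sigma_finite_lborel)
  interpret i: product_sigma_finite "\<lambda>_. lborel_on J" by (simp add: product_sigma_finite_def sigma_finite_lborel_on[OF J])
  show m: "?f \<in> measurable ?M (lborel_on K)"
    by (intro measurable_restrict measurable_coord2 rs)
  define q where "q = the_inv_into K (\<lambda>p. (r p, s p))"
  have q: "q (r p, s p) = p" if "p \<in> K" for p
    unfolding q_def by (rule the_inv_into_f_f) (use b that in \<open>auto simp: bij_betw_def\<close>)
  have bq: "bij_betw q (I \<times> J) K" unfolding q_def by (rule bij_betw_the_inv_into[OF b])
  have rq: "r (q ij) = fst ij" "s (q ij) = snd ij" "q ij \<in> K" if "ij \<in> I \<times> J" for ij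
    using f_the_inv_into_f_bij_betw[OF b, of ij] bij_betwE[OF bq] that unfolding q_def by auto
  show "distr ?M (lborel_on K) ?f = lborel_on K"
  proof (rule k.PiM_eqI[OF K])
    fix A :: "_ \<Rightarrow> real set" assume A: "\<And>p. p \<in> K \<Longrightarrow> A p \<in> sets lborel"
    \<comment> \<open>The preimage of a box is a box of boxes, whose measure is an iterated product
      over \<open>i\<close> and \<open>j\<close>; the inverse relabelling \<open>q\<close> then
      turns this into a product over \<open>K\<close>.\<close>
    have pre: "?f -` Pi\<^sub>E K A \<inter> space ?M = Pi\<^sub>E I (\<lambda>i. Pi\<^sub>E J (\<lambda>j. A (q (i, j))))"
    proof (intro set_eqI iffI)
      fix x assume x: "x \<in> ?f -` Pi\<^sub>E K A \<inter> space ?M"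
      have "x i j \<in> A (q (i, j))" if "i \<in> I" "j \<in> J" for i j
      proof -
        have "x (r (q (i, j))) (s (q (i, j))) \<in> A (q (i, j))" using x rq(3)[of "(i, j)"] that by (auto simp: PiE_iff)
        then show ?thesis using rq[of "(i, j)"] that by simp
      qed
      then show "x \<in> Pi\<^sub>E I (\<lambda>i. Pi\<^sub>E J (\<lambda>j. A (q (i, j))))" using x by (auto simp: space_PiM PiE_iff)
    next
      fix x assume x: "x \<in> Pi\<^sub>E I (\<lambda>i. Pi\<^sub>E J (\<lambda>j. A (q (i, j))))"
      have "x (r p) (s p) \<in> A p" if "p \<in> K" for p
      proof -
        have "x (r p) (s p) \<in> A (q (r p, s p))" using x rs[OF that] by (auto simp: PiE_iff)
        then show ?thesis unfolding q[OF that] .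
      qed
      then show "x \<in> ?f -` Pi\<^sub>E K A \<inter> space ?M" using x by (auto simp: space_PiM PiE_iff)
    qed
    have Aq: "A (q ij) \<in> sets lborel" if "ij \<in> I \<times> J" for ij using A rq(3)[OF that] by simp
    have "emeasure (distr ?M (lborel_on K) ?f) (Pi\<^sub>E K A) = emeasure ?M (?f -` Pi\<^sub>E K A \<inter> space ?M)"
      using A K by (intro emeasure_distr m sets_PiM_I_finite) auto
    also have "\<dots> = (\<Prod>i\<in>I. emeasure (lborel_on J) (Pi\<^sub>E J (\<lambda>j. A (q (i, j)))))"
      unfolding pre using Aq by (intro i.emeasure_PiM I sets_PiM_I_finite J) auto
    also have "\<dots> = (\<Prod>i\<in>I. \<Prod>j\<in>J. emeasure lborel (A (q (i, j))))"
      using Aq by (intro prod.cong refl k.emeasure_PiM J) auto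
    also have "\<dots> = (\<Prod>ij\<in>I \<times> J. emeasure lborel (A (q ij)))"
      by (simp add: prod.cartesian_product case_prod_unfold)
    also have "\<dots> = (\<Prod>p\<in>K. emeasure lborel (A p))"
      by (rule prod.reindex_bij_betw[OF bq])
    finally show "emeasure (distr ?M (lborel_on K) ?f) (Pi\<^sub>E K A) = (\<Prod>p\<in>K. emeasure lborel (A p))" .
  qed simp
qed

definition transpose_on :: "'i set \<Rightarrow> 'j set \<Rightarrow> ('i \<Rightarrow> 'j \<Rightarrow> real) \<Rightarrow> 'j \<Rightarrow> 'i \<Rightarrow> real" where
  "transpose_on I J x = (\<lambda>j\<in>J. \<lambda>i\<in>I. x i j)"

text \<open>States are indexed first by time, but the target is independent over the coordinates
  \<open>d\<close>. Both orders are compared through the flat product over pairs.\<close>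

lemma distr_transpose_lborel:
  assumes I: "finite I" and J: "finite J"
  shows "transpose_on I J \<in> measurable (\<Pi>\<^sub>M i\<in>I. lborel_on J) (\<Pi>\<^sub>M j\<in>J. lborel_on I)"
    and "distr (\<Pi>\<^sub>M i\<in>I. lborel_on J) (\<Pi>\<^sub>M j\<in>J. lborel_on I) (transpose_on I J) = (\<Pi>\<^sub>M j\<in>J. lborel_on I)"
proof -
  let ?M1 = "\<Pi>\<^sub>M i\<in>I. lborel_on J" and ?M2 = "\<Pi>\<^sub>M j\<in>J. lborel_on I" and ?K = "I \<times> J"
  show m: "transpose_on I J \<in> measurable ?M1 ?M2"
    unfolding transpose_on_def
    by (intro measurable_restrict measurable_coord2)
  let ?u = "\<lambda>z. \<lambda>j\<in>J. \<lambda>i\<in>I. z (i, j) :: real"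
  have u: "?u \<in> measurable (lborel_on ?K) ?M2"
    by (intro measurable_restrict measurable_component_singleton) auto
  have b1: "bij_betw (\<lambda>p. (fst p, snd p)) ?K (I \<times> J)" by (simp add: bij_betw_def)
  have b2: "bij_betw (\<lambda>p. (snd p, fst p)) ?K (J \<times> I)"
    by (rule bij_betwI[where g="\<lambda>p. (snd p, fst p)"]) auto
  note f1 = distr_flatten_lborel[OF I J b1] and f2 = distr_flatten_lborel[OF J I b2]
  have "distr ?M1 ?M2 (transpose_on I J) = distr (distr ?M1 (lborel_on ?K) (\<lambda>x. \<lambda>p\<in>?K. x (fst p) (snd p))) ?M2 ?u"
    unfolding distr_distr[OF u f1(1)] by (intro distr_cong refl) (auto simp: transpose_on_def fun_eq_iff)
  also have "\<dots> = distr (distr ?M2 (lborel_on ?K) (\<lambda>x. \<lambda>p\<in>?K. x (snd p) (fst p))) ?M2 ?u"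
    unfolding f1(2) f2(2) ..
  also have "\<dots> = distr ?M2 ?M2 (\<lambda>y. y)"
    unfolding distr_distr[OF u f2(1)]
    by (intro distr_cong refl) (auto simp: space_PiM PiE_iff extensional_def fun_eq_iff)
  finally show "distr ?M1 ?M2 (transpose_on I J) = ?M2" by (simp add: distr_id)
qed

lemma PiM_density:
  assumes J: "finite J" and N: "sigma_finite_measure N" and f: "f \<in> borel_measurable N" and p: "prob_space (density N f)"
  shows "density (\<Pi>\<^sub>M j\<in>J. N) (\<lambda>y. \<Prod>j\<in>J. f (y j)) = (\<Pi>\<^sub>M j\<in>J. density N f)"
proof -
  interpret n: product_sigma_finite "\<lambda>_. N" using N by (simp add: product_sigma_finite_def)
  interpret d: product_sigma_finite "\<lambda>_. density N f"
    using p by (simp add: product_sigma_finite_def prob_space_imp_sigma_finite)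
  have s: "sets (\<Pi>\<^sub>M j\<in>J. density N f) = sets (\<Pi>\<^sub>M j\<in>J. N)" by (intro sets_PiM_cong) auto
  have m: "(\<lambda>y. \<Prod>j\<in>J. f (y j)) \<in> borel_measurable (\<Pi>\<^sub>M j\<in>J. N)"
    by (intro borel_measurable_prod_ennreal measurable_coord_compose f)
  show ?thesis
  proof (rule d.PiM_eqI[OF J])
    show "sets (density (\<Pi>\<^sub>M j\<in>J. N) (\<lambda>y. \<Prod>j\<in>J. f (y j))) = sets (\<Pi>\<^sub>M j\<in>J. density N f)" using s by simp
    fix A assume "\<And>j. j \<in> J \<Longrightarrow> A j \<in> sets (density N f)"
    then have A: "\<And>j. j \<in> J \<Longrightarrow> A j \<in> sets N" by simp
    have "emeasure (density (\<Pi>\<^sub>M j\<in>J. N) (\<lambda>y. \<Prod>j\<in>J. f (y j))) (Pi\<^sub>E J A)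
        = (\<integral>\<^sup>+y. (\<Prod>j\<in>J. f (y j)) * indicator (Pi\<^sub>E J A) y \<partial>(\<Pi>\<^sub>M j\<in>J. N))"
      using A J by (intro emeasure_density m sets_PiM_I_finite) auto
    also have "\<dots> = (\<integral>\<^sup>+y. (\<Prod>j\<in>J. f (y j) * indicator (A j) (y j)) \<partial>(\<Pi>\<^sub>M j\<in>J. N))"
    proof (intro nn_integral_cong)
      fix y assume "y \<in> space (\<Pi>\<^sub>M j\<in>J. N)"
      then have "(indicator (Pi\<^sub>E J A) y :: ennreal) = (\<Prod>j\<in>J. indicator (A j) (y j))"
        using J by (auto simp: indicator_def space_PiM PiE_iff prod_zero_iff)
      then show "(\<Prod>j\<in>J. f (y j)) * indicator (Pi\<^sub>E J A) y = (\<Prod>j\<in>J. f (y j) * indicator (A j) (y j))"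
        by (simp add: prod.distrib)
    qed
    also have "\<dots> = (\<Prod>j\<in>J. \<integral>\<^sup>+v. f v * indicator (A j) v \<partial>N)"
      using f A by (intro n.product_nn_integral_prod J) auto
    also have "\<dots> = (\<Prod>j\<in>J. emeasure (density N f) (A j))"
      using f A by (intro prod.cong refl) (simp add: emeasure_density)
    finally show "emeasure (density (\<Pi>\<^sub>M j\<in>J. N) (\<lambda>y. \<Prod>j\<in>J. f (y j))) (Pi\<^sub>E J A) = (\<Prod>j\<in>J. emeasure (density N f) (A j))" .
  qed
qed

text \<open>The factor at \<open>t = 1\<close> ignores the state at time 0, so paths may differ
  outside \<open>{1..T}\<close>; a path cut out of a transposed array does so.\<close>

lemma path_weight_cong:
  assumes "\<And>t. t \<in> {1..T} \<Longrightarrow> x t = y t"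
  shows "path_weight T M x = path_weight T M y"
  unfolding path_weight_def
proof (intro prod.cong refl)
  fix t assume "t \<in> {1..T}"
  then show "mdens M t (x (t - 1)) (x t) * pot M t (x t) = mdens M t (y (t - 1)) (y t) * pot M t (y t)"
  proof (cases "t = 1")
    case False
    then have "t - 1 \<in> {1..T}" using \<open>t \<in> {1..T}\<close> by auto
    then show ?thesis using assms[OF \<open>t \<in> {1..T}\<close>] assms[of "t - 1"] by simp
  qed (simp add: mdens_def assms)
qed

text \<open>After transposition the product density makes the coordinates of a stationary state
  independent paths with law \<open>target T M\<close>, the setting of the weak law.\<close>

lemma distr_target_D:
  assumes pw: "path_weight T M \<in> borel_measurable (lborel_on {1..T})" and pos: "\<And>x. 0 \<le> path_weight T M x"
    and p: "prob_space (target T M)"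
  shows "distr (target_D T D M) (\<Pi>\<^sub>M d\<in>{1..D}. lborel_on {1..T}) (transpose_on {1..T} {1..D}) = (\<Pi>\<^sub>M d\<in>{1..D}. target T M)"
proof -
  let ?I = "{1..T}" and ?J = "{1..D}"
  let ?f = "\<lambda>x. ennreal (target_dens T M x)"
  have td: "0 \<le> target_dens T M x" for x unfolding target_dens_def using pos by simp
  have f: "?f \<in> borel_measurable (lborel_on ?I)" unfolding target_dens_def using pw by simp
  note tr = distr_transpose_lborel[of ?I ?J, OF finite_atLeastAtMost finite_atLeastAtMost]
  have m: "(\<lambda>y. \<Prod>d\<in>?J. ?f (y d)) \<in> borel_measurable (\<Pi>\<^sub>M d\<in>?J. lborel_on ?I)"
    by (intro borel_measurable_prod_ennreal measurable_coord_compose f)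
  have e: "ennreal (\<Prod>d=1..D. target_dens T M (\<lambda>t. x t d)) = (\<Prod>d\<in>?J. ?f (transpose_on ?I ?J x d))" for x
  proof -
    have "target_dens T M (\<lambda>t. x t d) = target_dens T M (transpose_on ?I ?J x d)" if "d \<in> ?J" for d
      unfolding target_dens_def using that
      by (subst path_weight_cong[of T "\<lambda>t. x t d" "transpose_on ?I ?J x d"]) (auto simp: transpose_on_def)
    then show ?thesis using td by (simp add: prod_ennreal)
  qed
  have "distr (target_D T D M) (\<Pi>\<^sub>M d\<in>?J. lborel_on ?I) (transpose_on ?I ?J)
    = density (distr (\<Pi>\<^sub>M t\<in>?I. lborel_on ?J) (\<Pi>\<^sub>M d\<in>?J. lborel_on ?I) (transpose_on ?I ?J)) (\<lambda>y. \<Prod>d\<in>?J. ?f (y d))"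
    unfolding target_D_def e density_distr[OF m tr(1)] ..
  also have "\<dots> = (\<Pi>\<^sub>M d\<in>?J. target T M)"
    unfolding tr(2) target_def using p
    by (intro PiM_density sigma_finite_lborel_on f) (auto simp: target_def)
  finally show ?thesis .
qed

text \<open>Chebyshev's inequality; centred copies in different coordinates are orthogonal, and the
  coefficients \<open>1 / D\<close> give variance of order \<open>1 / D\<close>.\<close>

lemma weak_law:
  fixes \<phi> :: "'a \<Rightarrow> real" and D :: nat and e :: real
  assumes P: "prob_space P" and \<phi>[measurable]: "\<phi> \<in> borel_measurable P" and sq: "integrable P (\<lambda>x. (\<phi> x)\<^sup>2)"
    and D: "1 \<le> D" and e: "0 < e"
  shows "measure (\<Pi>\<^sub>M d\<in>{1..D}. P) {y \<in> space (\<Pi>\<^sub>M d\<in>{1..D}. P). e \<le> \<bar>(\<Sum>d=1..D. \<phi> (y d)) / D - (\<integral>x. \<phi> x \<partial>P)\<bar>}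
    \<le> (\<integral>x. (\<phi> x - (\<integral>x. \<phi> x \<partial>P))\<^sup>2 \<partial>P) / (D * e\<^sup>2)"
proof -
  interpret P: prob_space P by fact
  let ?Q = "\<Pi>\<^sub>M d\<in>{1..D}. P"
  interpret Q: prob_space ?Q by (intro prob_space_PiM P)
  define m where "m = (\<integral>x. \<phi> x \<partial>P)"
  define g where "g x = \<phi> x - m" for x
  have i: "integrable P \<phi>" by (rule P.square_integrable_imp_integrable[OF \<phi> sq])
  have g: "integrable P g" "(\<integral>x. g x \<partial>P) = 0" using i P.prob_space by (simp_all add: g_def[abs_def] m_def)
  have "(g x)\<^sup>2 = (\<phi> x)\<^sup>2 - 2 * m * \<phi> x + m\<^sup>2" for x by (simp add: g_def power2_diff)
  then have g2: "integrable P (\<lambda>x. g x * g x)" using sq i by (simp flip: power2_eq_square)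
  let ?v = "\<integral>x. g x * g x \<partial>P"
  have Y: "integrable ?Q (\<lambda>y. g (y d) * g (y d')) \<and> (\<integral>y. g (y d) * g (y d') \<partial>?Q) = (if d = d' then ?v else 0)"
    if "d \<in> {1..D}" "d' \<in> {1..D}" for d d'
  proof (cases "d = d'")
    case True
    then show ?thesis
      using PiM_prod_subset[of "\<lambda>_. P" "{1..D}" "{d}" "\<lambda>_ x. g x * g x", OF P finite_atLeastAtMost] g2 that by simp
  next
    case False
    then show ?thesis
      using PiM_prod_subset[of "\<lambda>_. P" "{1..D}" "{d, d'}" "\<lambda>_. g", OF P finite_atLeastAtMost] g that by simp
  qed
  define X where "X y = (\<Sum>d=1..D. (1 / D) * g (y d))" for y
  have X: "X y = (\<Sum>d=1..D. \<phi> (y d)) / D - m" for y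
    using D by (simp add: X_def g_def sum_subtractf sum_divide_distrib[symmetric] diff_divide_distrib)
  note sm = orthogonal_sum_second_moment[of "{1..D}" ?Q "\<lambda>d y. g (y d)" ?v "\<lambda>_. 1 / D" "1 / D", folded X_def]
  have X2: "integrable ?Q (\<lambda>y. (X y)\<^sup>2)" by (rule sm) (use Y in auto)
  have "(\<integral>y. (X y)\<^sup>2 \<partial>?Q) \<le> (1 / D)\<^sup>2 * ?v * card {1..D}" by (rule sm) (use Y in auto)
  also have "\<dots> = ?v / D" using D by (simp add: power2_eq_square)
  finally have EX: "(\<integral>y. (X y)\<^sup>2 \<partial>?Q) \<le> ?v / D" .
  have Xm: "X \<in> borel_measurable ?Q"
    unfolding X_def by (intro borel_measurable_sum borel_measurable_times borel_measurable_const
      measurable_coord_compose borel_measurable_integrable[OF g(1)])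
  have "measure ?Q {y \<in> space ?Q. e \<le> \<bar>X y\<bar>} \<le> (\<integral>y. (X y)\<^sup>2 \<partial>?Q) / e\<^sup>2"
    by (rule Q.second_moment_method) (use X2 e Xm in \<open>simp_all del: One_nat_def\<close>)
  also have "\<dots> \<le> (?v / D) / e\<^sup>2" using EX by (intro divide_right_mono) auto
  finally show ?thesis unfolding X m_def[symmetric] g_def by (simp add: power2_eq_square mult_ac)
qed

text \<open>With tolerance \<open>D powr (-1/4)\<close>, Chebyshev and a union bound over the finite
  set \<open>A\<close> leave an exceptional probability of order \<open>D powr (-1/2)\<close>.
  Tolerance and exceptional probability vanish together.\<close>

lemma typical_sets:
  fixes \<phi> :: "'k \<Rightarrow> (nat \<Rightarrow> real) \<Rightarrow> real" and F :: "nat \<Rightarrow> (nat \<Rightarrow> nat \<Rightarrow> real) set"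
  assumes pw: "path_weight T M \<in> borel_measurable (lborel_on {1..T})" and pos: "\<And>x. 0 \<le> path_weight T M x"
    and p: "prob_space (target T M)"
    and A: "finite A" and \<phi>: "\<And>i. i \<in> A \<Longrightarrow> \<phi> i \<in> borel_measurable (lborel_on {1..T})"
    and sq: "\<And>i. i \<in> A \<Longrightarrow> integrable (target T M) (\<lambda>x. (\<phi> i x)\<^sup>2)"
    and F: "\<And>D. F D = {x \<in> space (\<Pi>\<^sub>M t\<in>{1..T}. \<Pi>\<^sub>M d\<in>{1..D}. borel). \<forall>i\<in>A.
       \<bar>(\<Sum>d=1..D. \<phi> i (\<lambda>t\<in>{1..T}. x t d)) / D - (\<integral>x. \<phi> i x \<partial>target T M)\<bar> < D powr (-1/4)}"
  shows "\<And>D. F D \<in> sets (\<Pi>\<^sub>M t\<in>{1..T}. \<Pi>\<^sub>M d\<in>{1..D}. borel)"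
    and "(\<lambda>D. measure (target_D T D M) (F D)) \<longlonglongrightarrow> 1"
proof -
  let ?I = "{1..T}" and ?J = "\<lambda>D. {1..D::nat}"
  interpret p: prob_space "target T M" by fact
  have st: "sets (target T M) = sets (lborel_on ?I)" by (simp add: target_def)
  have \<phi>': "\<phi> i \<in> borel_measurable (target T M)" if "i \<in> A" for i
    using \<phi>[OF that] by (simp add: measurable_cong_sets[OF st refl])
  define m where "m i = (\<integral>x. \<phi> i x \<partial>target T M)" for i
  define v where "v i = (\<integral>x. (\<phi> i x - m i)\<^sup>2 \<partial>target T M)" for i
  define e where "e D = real D powr (-1/4)" for D :: nat
  let ?Q = "\<lambda>D. \<Pi>\<^sub>M d\<in>?J D. target T M"
  let ?M1 = "\<lambda>D. \<Pi>\<^sub>M t\<in>?I. lborel_on (?J D)" and ?M2 = "\<lambda>D. \<Pi>\<^sub>M d\<in>?J D. lborel_on ?I"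
  have sQ: "sets (?Q D) = sets (?M2 D)" for D by (intro sets_PiM_cong st) auto
  have sM1: "sets (\<Pi>\<^sub>M t\<in>?I. \<Pi>\<^sub>M d\<in>?J D. borel) = sets (?M1 D)" for D by (intro sets_PiM_cong) auto
  define F' where "F' D = {y \<in> space (?Q D). \<forall>i\<in>A. \<bar>(\<Sum>d=1..D. \<phi> i (y d)) / D - m i\<bar> < e D}" for D :: nat
  have mS: "(\<lambda>y. (\<Sum>d=1..D. \<phi> i (y d)) / D) \<in> borel_measurable (?Q D)" if "i \<in> A" for i and D :: nat
    by (intro borel_measurable_divide borel_measurable_sum borel_measurable_const measurable_coord_compose \<phi>' that)
  have F'[measurable]: "F' D \<in> sets (?Q D)" for D
    unfolding F'_def
    by (intro sets.sets_Collect_finite_All A borel_measurable_less borel_measurable_abs borel_measurable_diff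
        borel_measurable_const mS)
  note tr = distr_transpose_lborel[of ?I "?J D" for D, OF finite_atLeastAtMost finite_atLeastAtMost]
  have FF': "F D = transpose_on ?I (?J D) -` F' D \<inter> space (?M1 D)" for D
  proof -
    have "transpose_on ?I (?J D) x \<in> space (?Q D)" if "x \<in> space (?M1 D)" for x
      using measurable_space[OF tr(1) that] sets_eq_imp_space_eq[OF sQ] by blast
    moreover have "(\<Sum>d=1..D. \<phi> i (transpose_on ?I (?J D) x d)) = (\<Sum>d=1..D. \<phi> i (\<lambda>t\<in>?I. x t d))" for x i
      by (intro sum.cong refl) (simp add: transpose_on_def)
    ultimately show ?thesis
      unfolding F F'_def m_def e_def sets_eq_imp_space_eq[OF sM1] by auto
  qed
  have F'2: "F' D \<in> sets (?M2 D)" for D using F' sQ by blast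
  show "F D \<in> sets (\<Pi>\<^sub>M t\<in>{1..T}. \<Pi>\<^sub>M d\<in>{1..D}. borel)" for D
    unfolding sM1 FF' by (rule measurable_sets[OF tr(1) F'2])
  have meas: "measure (target_D T D M) (F D) = measure (?Q D) (F' D)" for D
  proof -
    have "transpose_on ?I (?J D) \<in> measurable (target_D T D M) (?M2 D)"
      using tr(1)[of D] unfolding target_D_def by simp
    from measure_distr[OF this F'2] show ?thesis
      unfolding distr_target_D[OF pw pos p] FF' by (simp add: target_D_def)
  qed
  have bound: "1 - (\<Sum>i\<in>A. v i) * real D powr (-1/2) \<le> measure (?Q D) (F' D) \<and> measure (?Q D) (F' D) \<le> 1" if D: "1 \<le> D" for D
  proof -
    interpret Q: prob_space "?Q D" by (intro prob_space_PiM p)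
    have e: "0 < e D" using D by (simp add: e_def)
    have e2: "D * (e D)\<^sup>2 = real D powr (1/2)"
    proof -
      have "(e D)\<^sup>2 = real D powr (-1/2)" using D by (simp add: e_def powr_power)
      then have "D * (e D)\<^sup>2 = real D powr 1 * real D powr (-1/2)" using D by simp
      also have "\<dots> = real D powr (1/2)" by (simp only: powr_add[symmetric]) simp
      finally show ?thesis .
    qed
    let ?B = "\<lambda>i. {y \<in> space (?Q D). e D \<le> \<bar>(\<Sum>d=1..D. \<phi> i (y d)) / D - m i\<bar>}"
    have B: "?B i \<in> sets (?Q D)" if "i \<in> A" for i 
      by (intro borel_measurable_le borel_measurable_abs borel_measurable_diff borel_measurable_const mS that)
    have "1 - measure (?Q D) (F' D) = measure (?Q D) (space (?Q D) - F' D)"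
      by (rule Q.prob_compl[OF F', symmetric])
    also have "\<dots> \<le> measure (?Q D) (\<Union>i\<in>A. ?B i)"
      using A B by (intro Q.finite_measure_mono) (auto simp: F'_def not_less)
    also have "\<dots> \<le> (\<Sum>i\<in>A. measure (?Q D) (?B i))"
      using A B by (intro Q.finite_measure_subadditive_finite) auto
    also have "\<dots> \<le> (\<Sum>i\<in>A. v i / (D * (e D)\<^sup>2))"
      unfolding v_def m_def using D e by (intro sum_mono weak_law p \<phi>' sq) auto
    also have "\<dots> = (\<Sum>i\<in>A. v i) * real D powr (-1/2)"
      unfolding e2 using D by (simp add: sum_divide_distrib[symmetric] powr_minus_divide)
    finally show ?thesis using Q.prob_le_1[of "F' D"] by (simp del: One_nat_def)
  qed
  have "(\<lambda>D. 1 - (\<Sum>i\<in>A. v i) * real D powr (-1/2)) \<longlonglongrightarrow> 1 - (\<Sum>i\<in>A. v i) * 0"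
    by (intro tendsto_intros tendsto_neg_powr filterlim_real_sequentially) auto
  then have lim: "(\<lambda>D. 1 - (\<Sum>i\<in>A. v i) * real D powr (-1/2)) \<longlonglongrightarrow> 1" by simp
  have ev: "\<forall>\<^sub>F D in sequentially. 1 \<le> D" by (rule eventually_ge_at_top)
  show "(\<lambda>D. measure (target_D T D M) (F D)) \<longlonglongrightarrow> 1"
    unfolding meas
    by (rule tendsto_sandwich[OF eventually_mono[OF ev] eventually_mono[OF ev] lim tendsto_const])
      (use bound in blast)+
qed

section \<open>Comparison of the laws of the indices\<close>

text \<open>Both families of log-weights are functions of the same noise, so the pathwise Lipschitz
  estimate can be integrated. There are \<open>T * (N + 1)^2\<close> triples of time, ancestor and
  particle.\<close>

lemma scheme_expectation_diff:
  assumes T: "1 \<le> T" and P: "prob_space P" and AK: "(A, K) \<in> index_range T N"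
    and m: "\<And>t a l. \<lbrakk>t \<in> {1..T}; a \<le> N; l \<le> N\<rbrakk> \<Longrightarrow> (\<lambda>u. \<delta> u t a l) \<in> borel_measurable P"
      "\<And>t a l. \<lbrakk>t \<in> {1..T}; a \<le> N; l \<le> N\<rbrakk> \<Longrightarrow> (\<lambda>u. \<delta>' u t a l) \<in> borel_measurable P"
    and le: "\<And>u t a l. \<lbrakk>t \<in> {1..T}; a \<le> N; l \<le> N\<rbrakk> \<Longrightarrow> \<bar>\<delta> u t a l - \<delta>' u t a l\<bar> \<le> b u t a l"
    and b: "\<And>t a l. \<lbrakk>t \<in> {1..T}; a \<le> N; l \<le> N\<rbrakk> \<Longrightarrow> integrable P (\<lambda>u. b u t a l)"
      "\<And>t a l. \<lbrakk>t \<in> {1..T}; a \<le> N; l \<le> N\<rbrakk> \<Longrightarrow> (\<integral>u. b u t a l \<partial>P) \<le> \<epsilon>"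
  shows "\<bar>(\<integral>u. pmf (scheme_pmf bs fm T N (\<delta> u)) (A, K) \<partial>P) - (\<integral>u. pmf (scheme_pmf bs fm T N (\<delta>' u)) (A, K) \<partial>P)\<bar>
    \<le> scheme_const T N * (real T * (real N + 1)\<^sup>2 * \<epsilon>)"
proof -
  interpret P: prob_space P by fact
  let ?p = "\<lambda>\<delta> u. pmf (scheme_pmf bs fm T N (\<delta> u)) (A, K)"
  have i: "integrable P (?p \<delta>)" if "\<And>t a l. \<lbrakk>t \<in> {1..T}; a \<le> N; l \<le> N\<rbrakk> \<Longrightarrow> (\<lambda>u. \<delta> u t a l) \<in> borel_measurable P" for \<delta>
    by (intro P.integrable_const_bound[of _ 1] scheme_pmf_measurable T AK that AE_I2) (auto simp: pmf_le_1)
  note i1 = i[of \<delta>, OF m(1)] and i2 = i[of \<delta>', OF m(2)]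
  have ib: "integrable P (\<lambda>u. \<Sum>t=1..T. \<Sum>a\<le>N. \<Sum>l\<le>N. b u t a l)"
    by (intro Bochner_Integration.integrable_sum b(1)) auto
  have "\<bar>(\<integral>u. ?p \<delta> u \<partial>P) - (\<integral>u. ?p \<delta>' u \<partial>P)\<bar> = \<bar>\<integral>u. ?p \<delta> u - ?p \<delta>' u \<partial>P\<bar>"
    using i1 i2 by simp
  also have "\<dots> \<le> (\<integral>u. \<bar>?p \<delta> u - ?p \<delta>' u\<bar> \<partial>P)" by (rule integral_abs_bound)
  also have "\<dots> \<le> (\<integral>u. scheme_const T N * (\<Sum>t=1..T. \<Sum>a\<le>N. \<Sum>l\<le>N. b u t a l) \<partial>P)"
  proof (rule integral_mono)
    fix u
    have "\<bar>?p \<delta> u - ?p \<delta>' u\<bar> \<le> scheme_const T N * (\<Sum>t=1..T. \<Sum>a\<le>N. \<Sum>l\<le>N. \<bar>\<delta> u t a l - \<delta>' u t a l\<bar>)"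
      by (rule scheme_pmf_lipschitz[OF T AK])
    also have "\<dots> \<le> scheme_const T N * (\<Sum>t=1..T. \<Sum>a\<le>N. \<Sum>l\<le>N. b u t a l)"
      by (intro mult_left_mono scheme_const_nonneg sum_mono le) auto
    finally show "\<bar>?p \<delta> u - ?p \<delta>' u\<bar> \<le> scheme_const T N * (\<Sum>t=1..T. \<Sum>a\<le>N. \<Sum>l\<le>N. b u t a l)" .
  qed (use i1 i2 ib in auto)
  also have "\<dots> = scheme_const T N * (\<integral>u. (\<Sum>t=1..T. \<Sum>a\<le>N. \<Sum>l\<le>N. b u t a l) \<partial>P)"
    by simp
  also have "(\<integral>u. (\<Sum>t=1..T. \<Sum>a\<le>N. \<Sum>l\<le>N. b u t a l) \<partial>P) = (\<Sum>t=1..T. \<Sum>a\<le>N. \<Sum>l\<le>N. (\<integral>u. b u t a l \<partial>P))"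
  proof -
    have 1: "(\<integral>u. (\<Sum>l\<le>N. b u t a l) \<partial>P) = (\<Sum>l\<le>N. (\<integral>u. b u t a l \<partial>P))" if "t \<in> {1..T}" "a \<le> N" for t a
      by (intro Bochner_Integration.integral_sum b(1) that) auto
    have 2: "(\<integral>u. (\<Sum>a\<le>N. \<Sum>l\<le>N. b u t a l) \<partial>P) = (\<Sum>a\<le>N. \<Sum>l\<le>N. (\<integral>u. b u t a l \<partial>P))" if "t \<in> {1..T}" for t
    proof -
      have "(\<integral>u. (\<Sum>a\<le>N. \<Sum>l\<le>N. b u t a l) \<partial>P) = (\<Sum>a\<le>N. (\<integral>u. (\<Sum>l\<le>N. b u t a l) \<partial>P))"
        by (intro Bochner_Integration.integral_sum Bochner_Integration.integrable_sum b(1) that) auto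
      then show ?thesis using 1[OF that] by simp
    qed
    have "(\<integral>u. (\<Sum>t=1..T. \<Sum>a\<le>N. \<Sum>l\<le>N. b u t a l) \<partial>P) = (\<Sum>t=1..T. (\<integral>u. (\<Sum>a\<le>N. \<Sum>l\<le>N. b u t a l) \<partial>P))"
      by (intro Bochner_Integration.integral_sum Bochner_Integration.integrable_sum b(1)) auto
    also have "\<dots> = (\<Sum>t=1..T. \<Sum>a\<le>N. \<Sum>l\<le>N. (\<integral>u. b u t a l \<partial>P))" by (rule sum.cong[OF refl 2])
    finally show ?thesis .
  qed
  also have "\<dots> \<le> (\<Sum>t=1..T. \<Sum>a\<le>N. \<Sum>l\<le>N. \<epsilon>)"
    by (intro sum_mono b(2)) auto
  also have "\<dots> = real T * (real N + 1)\<^sup>2 * \<epsilon>" by (simp add: power2_eq_square mult_ac add.commute)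
  finally show ?thesis by (simp add: mult_left_mono scheme_const_nonneg)
qed

section \<open>The limiting log-weights and their representation by two-dimensional noise\<close>

definition lim_delta :: "(nat \<Rightarrow> nat + nat \<Rightarrow> real) \<Rightarrow> nat \<Rightarrow> nat \<Rightarrow> nat \<Rightarrow> real" where
  "lim_delta vw t a l = Vpart vw t l + Wpart vw (t - 1) a"

lemma lim_delta_measurable:
  assumes vw: "\<And>t i. \<lbrakk>t \<in> {1..T}; i \<in> {1..N} <+> {1..N}\<rbrakk> \<Longrightarrow> (\<lambda>u. vw u t i) \<in> borel_measurable P"
    and "t \<in> {1..T}" "a \<le> N" "l \<le> N"
  shows "(\<lambda>u. lim_delta (vw u) t a l) \<in> borel_measurable P"
proof -
  have "(\<lambda>u. Vpart (vw u) t l) \<in> borel_measurable P"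
    using assms(2,4) by (cases "l = 0") (auto simp: Vpart_def intro!: vw)
  moreover have "(\<lambda>u. Wpart (vw u) (t - 1) a) \<in> borel_measurable P"
  proof (cases "a = 0 \<or> t - 1 = 0")
    case False
    then have "t - 1 \<in> {1..T}" "Inr a \<in> {1..N} <+> {1..N}" using assms by auto
    from vw[OF this] False show ?thesis by (simp add: Wpart_def)
  qed (auto simp: Wpart_def)
  ultimately show ?thesis unfolding lim_delta_def by (rule borel_measurable_add)
qed

lemma limit_pmf_eq: "limit_indices_pmf bs fm T N vw = scheme_pmf bs fm T N (lim_delta vw)"
  unfolding limit_indices_eq_scheme lim_delta_def ..

abbreviation unflatten :: "(nat \<times> (nat + nat) \<Rightarrow> real) \<Rightarrow> nat \<Rightarrow> nat + nat \<Rightarrow> real" where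
  "unflatten y \<equiv> (\<lambda>t i. y (t, i))"

text \<open>Flattening loses the values outside the index set, which no log-weight in range reads.
  The Lipschitz estimate at distance 0 turns this into equality of the probabilities.\<close>

lemma unflatten_flatten:
  assumes "1 \<le> T" "(A, K) \<in> index_range T N"
  shows "pmf (limit_indices_pmf bs fm T N (unflatten (flatten T N vw))) (A, K) = pmf (limit_indices_pmf bs fm T N vw) (A, K)"
proof -
  have "lim_delta (unflatten (flatten T N vw)) t a l = lim_delta vw t a l" if "t \<in> {1..T}" "a \<le> N" "l \<le> N" for t a l
  proof -
    have "t - 1 \<noteq> 0 \<Longrightarrow> t - 1 \<in> {1..T}" using that by auto
    then show ?thesis using that by (auto simp: lim_delta_def Vpart_def Wpart_def)
  qed
  then have "(\<Sum>t=1..T. \<Sum>a\<le>N. \<Sum>l\<le>N. \<bar>lim_delta (unflatten (flatten T N vw)) t a l - lim_delta vw t a l\<bar>) = 0"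
    by simp
  then show ?thesis
    using scheme_pmf_lipschitz[OF assms, of bs fm "lim_delta (unflatten (flatten T N vw))" "lim_delta vw"]
    unfolding limit_pmf_eq by simp
qed

lemma limit_pmf_flat_measurable:
  assumes "1 \<le> T" "(A, K) \<in> index_range T N"
  shows "(\<lambda>y. pmf (limit_indices_pmf bs fm T N (unflatten y)) (A, K)) \<in> borel_measurable (\<Pi>\<^sub>M p\<in>flat_index T N. borel)"
  unfolding limit_pmf_eq
  by (intro scheme_pmf_measurable assms lim_delta_measurable[where T=T and N=N] measurable_component_singleton) auto

lemma limit_pmf_flat_noise:
  assumes "1 \<le> T" "(A, K) \<in> index_range T N"
  shows "(\<integral>y. pmf (limit_indices_pmf bs fm T N (unflatten y)) (A, K)
      \<partial>distr (noise_law T N D) (\<Pi>\<^sub>M p\<in>flat_index T N. borel) (flat_noise T N D \<alpha> \<beta> \<mu>))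
    = (\<integral>u. pmf (scheme_pmf bs fm T N (lim_delta (\<lambda>t i. \<mu> t i + noise_lin D \<alpha> \<beta> u t i))) (A, K) \<partial>noise_law T N D)"
  unfolding integral_distr[OF flat_noise_measurable limit_pmf_flat_measurable[OF assms]]
proof (intro Bochner_Integration.integral_cong refl)
  fix u
  show "pmf (limit_indices_pmf bs fm T N (unflatten (flat_noise T N D \<alpha> \<beta> \<mu> u))) (A, K)
      = pmf (scheme_pmf bs fm T N (lim_delta (\<lambda>t i. \<mu> t i + noise_lin D \<alpha> \<beta> u t i))) (A, K)"
    using unflatten_flatten[OF assms, of bs fm "\<lambda>t i. \<mu> t i + noise_lin D \<alpha> \<beta> u t i"]
    by (simp only: flat_noise_def limit_pmf_eq)
qed

text \<open>The linearised log-weights enter only through their Gram matrices, so that two-dimensional noise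
  suffices to represent them, with the square roots of the Gram matrices as coefficients.\<close>

definition root_alpha :: "(nat \<Rightarrow> real \<times> real \<times> real) \<Rightarrow> nat \<Rightarrow> nat \<Rightarrow> real" where
  "root_alpha p t d = (if d = 1 then sqrt11 (p t) else sqrt12 (p t))"

definition root_beta :: "(nat \<Rightarrow> real \<times> real \<times> real) \<Rightarrow> nat \<Rightarrow> nat \<Rightarrow> real" where
  "root_beta p t d = (if d = 1 then sqrt12 (p t) else sqrt22 (p t))"

lemma root_gram:
  assumes "p t \<in> psd2"
  shows "(\<Sum>d=1..2. (root_alpha p t d)\<^sup>2) = fst (p t)"
    and "(\<Sum>d=1..2. root_alpha p t d * root_beta p t d) = fst (snd (p t))"
    and "(\<Sum>d=1..2. (root_beta p t d)\<^sup>2) = snd (snd (p t))"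
proof -
  have two: "(\<Sum>d=1..2. f d) = f 1 + f 2" for f :: "nat \<Rightarrow> real" by (simp add: numeral_2_eq_2)
  obtain a c b where p: "p t = (a, c, b)" by (cases "p t") auto
  show "(\<Sum>d=1..2. (root_alpha p t d)\<^sup>2) = fst (p t)"
    "(\<Sum>d=1..2. root_alpha p t d * root_beta p t d) = fst (snd (p t))"
    "(\<Sum>d=1..2. (root_beta p t d)\<^sup>2) = snd (snd (p t))"
    using psd_sqrt[OF assms[unfolded p]] unfolding two by (simp_all add: root_alpha_def root_beta_def p)
qed

text \<open>The passage from dimension \<open>D\<close> to dimension 2 is exact: equal Gram sums
  give equal laws of the flattened vectors, and the root of a positive semidefinite matrix has the
  right Gram sums.\<close>

lemma limit_expectation_noise:
  assumes T: "1 \<le> T" "(A, K) \<in> index_range T N"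
    and gram: "\<And>t. t \<in> {1..T} \<Longrightarrow> ((\<Sum>d=1..D. (\<alpha> t d)\<^sup>2), (\<Sum>d=1..D. \<alpha> t d * \<beta> t d), (\<Sum>d=1..D. (\<beta> t d)\<^sup>2)) = p t"
    and p: "\<And>t. t \<in> {1..T} \<Longrightarrow> p t \<in> psd2"
  shows "(\<integral>u. pmf (scheme_pmf bs fm T N (lim_delta (\<lambda>t i. \<mu> t i + noise_lin D \<alpha> \<beta> u t i))) (A, K) \<partial>noise_law T N D)
    = (\<integral>u. pmf (scheme_pmf bs fm T N (lim_delta (\<lambda>t i. \<mu> t i + noise_lin 2 (root_alpha p) (root_beta p) u t i))) (A, K) \<partial>noise_law T N 2)"
proof -
  have "distr (noise_law T N D) (\<Pi>\<^sub>M p\<in>flat_index T N. borel) (flat_noise T N D \<alpha> \<beta> \<mu>)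
    = distr (noise_law T N 2) (\<Pi>\<^sub>M p\<in>flat_index T N. borel) (flat_noise T N 2 (root_alpha p) (root_beta p) \<mu>)"
    by (rule distr_flat_noise_eqI) (use gram root_gram[OF p] in \<open>auto simp: prod_eq_iff\<close>)
  then show ?thesis unfolding limit_pmf_flat_noise[OF T, symmetric] by simp
qed

text \<open>This places the limit on the same probability space, \<open>noise_law T N 2\<close>, as
  the reduced algorithm, so that one draw \<open>u\<close> can drive both.\<close>

lemma limit_expectation_VW:
  fixes p :: "nat \<Rightarrow> real \<times> real \<times> real" and \<mu> :: "nat \<Rightarrow> nat + nat \<Rightarrow> real"
  assumes T: "1 \<le> T" and p: "\<And>t. p t \<in> psd2"
    and G: "\<And>t. t \<in> {1..T} \<Longrightarrow> G t = gaussian_law ({1..N} <+> {1..N}) (\<mu> t) (block_cov (fst (p t)) (fst (snd (p t))) (snd (snd (p t))))"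
  shows "prob_space (\<Pi>\<^sub>M t\<in>{1..T}. G t)"
    and "(A, K) \<in> index_range T N \<Longrightarrow> (\<lambda>vw. pmf (limit_indices_pmf bs fm T N vw) (A, K)) \<in> borel_measurable (\<Pi>\<^sub>M t\<in>{1..T}. G t)"
    and "(A, K) \<in> index_range T N \<Longrightarrow> (\<integral>vw. pmf (limit_indices_pmf bs fm T N vw) (A, K) \<partial>(\<Pi>\<^sub>M t\<in>{1..T}. G t))
      = (\<integral>u. pmf (scheme_pmf bs fm T N (lim_delta (\<lambda>t i. \<mu> t i + noise_lin 2 (root_alpha p) (root_beta p) u t i))) (A, K) \<partial>noise_law T N 2)"
proof -
  let ?G = "\<lambda>t. gaussian_law ({1..N} <+> {1..N}) (\<mu> t) (block_cov (fst (p t)) (fst (snd (p t))) (snd (snd (p t))))"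
  have GP: "(\<Pi>\<^sub>M t\<in>{1..T}. G t) = (\<Pi>\<^sub>M t\<in>{1..T}. ?G t)" by (intro PiM_cong refl G)
  note root = root_gram[OF p, symmetric]
  note fl = distr_flatten_gaussian[where \<mu>=\<mu> and N=N and T=T and D=2, OF root]
  have fl3: "distr (\<Pi>\<^sub>M t\<in>{1..T}. ?G t) (\<Pi>\<^sub>M p\<in>flat_index T N. borel) (flatten T N)
      = distr (noise_law T N 2) (\<Pi>\<^sub>M p\<in>flat_index T N. borel) (flat_noise T N 2 (root_alpha p) (root_beta p) \<mu>)"
    by (rule distr_flatten_gaussian(3)[OF root])
  show "prob_space (\<Pi>\<^sub>M t\<in>{1..T}. G t)" unfolding GP by (rule fl(1))
  assume AK: "(A, K) \<in> index_range T N"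
  have e: "(\<lambda>vw. pmf (limit_indices_pmf bs fm T N vw) (A, K)) = (\<lambda>vw. pmf (limit_indices_pmf bs fm T N (unflatten (flatten T N vw))) (A, K))"
    unfolding unflatten_flatten[OF T AK] ..
  show "(\<lambda>vw. pmf (limit_indices_pmf bs fm T N vw) (A, K)) \<in> borel_measurable (\<Pi>\<^sub>M t\<in>{1..T}. G t)"
    unfolding e GP by (rule measurable_compose[OF fl(2) limit_pmf_flat_measurable[OF T AK]])
  have "(\<integral>vw. pmf (limit_indices_pmf bs fm T N vw) (A, K) \<partial>(\<Pi>\<^sub>M t\<in>{1..T}. G t))
     = (\<integral>y. pmf (limit_indices_pmf bs fm T N (unflatten y)) (A, K)
         \<partial>distr (\<Pi>\<^sub>M t\<in>{1..T}. ?G t) (\<Pi>\<^sub>M p\<in>flat_index T N. borel) (flatten T N))"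
    unfolding e GP by (rule integral_distr[OF fl(2) limit_pmf_flat_measurable[OF T AK], symmetric])
  also have "\<dots> = (\<integral>u. pmf (scheme_pmf bs fm T N (lim_delta (\<lambda>t i. \<mu> t i + noise_lin 2 (root_alpha p) (root_beta p) u t i))) (A, K) \<partial>noise_law T N 2)"
    unfolding fl3 by (rule limit_pmf_flat_noise[OF T AK])
  finally show "(\<integral>vw. pmf (limit_indices_pmf bs fm T N vw) (A, K) \<partial>(\<Pi>\<^sub>M t\<in>{1..T}. G t))
      = (\<integral>u. pmf (scheme_pmf bs fm T N (lim_delta (\<lambda>t i. \<mu> t i + noise_lin 2 (root_alpha p) (root_beta p) u t i))) (A, K) \<partial>noise_law T N 2)"
    .
qed

text \<open>The coupling: the same \<open>u\<close> with slightly different drifts and root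
  coefficients. Small differences of the roots suffice, even if the covariances are
  singular.\<close>

lemma root_expectation_diff:
  assumes T: "1 \<le> T" and AK: "(A, K) \<in> index_range T N" and \<eta>: "0 \<le> \<eta>"
    and \<mu>: "\<And>t i. t \<in> {1..T} \<Longrightarrow> \<bar>\<mu> t i - \<mu>' t i\<bar> \<le> \<eta>"
    and s: "\<And>t. t \<in> {1..T} \<Longrightarrow> \<bar>sqrt11 (p t) - sqrt11 (p' t)\<bar> \<le> \<eta>"
      "\<And>t. t \<in> {1..T} \<Longrightarrow> \<bar>sqrt12 (p t) - sqrt12 (p' t)\<bar> \<le> \<eta>"
      "\<And>t. t \<in> {1..T} \<Longrightarrow> \<bar>sqrt22 (p t) - sqrt22 (p' t)\<bar> \<le> \<eta>"
  shows "\<bar>(\<integral>u. pmf (scheme_pmf bs fm T N (lim_delta (\<lambda>t i. \<mu> t i + noise_lin 2 (root_alpha p) (root_beta p) u t i))) (A, K) \<partial>noise_law T N 2)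
     - (\<integral>u. pmf (scheme_pmf bs fm T N (lim_delta (\<lambda>t i. \<mu>' t i + noise_lin 2 (root_alpha p') (root_beta p') u t i))) (A, K) \<partial>noise_law T N 2)\<bar>
    \<le> scheme_const T N * (real T * (real N + 1)\<^sup>2 * (10 * \<eta>))"
proof -
  let ?vw = "\<lambda>\<mu> p u t i. \<mu> t i + noise_lin 2 (root_alpha p) (root_beta p) u t i"
  have two: "(\<Sum>d=1..2. f d) = f 1 + f 2" for f :: "nat \<Rightarrow> real" by (simp add: numeral_2_eq_2)
  \<comment> \<open>Bounds the change of one component of \<open>V\<close> or \<open>W\<close>. Its
    mean is at most \<open>\<eta> * (1 + 2 + 2)\<close>, and a log-weight contains one component of
    each kind, whence the factor 10.\<close>
  define c :: "nat \<Rightarrow> nat \<Rightarrow> (nat \<times> nat \<Rightarrow> nat \<Rightarrow> real) \<Rightarrow> real" where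
    "c t n u = (if t \<in> {1..T} \<and> n \<in> {1..N} then \<eta> * (1 + \<bar>u (t, 1) n\<bar> + \<bar>u (t, 2) n\<bar>) else 0)" for t n u
  have c0: "0 \<le> c t n u" for t n u using \<eta> by (simp add: c_def)
  have c: "integrable (noise_law T N 2) (c t n) \<and> (\<integral>u. c t n u \<partial>noise_law T N 2) \<le> 5 * \<eta>" for t n
  proof (cases "t \<in> {1..T} \<and> n \<in> {1..N}")
    case True
    interpret prob_space "noise_law T N 2" by (rule prob_space_noise_law)
    note m1 = noise_abs_moments[of "(t, 1)" T 2 n N] and m2 = noise_abs_moments[of "(t, 2)" T 2 n N]
    have i: "integrable (noise_law T N 2) (\<lambda>u. 1 + \<bar>u (t, 1) n\<bar> + \<bar>u (t, 2) n\<bar>)"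
      using m1(3) m2(3) True by simp
    have "(\<integral>u. 1 + \<bar>u (t, 1) n\<bar> + \<bar>u (t, 2) n\<bar> \<partial>noise_law T N 2) \<le> 5"
      using m1(3,4) m2(3,4) True prob_space by simp
    from mult_left_mono[OF this \<eta>] i True show ?thesis by (simp add: c_def[abs_def] mult.commute)
  next
    case False
    then have "c t n = (\<lambda>_. 0)" by (auto simp: c_def fun_eq_iff)
    then show ?thesis using \<eta> by simp
  qed
  have vw: "\<bar>?vw \<mu> p u t i - ?vw \<mu>' p' u t i\<bar> \<le> c t n u"
    if t: "t \<in> {1..T}" and n: "n \<in> {1..N}" and i: "i = Inl n \<or> i = Inr n" for u t i n
  proof -
    have lin: "\<bar>a * x + b * y - (a' * x + b' * y)\<bar> \<le> \<eta> * (\<bar>x\<bar> + \<bar>y\<bar>)"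
      if "\<bar>a - a'\<bar> \<le> \<eta>" "\<bar>b - b'\<bar> \<le> \<eta>" for a a' b b' x y :: real
    proof -
      have "a * x + b * y - (a' * x + b' * y) = (a - a') * x + (b - b') * y" by (simp add: algebra_simps)
      then have "\<bar>a * x + b * y - (a' * x + b' * y)\<bar> \<le> \<bar>a - a'\<bar> * \<bar>x\<bar> + \<bar>b - b'\<bar> * \<bar>y\<bar>"
        by (metis abs_mult abs_triangle_ineq)
      also have "\<dots> \<le> \<eta> * \<bar>x\<bar> + \<eta> * \<bar>y\<bar>" using that by (intro add_mono mult_right_mono) auto
      finally show ?thesis by (simp add: distrib_left)
    qed
    have "\<bar>noise_lin 2 (root_alpha p) (root_beta p) u t i - noise_lin 2 (root_alpha p') (root_beta p') u t i\<bar>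
       \<le> \<eta> * (\<bar>u (t, 1) n\<bar> + \<bar>u (t, 2) n\<bar>)"
      using i
    proof
      assume "i = Inl n"
      then show ?thesis unfolding noise_lin_def two using lin[OF s(1)[OF t] s(2)[OF t]]
        by (simp add: root_alpha_def two)
    next
      assume "i = Inr n"
      then show ?thesis unfolding noise_lin_def two using lin[OF s(2)[OF t] s(3)[OF t]]
        by (simp add: root_beta_def two)
    qed
    then have "\<bar>?vw \<mu> p u t i - ?vw \<mu>' p' u t i\<bar> \<le> \<eta> + \<eta> * (\<bar>u (t, 1) n\<bar> + \<bar>u (t, 2) n\<bar>)"
      using \<mu>[OF t, of i] by linarith
    then show ?thesis using t n by (simp add: c_def algebra_simps)
  qed
  have m: "(\<lambda>u. lim_delta (?vw \<mu> p u) t a l) \<in> borel_measurable (noise_law T N 2)"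
    if "t \<in> {1..T}" "a \<le> N" "l \<le> N" for \<mu> p t a l
    by (rule lim_delta_measurable[where T=T and N=N])
      (use that in \<open>auto intro!: borel_measurable_add borel_measurable_const noise_lin_measurable\<close>)
  show ?thesis
  proof (rule scheme_expectation_diff[where b="\<lambda>u t a l. c t l u + c (t - 1) a u"])
    fix u t a l assume t: "t \<in> {1..T}" "a \<le> N" "l \<le> N"
    have "\<bar>Vpart (?vw \<mu> p u) t l - Vpart (?vw \<mu>' p' u) t l\<bar> \<le> c t l u"
      using vw[OF t(1), of l "Inl l" u] t c0[of t l u] by (cases "l = 0") (auto simp: Vpart_def)
    moreover have "\<bar>Wpart (?vw \<mu> p u) (t - 1) a - Wpart (?vw \<mu>' p' u) (t - 1) a\<bar> \<le> c (t - 1) a u"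
    proof (cases "a = 0 \<or> t - 1 = 0")
      case False
      then have "t - 1 \<in> {1..T}" "a \<in> {1..N}" using t by auto
      from vw[OF this, of "Inr a" u] False show ?thesis by (simp add: Wpart_def)
    qed (use c0 in \<open>auto simp: Wpart_def\<close>)
    ultimately show "\<bar>lim_delta (?vw \<mu> p u) t a l - lim_delta (?vw \<mu>' p' u) t a l\<bar> \<le> c t l u + c (t - 1) a u"
      unfolding lim_delta_def by linarith
  next
    fix t a l
    show "integrable (noise_law T N 2) (\<lambda>u. c t l u + c (t - 1) a u)" using c by simp
    show "(\<integral>u. c t l u + c (t - 1) a u \<partial>noise_law T N 2) \<le> 10 * \<eta>"
      using c[of t l] c[of "t - 1" a] by simp
  qed (use T AK prob_space_noise_law m in auto)
qed

lemma continuous_on_eventually_close: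
  fixes s :: "'a::metric_space \<Rightarrow> real"
  assumes "continuous_on S s" "p \<in> S" "r \<longlonglongrightarrow> 0" "0 < \<eta>"
  shows "\<forall>\<^sub>F D in sequentially. \<forall>q\<in>S. dist q p \<le> r D \<longrightarrow> \<bar>s q - s p\<bar> \<le> \<eta>"
proof -
  obtain d where d: "0 < d" "\<And>q. q \<in> S \<Longrightarrow> dist q p < d \<Longrightarrow> dist (s q) (s p) < \<eta>"
    using assms(1,2,4) unfolding continuous_on_iff by blast
  have "\<forall>\<^sub>F D in sequentially. r D < d" using assms(3) d(1) by (rule order_tendstoD)
  then show ?thesis
    by eventually_elim (use d(2) in \<open>force simp: dist_real_def\<close>)
qed

lemma Cauchy_Schwarz_integral:
  fixes f g :: "'a \<Rightarrow> real"
  assumes f: "integrable M (\<lambda>x. (f x)\<^sup>2)" and g: "integrable M (\<lambda>x. (g x)\<^sup>2)" and fg: "integrable M (\<lambda>x. f x * g x)"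
  shows "(\<integral>x. f x * g x \<partial>M)\<^sup>2 \<le> (\<integral>x. (f x)\<^sup>2 \<partial>M) * (\<integral>x. (g x)\<^sup>2 \<partial>M)"
proof -
  define A B C where "A = (\<integral>x. (f x)\<^sup>2 \<partial>M)" and "B = (\<integral>x. (g x)\<^sup>2 \<partial>M)" and "C = (\<integral>x. f x * g x \<partial>M)"
  have q: "0 \<le> A + 2 * s * C + s\<^sup>2 * B" for s
  proof -
    have "0 \<le> (\<integral>x. (f x + s * g x)\<^sup>2 \<partial>M)" by simp
    also have "(\<integral>x. (f x + s * g x)\<^sup>2 \<partial>M) = (\<integral>x. (f x)\<^sup>2 + 2 * s * (f x * g x) + s\<^sup>2 * (g x)\<^sup>2 \<partial>M)"
      by (intro Bochner_Integration.integral_cong refl) (simp add: power2_eq_square algebra_simps)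
    also have "\<dots> = A + 2 * s * C + s\<^sup>2 * B"
      using f g fg by (simp add: A_def B_def C_def)
    finally show ?thesis .
  qed
  have "C\<^sup>2 \<le> A * B"
  proof (cases "B = 0")
    case True
    have "C = 0"
    proof (rule ccontr)
      assume "C \<noteq> 0"
      \<comment> \<open>For \<open>B = 0\<close> the quadratic is affine in \<open>s\<close>, and
        the chosen point gives it the value -1.\<close>
      then show False using q[of "- (A + 1) / (2 * C)"] True by (simp add: field_simps)
    qed
    then show ?thesis using True by simp
  next
    case False
    have "0 \<le> B" unfolding B_def by simp
    then have "0 < B" using False by simp
    have "A + 2 * (- C / B) * C + (- C / B)\<^sup>2 * B = A - C\<^sup>2 / B"
      using False by (simp add: power2_eq_square field_simps)
    then have "C\<^sup>2 / B \<le> A" using q[of "- C / B"] by simp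
    then show ?thesis using \<open>0 < B\<close> by (simp add: field_simps)
  qed
  then show ?thesis unfolding A_def B_def C_def .
qed

section \<open>Typical states\<close>

lemma lip2_continuous:
  assumes "lip2 L f"
  shows "continuous_on UNIV (\<lambda>(x, y). f x y)"
proof (rule lipschitz_on_continuous_on)
  have L: "0 \<le> L" using assms abs_ge_zero order_trans unfolding lip2_def by blast
  show "(2 * L)-lipschitz_on UNIV (\<lambda>(x, y). f x y)"
  proof (rule lipschitz_onI)
    fix p q :: "real \<times> real"
    obtain x y x' y' where pq: "p = (x, y)" "q = (x', y')" by (cases p, cases q) auto
    have "\<bar>f x y - f x' y'\<bar> \<le> L * (\<bar>x - x'\<bar> + \<bar>y - y'\<bar>)" using assms by (simp add: lip2_def)
    also have "\<dots> \<le> L * (2 * dist p q)"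
      using dist_fst_le[of p q] dist_snd_le[of p q] L by (intro mult_left_mono) (auto simp: pq dist_real_def)
    finally show "dist (case p of (x, y) \<Rightarrow> f x y) (case q of (x, y) \<Rightarrow> f x y) \<le> 2 * L * dist p q"
      by (simp add: pq dist_real_def)
  qed (use L in simp)
qed

locale csmc_weights = smooth_weights +
  assumes w_last: "\<And>x y. w (T + 1) x y = 0"
begin

lemma w1_eq: "w 1 = (\<lambda>x y. w 1 0 y)"
  using w1 by (auto simp: fun_eq_iff)

text \<open>States at the times \<open>0\<close> and \<open>T + 1\<close> are junk. An expression in \<open>x (t - 1)\<close> and \<open>x t\<close> is a measurable function of the path
  only because it ignores the former at \<open>t = 1\<close> and vanishes at \<open>t = T + 1\<close>.\<close>

definition edge_fun :: "(nat \<Rightarrow> real \<Rightarrow> real \<Rightarrow> real) \<Rightarrow> bool" where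
  "edge_fun f \<longleftrightarrow> (\<forall>x x' y. f 1 x y = f 1 x' y) \<and> (\<forall>x y. f (T + 1) x y = 0) \<and>
     (\<forall>t\<in>{1..T + 1}. continuous_on UNIV (\<lambda>(x, y). f t x y))"

lemma edge_fun_cong:
  assumes f: "edge_fun f" and t: "t \<in> {1..T + 1}" and e: "\<And>s. s \<in> {1..T} \<Longrightarrow> x s = y s"
  shows "f t (x (t - 1)) (x t) = f t (y (t - 1)) (y t)"
proof -
  consider "t = T + 1" | "t = 1" "t \<in> {1..T}" | "t \<in> {1..T}" "t - 1 \<in> {1..T}" using t by force
  then show ?thesis
  proof cases
    case 2
    have "f 1 (x (t - 1)) (x t) = f 1 (y (t - 1)) (x t)" using f unfolding edge_fun_def by blast
    then show ?thesis using e[OF 2(2)] 2(1) by simp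
  qed (use f e in \<open>auto simp: edge_fun_def\<close>)
qed

lemma edge_fun_measurable:
  assumes f: "edge_fun f" and t: "t \<in> {1..T + 1}"
  shows "(\<lambda>x. f t (x (t - 1)) (x t)) \<in> borel_measurable (lborel_on {1..T})"
proof -
  have m: "(\<lambda>(x, y). f t x y) \<in> borel_measurable borel"
    using f t by (intro borel_measurable_continuous_onI) (simp add: edge_fun_def)
  have c: "(\<lambda>x. x s) \<in> borel_measurable (lborel_on {1..T})" if "s \<in> {1..T}" for s
    using measurable_component_singleton[OF that, of "\<lambda>_. lborel :: real measure"] by simp
  consider "t = T + 1" | "t = 1" "t \<in> {1..T}" | "t \<in> {1..T}" "t - 1 \<in> {1..T}" using t by force
  then show ?thesis
  proof cases
    case 1
    then show ?thesis using f by (simp add: edge_fun_def)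
  next
    case 2
    have "(\<lambda>x. (0 :: real, x t)) \<in> borel_measurable (lborel_on {1..T})"
      by (intro borel_measurable_Pair borel_measurable_const c 2)
    from measurable_compose[OF this m] have "(\<lambda>x. f t 0 (x t)) \<in> borel_measurable (lborel_on {1..T})" by simp
    moreover have "f t (x (t - 1)) (x t) = f t 0 (x t)" for x
      using f unfolding edge_fun_def 2(1) by blast
    ultimately show ?thesis by simp
  next
    case 3
    have "(\<lambda>x. (x (t - 1), x t)) \<in> borel_measurable (lborel_on {1..T})"
      by (intro borel_measurable_Pair c 3)
    from measurable_compose[OF this m] show ?thesis by simp
  qed
qed

lemma edge_fun_derivs:
  "edge_fun w" "edge_fun (\<lambda>t. partial1 (w t))" "edge_fun (\<lambda>t. partial2 (w t))"
  "edge_fun (\<lambda>t. partial1 (partial1 (w t)))" "edge_fun (\<lambda>t. partial2 (partial2 (w t)))"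
proof -
  have wT: "w (T + 1) = (\<lambda>_ _. 0)" using w_last by (simp add: fun_eq_iff)
  have p1: "partial1 (w 1) = (\<lambda>_ _. 0)" by (subst w1_eq) simp
  have p2: "partial2 (w 1) x y = partial2 (w 1) x' y" for x x' y
    unfolding partial2_def by (rule arg_cong[of _ _ "\<lambda>g. deriv g y"]) (rule ext, rule w1)
  have p22: "partial2 (partial2 (w 1)) x y = partial2 (partial2 (w 1)) x' y" for x x' y
    unfolding partial2_def[of "partial2 (w 1)"] by (rule arg_cong[of _ _ "\<lambda>g. deriv g y"]) (rule ext, rule p2)
  note d = twice_cont_diff_partials[OF tcd]
  show "edge_fun w"
    unfolding edge_fun_def by (intro conjI allI ballI w1 w_last d(6))
  show "edge_fun (\<lambda>t. partial1 (w t))"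
    unfolding edge_fun_def p1 wT by (intro conjI allI ballI d(7)) simp_all
  show "edge_fun (\<lambda>t. partial2 (w t))"
    unfolding edge_fun_def wT by (intro conjI allI ballI d(8) p2) simp_all
  show "edge_fun (\<lambda>t. partial1 (partial1 (w t)))"
    unfolding edge_fun_def p1 wT by (intro conjI allI ballI lip2_continuous[OF lip(1)]) simp_all
  show "edge_fun (\<lambda>t. partial2 (partial2 (w t)))"
    unfolding edge_fun_def wT by (intro conjI allI ballI lip2_continuous[OF lip(3)] p22) simp_all
qed

text \<open>The five quantities whose target means fix the limit at time \<open>t\<close>: 0 and 1
  give the drifts of \<open>V\<close> and \<open>W\<close>, and 2, 3, 4 the entries
  \<open>a\<close>, \<open>c\<close>, \<open>b\<close> of the covariance matrix, each up to the step
  size.\<close>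

definition stat :: "nat \<times> nat \<Rightarrow> (nat \<Rightarrow> real) \<Rightarrow> real" where
  "stat = (\<lambda>(t, k) x.
     let p = partial2 (w t) (x (t - 1)) (x t); q = partial1 (w (t + 1)) (x t) (x (t + 1)) in
     if k = 0 then partial2 (partial2 (w t)) (x (t - 1)) (x t)
     else if k = 1 then partial1 (partial1 (w (t + 1))) (x t) (x (t + 1))
     else if k = 2 then p\<^sup>2 else if k = 3 then p * q else q\<^sup>2)"

abbreviation stat_index :: "(nat \<times> nat) set" where "stat_index \<equiv> {1..T} \<times> {0..4}"

lemma stat_cong:
  assumes t: "t \<in> {1..T}" and e: "\<And>s. s \<in> {1..T} \<Longrightarrow> x s = y s"
  shows "stat (t, k) x = stat (t, k) y"
proof -
  have t1: "t \<in> {1..T + 1}" "t + 1 \<in> {1..T + 1}" using t by auto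
  note c = edge_fun_cong[OF _ t1(1), of _ x y, OF _ e] edge_fun_cong[OF _ t1(2), of _ x y, OF _ e, simplified]
  show ?thesis
    unfolding stat_def Let_def prod.case
    using c(1)[OF edge_fun_derivs(3)] c(1)[OF edge_fun_derivs(5)] c(2)[OF edge_fun_derivs(2)] c(2)[OF edge_fun_derivs(4)]
    by simp
qed

lemma stat_measurable:
  assumes "i \<in> stat_index"
  shows "stat i \<in> borel_measurable (lborel_on {1..T})"
proof -
  obtain t k where i: "i = (t, k)" and t: "t \<in> {1..T + 1}" "t + 1 \<in> {1..T + 1}" using assms by auto
  have ms:
    "(\<lambda>x. partial2 (w t) (x (t - 1)) (x t)) \<in> borel_measurable (lborel_on {1..T})"
    "(\<lambda>x. partial2 (partial2 (w t)) (x (t - 1)) (x t)) \<in> borel_measurable (lborel_on {1..T})"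
    "(\<lambda>x. partial1 (w (t + 1)) (x t) (x (t + 1))) \<in> borel_measurable (lborel_on {1..T})"
    "(\<lambda>x. partial1 (partial1 (w (t + 1))) (x t) (x (t + 1))) \<in> borel_measurable (lborel_on {1..T})"
    using edge_fun_measurable[OF edge_fun_derivs(3) t(1)] edge_fun_measurable[OF edge_fun_derivs(5) t(1)]
      edge_fun_measurable[OF edge_fun_derivs(2) t(2)] edge_fun_measurable[OF edge_fun_derivs(4) t(2)] by simp_all
  show ?thesis unfolding i stat_def Let_def prod.case 
    by (cases "k = 0"; cases "k = 1"; cases "k = 2"; cases "k = 3")
      (auto simp del: One_nat_def intro!: borel_measurable_power borel_measurable_times ms)
qed

text \<open>Fourth moments enter here: squares and products of first derivatives have second moments
  bounded by \<open>p^4 + q^4\<close>, via \<open>2 * p^2 * q^2 \<le> p^4 + q^4\<close>. Second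
  derivatives are bounded.\<close>

lemma stat_square_integrable:
  assumes i: "i \<in> stat_index" and \<pi>: "prob_space \<pi>" and s[measurable_cong]: "sets \<pi> = sets (lborel_on {1..T})"
    and i4: "\<And>t. t \<in> {1..T} \<Longrightarrow> integrable \<pi> (\<lambda>x. \<bar>partial2 (w t) (x (t - 1)) (x t)\<bar> ^ 4)"
      "\<And>t. t \<in> {1..T} \<Longrightarrow> integrable \<pi> (\<lambda>x. \<bar>partial1 (w (t + 1)) (x t) (x (t + 1))\<bar> ^ 4)"
  shows "integrable \<pi> (\<lambda>x. (stat i x)\<^sup>2)"
proof -
  interpret prob_space \<pi> by fact
  obtain t k where ik: "i = (t, k)" "t \<in> {1..T}" using i by auto
  have t: "t \<in> {1..T + 1}" "t + 1 \<in> {1..T + 1}" using ik by auto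
  let ?p = "\<lambda>x. partial2 (w t) (x (t - 1)) (x t)" and ?q = "\<lambda>x. partial1 (w (t + 1)) (x t) (x (t + 1))"
  have [measurable]: "stat i \<in> borel_measurable \<pi>"
    using stat_measurable[OF i] by (simp add: measurable_cong_sets[OF s refl])
  have int: "integrable \<pi> (\<lambda>x. L\<^sup>2 + (\<bar>?p x\<bar> ^ 4 + \<bar>?q x\<bar> ^ 4))"
    using i4[OF ik(2)] by simp
  have sq: "z\<^sup>2 \<le> L\<^sup>2" if "\<bar>z\<bar> \<le> L" for z using that by (metis abs_ge_zero power2_abs power_mono)
  have pq: "(a * b)\<^sup>2 \<le> \<bar>a\<bar> ^ 4 + \<bar>b\<bar> ^ 4" for a b :: real
  proof -
    have "0 \<le> (a\<^sup>2 - b\<^sup>2)\<^sup>2" by simp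
    then have "2 * (a\<^sup>2 * b\<^sup>2) \<le> (a\<^sup>2)\<^sup>2 + (b\<^sup>2)\<^sup>2" by (simp add: power2_diff)
    moreover have "0 \<le> a\<^sup>2 * b\<^sup>2" by simp
    moreover have "\<bar>a\<bar> ^ 4 = (a\<^sup>2)\<^sup>2" "\<bar>b\<bar> ^ 4 = (b\<^sup>2)\<^sup>2" by simp_all
    ultimately show ?thesis unfolding power_mult_distrib by linarith
  qed
  have b4: "(z\<^sup>2)\<^sup>2 = \<bar>z\<bar> ^ 4" for z :: real by simp
  have p4: "0 \<le> \<bar>z\<bar> ^ 4" for z :: real by simp
  have "(stat i x)\<^sup>2 \<le> L\<^sup>2 + (\<bar>?p x\<bar> ^ 4 + \<bar>?q x\<bar> ^ 4)" for x
  proof -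
    have "(partial2 (partial2 (w t)) (x (t - 1)) (x t))\<^sup>2 \<le> L\<^sup>2" "(partial1 (partial1 (w (t + 1))) (x t) (x (t + 1)))\<^sup>2 \<le> L\<^sup>2"
      using lip(3)[OF t(1)] lip(1)[OF t(2)] by (auto simp: lip2_def intro!: sq)
    moreover have "0 \<le> L\<^sup>2" by simp
    moreover note pq[of "?p x" "?q x"] p4[of "?p x"] p4[of "?q x"]
    moreover have "stat i x = partial2 (partial2 (w t)) (x (t - 1)) (x t) \<or> stat i x = partial1 (partial1 (w (t + 1))) (x t) (x (t + 1))
        \<or> stat i x = (?p x)\<^sup>2 \<or> stat i x = ?p x * ?q x \<or> stat i x = (?q x)\<^sup>2"
      unfolding ik(1) stat_def Let_def prod.case by argo
    ultimately show ?thesis using b4[of "?p x"] b4[of "?q x"] by (elim disjE; simp only:; linarith)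
  qed
  then show ?thesis
    by (intro Bochner_Integration.integrable_bound[OF int]) (auto intro!: AE_I2 order_trans[OF _ abs_ge_self])
qed

definition gram :: "nat \<Rightarrow> (nat \<Rightarrow> nat \<Rightarrow> real) \<Rightarrow> nat \<Rightarrow> real \<times> real \<times> real" where
  "gram D x t = ((\<Sum>d=1..D. (alpha D x t d)\<^sup>2), (\<Sum>d=1..D. alpha D x t d * beta D x t d), (\<Sum>d=1..D. (beta D x t d)\<^sup>2))"

lemma gram_psd: "gram D x t \<in> psd2"
  unfolding gram_def psd2_def using Cauchy_Schwarz_ineq_sum[of "alpha D x t" "beta D x t" "{1..D}"]
  by (auto intro: sum_nonneg)

text \<open>The restriction turns a column of the state into a point of the path space, as
  \<open>typical_sets\<close> requires; \<open>mean_stat_eq\<close> removes it again.\<close>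

definition mean_stat :: "nat \<Rightarrow> (nat \<Rightarrow> nat \<Rightarrow> real) \<Rightarrow> nat \<times> nat \<Rightarrow> real" where
  "mean_stat D x i = (\<Sum>d=1..D. stat i (\<lambda>t\<in>{1..T}. x t d)) / D"

lemma mean_stat_eq:
  assumes "t \<in> {1..T}"
  shows "mean_stat D x (t, k) = (\<Sum>d=1..D. stat (t, k) (\<lambda>s. x s d)) / D"
proof -
  have "stat (t, k) (\<lambda>t\<in>{1..T}. x t d) = stat (t, k) (\<lambda>s. x s d)" for d
    by (rule stat_cong[OF assms]) simp
  then show ?thesis unfolding mean_stat_def by simp
qed

lemma mu_gram_mean_stat:
  assumes t: "t \<in> {1..T}"
  shows "mu D x t (Inl n) = 1/2 * ell t * mean_stat D x (t, 0)"
    and "mu D x t (Inr n) = 1/2 * ell t * mean_stat D x (t, 1)"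
    and "gram D x t = (ell t * mean_stat D x (t, 2), ell t * mean_stat D x (t, 3), ell t * mean_stat D x (t, 4))"
proof -
  show "mu D x t (Inl n) = 1/2 * ell t * mean_stat D x (t, 0)" "mu D x t (Inr n) = 1/2 * ell t * mean_stat D x (t, 1)"
    unfolding mean_stat_eq[OF t] by (simp_all add: mu_def stat_def)
  have e: "sqrt (ell t / D) * sqrt (ell t / D) = ell t / D" using ell[OF t] by simp
  have m: "(sqrt (ell t / D) * a) * (sqrt (ell t / D) * b) = ell t * (a * b / D)" for a b
  proof -
    have "(sqrt (ell t / D) * a) * (sqrt (ell t / D) * b) = (sqrt (ell t / D) * sqrt (ell t / D)) * (a * b)" by (simp only: mult_ac)
    then show ?thesis unfolding e by simp
  qed
  show "gram D x t = (ell t * mean_stat D x (t, 2), ell t * mean_stat D x (t, 3), ell t * mean_stat D x (t, 4))"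
    unfolding gram_def mean_stat_eq[OF t] alpha_def beta_def power2_eq_square m
    by (simp add: stat_def sum_divide_distrib sum_distrib_left power2_eq_square Let_def del: real_sqrt_mult_self)
qed

end

text \<open>Selection probabilities are unchanged when all weights are divided by that of particle
  0. As its ancestor is 0, its weight is that of the current state, so only sums of differences of
  \<open>wbar\<close> remain.\<close>

lemma csmc_eq_scheme:
  assumes T: "1 \<le> T" and pot: "\<And>t y. t \<in> {1..T} \<Longrightarrow> 0 < pot M t y" and dens: "\<And>t x y. t \<in> {1..T} \<Longrightarrow> 0 < mdens M t x y"
  shows "csmc_indices_pmf bs fm T N D M Z = scheme_pmf bs fm T N
    (\<lambda>t a l. \<Sum>d=1..D. wbar T M t (Z (t - 1) a d) (Z t l d) - wbar T M t (Z (t - 1) 0 d) (Z t 0 d))"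
proof -
  define S where "S t a l = (\<Sum>d=1..D. wbar T M t (Z (t - 1) a d) (Z t l d))" for t a l
  define Q where "Q t l k = (\<Sum>d=1..D. ln (mdens M (t + 1) (Z t l d) (Z (t + 1) k d)))" for t l k
  have pw: "particle_weight D M Z t a l = exp (S t (a l) l)" if t: "t \<in> {1..T}" for t a l
  proof -
    have "exp (wbar T M t x y) = mdens M t x y * pot M t y" for x y
      using pot[OF t] dens[OF t] t by (simp add: wbar_def exp_add)
    then show ?thesis
      by (simp add: particle_weight_def mdens_D_def pot_D_def S_def exp_sum prod.distrib)
  qed
  have md: "mdens_D D M (t + 1) (Z t l) (Z (t + 1) k) = exp (Q t l k)" if "t \<in> {1..T - 1}" for t l k
  proof -
    have "t + 1 \<in> {1..T}" using that T by auto
    from dens[OF this] show ?thesis by (simp add: mdens_D_def Q_def exp_sum)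
  qed
  \<comment> \<open>The potential at time \<open>t + 1\<close> depends on particle \<open>k\<close>
    alone and cancels, which leaves the transition densities of the backward weights. The case
    \<open>wbar = 0\<close> at time \<open>T + 1\<close> is not reached.\<close>
  have SQ: "S (t + 1) l k - S (t + 1) 0 k = Q t l k - Q t 0 k" if "t \<in> {1..T - 1}" for t l k
  proof -
    have "t \<noteq> T" using that T by auto
    then show ?thesis by (simp add: S_def Q_def wbar_def sum.distrib)
  qed
  have \<delta>: "(\<Sum>d=1..D. wbar T M t (Z (t - 1) a d) (Z t l d) - wbar T M t (Z (t - 1) 0 d) (Z t 0 d)) = S t a l - S t 0 0" for t a l
    by (simp add: S_def sum_subtractf)
  show ?thesis unfolding csmc_indices_pmf_def scheme_pmf_def \<delta>
  proof (rule indices_pmf_cong)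
    fix t :: nat and a :: "nat \<Rightarrow> nat" assume t: "t \<in> {1..T - 1}" and a: "a 0 = 0"
    then have t': "t \<in> {1..T}" by auto
    show "categorical_pmf N (particle_weight D M Z t a) = index_pmf N (Psi N (\<lambda>m. S t (a m) m - S t 0 0))"
      by (subst categorical_eq_Psi) (simp_all add: pw[OF t'] a)
    fix k
    have "categorical_pmf N (\<lambda>l. particle_weight D M Z t a l * mdens_D D M (t + 1) (Z t l) (Z (t + 1) k))
       = index_pmf N (Psi N (\<lambda>m. (S t (a m) m + Q t m k) - (S t (a 0) 0 + Q t 0 k)))"
      unfolding pw[OF t'] md[OF t] exp_add[symmetric] by (subst categorical_eq_Psi) simp_all
    also have "(\<lambda>m. (S t (a m) m + Q t m k) - (S t (a 0) 0 + Q t 0 k))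
       = (\<lambda>m. S t (a m) m - S t 0 0 + (S (t + 1) m k - S (t + 1) 0 0) - (S (t + 1) 0 k - S (t + 1) 0 0))"
      using SQ[OF t] a by (simp add: fun_eq_iff algebra_simps)
    finally show "categorical_pmf N (\<lambda>l. particle_weight D M Z t a l * mdens_D D M (t + 1) (Z t l) (Z (t + 1) k))
      = index_pmf N (Psi N (\<lambda>m. S t (a m) m - S t 0 0 + (S (t + 1) m k - S (t + 1) 0 0) - (S (t + 1) 0 k - S (t + 1) 0 0)))" .
  next
    fix a :: "nat \<Rightarrow> nat" assume "a 0 = 0"
    then show "final_pmf fm N (\<lambda>l. ln (particle_weight D M Z T a l) - ln (particle_weight D M Z T a 0))
       = final_pmf fm N (\<lambda>m. S T (a m) m - S T 0 0)"
      using T by (simp add: pw)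
  qed
qed

context csmc_weights
begin

lemma lim_delta_linear_measurable:
  assumes "t \<in> {1..T}" "a \<le> N" "l \<le> N"
  shows "(\<lambda>u. lim_delta (linear_vw D x u) t a l) \<in> borel_measurable (noise_law T N D)"
  by (rule lim_delta_measurable[where T=T and N=N])
    (use assms in \<open>auto simp: linear_vw_def intro!: borel_measurable_add borel_measurable_const noise_lin_measurable\<close>)

text \<open>Three comparisons: with the linearised log-weights (the remainder), with two-dimensional
  noise (no error), and with the limiting parameters (the coupling).\<close>

lemma expectation_distance:
  assumes D: "1 \<le> D" and AK: "(A, K) \<in> index_range T N" and \<eta>: "0 \<le> \<eta>"
    and \<mu>: "\<And>t i. t \<in> {1..T} \<Longrightarrow> \<bar>mu D x t i - \<mu> t i\<bar> \<le> \<eta>"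
    and s: "\<And>t. t \<in> {1..T} \<Longrightarrow> \<bar>sqrt11 (gram D x t) - sqrt11 (p t)\<bar> \<le> \<eta>"
      "\<And>t. t \<in> {1..T} \<Longrightarrow> \<bar>sqrt12 (gram D x t) - sqrt12 (p t)\<bar> \<le> \<eta>"
      "\<And>t. t \<in> {1..T} \<Longrightarrow> \<bar>sqrt22 (gram D x t) - sqrt22 (p t)\<bar> \<le> \<eta>"
  shows "\<bar>(\<integral>u. pmf (scheme_pmf bs fm T N (delta D x u)) (A, K) \<partial>noise_law T N D)
     - (\<integral>u. pmf (scheme_pmf bs fm T N (lim_delta (\<lambda>t i. \<mu> t i + noise_lin 2 (root_alpha p) (root_beta p) u t i))) (A, K) \<partial>noise_law T N 2)\<bar>
    \<le> scheme_const T N * (real T * (real N + 1)\<^sup>2 * (remainder_const / sqrt D))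
      + scheme_const T N * (real T * (real N + 1)\<^sup>2 * (10 * \<eta>))"
proof -
  have 1: "\<bar>(\<integral>u. pmf (scheme_pmf bs fm T N (delta D x u)) (A, K) \<partial>noise_law T N D)
     - (\<integral>u. pmf (scheme_pmf bs fm T N (lim_delta (linear_vw D x u))) (A, K) \<partial>noise_law T N D)\<bar>
    \<le> scheme_const T N * (real T * (real N + 1)\<^sup>2 * (remainder_const / sqrt D))"
  proof (rule scheme_expectation_diff[OF T prob_space_noise_law AK, where b="remainder_bound D x"])
    fix u t a l assume "t \<in> {1..T}"
    then show "\<bar>delta D x u t a l - lim_delta (linear_vw D x u) t a l\<bar> \<le> remainder_bound D x u t a l"
      unfolding lim_delta_def by (rule delta_linear_diff[OF _ D])
  qed (auto intro!: delta_measurable lim_delta_linear_measurable remainder_bound_integral D)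
  have 2: "(\<integral>u. pmf (scheme_pmf bs fm T N (lim_delta (linear_vw D x u))) (A, K) \<partial>noise_law T N D)
    = (\<integral>u. pmf (scheme_pmf bs fm T N (lim_delta (\<lambda>t i. mu D x t i + noise_lin 2 (root_alpha (gram D x)) (root_beta (gram D x)) u t i))) (A, K) \<partial>noise_law T N 2)"
    unfolding linear_vw_def[abs_def]
    by (rule limit_expectation_noise[OF T AK _ gram_psd]) (simp add: gram_def)
  note 3 = root_expectation_diff[OF T AK \<eta>, of "mu D x" \<mu> "gram D x" p bs fm, OF \<mu> s]
  show ?thesis using 1 3 unfolding 2 by linarith
qed

text \<open>The 3 counts the Gram entries, as the product metric is bounded by the sum of coordinate
  distances; the drifts share this cruder bound.\<close>

lemma parameter_distance:
  assumes D: "1 \<le> D" and t: "t \<in> {1..T}"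
    and m: "\<And>k. k \<le> 4 \<Longrightarrow> \<bar>mean_stat D x (t, k) - m (t, k)\<bar> \<le> r"
  shows "\<bar>mu D x t (Inl n) - 1/2 * ell t * m (t, 0)\<bar> \<le> 3 * Lam * r"
    and "\<bar>mu D x t (Inr n) - 1/2 * ell t * m (t, 1)\<bar> \<le> 3 * Lam * r"
    and "dist (gram D x t) (ell t * m (t, 2), ell t * m (t, 3), ell t * m (t, 4)) \<le> 3 * Lam * r"
proof -
  have r0: "0 \<le> r" using m[of 0] abs_ge_zero[of "mean_stat D x (t, 0) - m (t, 0)"] by linarith
  have l: "0 < ell t" "ell t \<le> Lam" "1 \<le> Lam" using ell Lam t by auto
  have e: "\<bar>ell t * mean_stat D x (t, k) - ell t * m (t, k)\<bar> \<le> Lam * r" if "k \<le> 4" for k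
  proof -
    have "\<bar>ell t * mean_stat D x (t, k) - ell t * m (t, k)\<bar> = ell t * \<bar>mean_stat D x (t, k) - m (t, k)\<bar>"
      using l by (simp add: abs_mult flip: right_diff_distrib)
    also have "\<dots> \<le> Lam * r" using l by (intro mult_mono m that) auto
    finally show ?thesis .
  qed
  have h: "\<bar>1/2 * ell t * mean_stat D x (t, k) - 1/2 * ell t * m (t, k)\<bar> \<le> 3 * Lam * r" if "k \<le> 4" for k
  proof -
    have "\<bar>1/2 * a - 1/2 * b\<bar> \<le> \<bar>a - b\<bar>" for a b :: real by linarith
    from this[of "ell t * mean_stat D x (t, k)" "ell t * m (t, k)"] e[OF that]
    have "\<bar>1/2 * ell t * mean_stat D x (t, k) - 1/2 * ell t * m (t, k)\<bar> \<le> Lam * r" by (simp only: mult.assoc)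
    also have "\<dots> \<le> 3 * Lam * r" using l r0 by (simp add: mult_right_mono)
    finally show ?thesis .
  qed
  show "\<bar>mu D x t (Inl n) - 1/2 * ell t * m (t, 0)\<bar> \<le> 3 * Lam * r"
    "\<bar>mu D x t (Inr n) - 1/2 * ell t * m (t, 1)\<bar> \<le> 3 * Lam * r"
    unfolding mu_gram_mean_stat[OF t] using h[of 0] h[of 1] by simp_all
  have pair: "dist (a, b) (a', b') \<le> dist a a' + dist b b'" for a a' :: "'x::metric_space" and b b' :: "'y::metric_space"
    by (simp add: dist_Pair_Pair sqrt_sum_squares_le_sum)
  have "dist (gram D x t) (ell t * m (t, 2), ell t * m (t, 3), ell t * m (t, 4))
    \<le> dist (ell t * mean_stat D x (t, 2)) (ell t * m (t, 2)) + (dist (ell t * mean_stat D x (t, 3)) (ell t * m (t, 3))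
       + dist (ell t * mean_stat D x (t, 4)) (ell t * m (t, 4)))"
    unfolding mu_gram_mean_stat[OF t] by (rule order_trans[OF pair add_left_mono[OF pair]])
  also have "\<dots> \<le> Lam * r + (Lam * r + Lam * r)"
    unfolding dist_real_def by (intro add_mono e) auto
  also have "\<dots> = 3 * Lam * r" by simp
  finally show "dist (gram D x t) (ell t * m (t, 2), ell t * m (t, 3), ell t * m (t, 4)) \<le> 3 * Lam * r" .
qed

end

section \<open>From the hypotheses on the model to the locale, and the limit theorem\<close>

lemma smooth_constant:
  assumes "finite S" "\<And>t. t \<in> S \<Longrightarrow> lipschitz_bounded (f t)"
  shows "\<exists>L\<ge>0. \<forall>t\<in>S. lip2 L (f t)"
proof -
  have "\<forall>t\<in>S. \<exists>L. 0 \<le> L \<and> lip2 L (f t)" using lipschitz_bounded_lip2 assms(2) by blast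
  then obtain L where L: "\<And>t. t \<in> S \<Longrightarrow> 0 \<le> L t" "\<And>t. t \<in> S \<Longrightarrow> lip2 (L t) (f t)" by metis
  have "L t \<le> (\<Sum>t\<in>S. L t)" if "t \<in> S" for t using L(1) assms(1) that by (intro member_le_sum) auto
  then have "\<forall>t\<in>S. lip2 (\<Sum>t\<in>S. L t) (f t)" using L(2) lip2_mono by blast
  moreover have "0 \<le> (\<Sum>t\<in>S. L t)" using L(1) by (rule sum_nonneg)
  ultimately show ?thesis by blast
qed

lemma lipschitz_bounded_zero: "lipschitz_bounded (\<lambda>_ _. 0)"
proof -
  have "0-lipschitz_on UNIV (\<lambda>_ :: real \<times> real. 0 :: real)" by (rule lipschitz_onI) auto
  moreover have "(\<lambda>(x, y). 0) = (\<lambda>_ :: real \<times> real. 0 :: real)" by auto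
  ultimately show ?thesis unfolding lipschitz_bounded_def by auto
qed

lemma wbar_1: "1 \<le> T \<Longrightarrow> wbar T M 1 = (\<lambda>x y. wbar T M 1 0 y)"
  by (auto simp: wbar_def mdens_def fun_eq_iff)

lemma wbar_last: "wbar T M (T + 1) = (\<lambda>_ _. 0)"
  by (simp add: wbar_def fun_eq_iff)

text \<open>Derivatives in the first argument are assumed regular at \<open>t + 1\<close> for
  \<open>t\<close> in \<open>{1..T}\<close>, that is at times 2 to \<open>T + 1\<close>; at time 1
  they vanish. In the second argument the additional time is \<open>T + 1\<close>, where
  \<open>wbar\<close> is 0.\<close>

lemma csmc_weights_wbar:
  fixes M :: csmc_model
  assumes "T \<ge> 1" and "\<forall>t\<in>{1..T}. ell t > 0"
    and "\<forall>t\<in>{1..T}. (\<forall>x y. mdens M t x y > 0) \<and> twice_cont_diff (\<lambda>(x, y). wbar T M t x y)"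
    and lb: "\<forall>t\<in>{1..T}. lipschitz_bounded (partial2 (partial2 (wbar T M t)))
                   \<and> lipschitz_bounded (partial1 (partial1 (wbar T M (t + 1))))
                   \<and> lipschitz_bounded (partial1 (partial2 (wbar T M (t + 1))))"
  shows "\<exists>L. csmc_weights T ell (wbar T M) L"
proof -
  let ?S = "{1..T + 1}"
  have p1: "partial1 (wbar T M 1) = (\<lambda>_ _. 0)" by (subst wbar_1[OF assms(1)]) simp
  have p12: "partial1 (partial2 (wbar T M 1)) = (\<lambda>_ _. 0)"
  proof -
    have "partial2 (wbar T M 1) = (\<lambda>x y. partial2 (wbar T M 1) 0 y)"
      unfolding partial2_def by (subst (1 2) wbar_1[OF assms(1)]) simp
    then show ?thesis by (metis partial1_const)
  qed
  have lb1: "lipschitz_bounded (partial1 (partial1 (wbar T M t)))" "lipschitz_bounded (partial1 (partial2 (wbar T M t)))"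
    if t: "t \<in> ?S" for t
  proof -
    consider "t = 1" | "t - 1 \<in> {1..T}" "t = (t - 1) + 1" using t by force
    then have "lipschitz_bounded (partial1 (partial1 (wbar T M t))) \<and> lipschitz_bounded (partial1 (partial2 (wbar T M t)))"
    proof cases
      case 1
      then show ?thesis using p1 p12 lipschitz_bounded_zero by simp
    next
      case 2
      then show ?thesis using lb by metis
    qed
    then show "lipschitz_bounded (partial1 (partial1 (wbar T M t)))" "lipschitz_bounded (partial1 (partial2 (wbar T M t)))" by auto
  qed
  have lb2: "lipschitz_bounded (partial2 (partial2 (wbar T M t)))" if "t \<in> ?S" for t
  proof (cases "t = T + 1")
    case True
    show ?thesis unfolding True wbar_last by (simp add: lipschitz_bounded_zero)
  qed (use lb that in auto)
  have fin: "finite ?S" by simp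
  obtain L1 where L1: "0 \<le> L1" "\<forall>t\<in>?S. lip2 L1 (partial1 (partial1 (wbar T M t)))"
    using smooth_constant[of ?S "\<lambda>t. partial1 (partial1 (wbar T M t))", OF fin lb1(1)] by blast
  obtain L2 where L2: "0 \<le> L2" "\<forall>t\<in>?S. lip2 L2 (partial1 (partial2 (wbar T M t)))"
    using smooth_constant[of ?S "\<lambda>t. partial1 (partial2 (wbar T M t))", OF fin lb1(2)] by blast
  obtain L3 where L3: "0 \<le> L3" "\<forall>t\<in>?S. lip2 L3 (partial2 (partial2 (wbar T M t)))"
    using smooth_constant[of ?S "\<lambda>t. partial2 (partial2 (wbar T M t))", OF fin lb2] by blast
  have "csmc_weights T ell (wbar T M) (L1 + L2 + L3)"
  proof
    show "twice_cont_diff (\<lambda>(x, y). wbar T M t x y)" if "t \<in> ?S" for t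
    proof (cases "t = T + 1")
      case True
      have "(\<lambda>(x, y). wbar T M t x y) = (\<lambda>_. 0)" unfolding True wbar_last by auto
      then show ?thesis by (simp add: twice_cont_diff_zero)
    qed (use assms(3) that in auto)
    show "lip2 (L1 + L2 + L3) (partial1 (partial1 (wbar T M t)))" "lip2 (L1 + L2 + L3) (partial1 (partial2 (wbar T M t)))"
      "lip2 (L1 + L2 + L3) (partial2 (partial2 (wbar T M t)))" if "t \<in> ?S" for t
      using lip2_mono[OF bspec[OF L1(2) that], of "L1 + L2 + L3"] lip2_mono[OF bspec[OF L2(2) that], of "L1 + L2 + L3"]
        lip2_mono[OF bspec[OF L3(2) that], of "L1 + L2 + L3"] L1(1) L2(1) L3(1) by simp_all
    show "wbar T M 1 x y = wbar T M 1 x' y" for x x' y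
      by (simp add: wbar_def mdens_def)
    show "wbar T M (T + 1) x y = 0" for x y unfolding wbar_last ..
  qed (use assms(1,2) L1(1) L2(1) L3(1) in auto)
  then show ?thesis by blast
qed

theorem proposition4p5:
  fixes T N :: nat and ell :: "nat \<Rightarrow> real" and M :: csmc_model and bs fm :: bool
  assumes "T \<ge> 1" and "N \<ge> 1"
    and "\<forall>t\<in>{1..T}. ell t > 0"
    and "csmc_model_ok T M"
    and "prob_space (target T M)"
    and "\<forall>t\<in>{1..T}. (\<forall>x y. mdens M t x y > 0) \<and> twice_cont_diff (\<lambda>(x, y). wbar T M t x y)"
    and "\<forall>t\<in>{1..T}. lipschitz_bounded (partial2 (partial2 (wbar T M t)))
                   \<and> lipschitz_bounded (partial1 (partial1 (wbar T M (t + 1))))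
                   \<and> lipschitz_bounded (partial1 (partial2 (wbar T M (t + 1))))"
    and "\<forall>t\<in>{1..T}. integrable (target T M) (\<lambda>x. \<bar>partial2 (wbar T M t) (x (t - 1)) (x t)\<bar> ^ 4)
                   \<and> integrable (target T M) (\<lambda>x. \<bar>partial1 (wbar T M (t + 1)) (x t) (x (t + 1))\<bar> ^ 4)"
  shows "\<exists>F :: nat \<Rightarrow> (nat \<Rightarrow> nat \<Rightarrow> real) set.
           (\<forall>D\<ge>1. F D \<in> sets (\<Pi>\<^sub>M t\<in>{1..T}. \<Pi>\<^sub>M d\<in>{1..D}. borel)) \<and>
           (\<lambda>D. measure (target_D T D M) (F D)) \<longlonglongrightarrow> 1 \<and>
           (\<lambda>D. SUP x\<in>F D. tv_dist (irwcsmc_law bs fm T N D M ell x) (limit_law bs fm T N M ell))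
             \<longlonglongrightarrow> 0"
proof -
  have T: "1 \<le> T" by fact
  obtain L where "csmc_weights T ell (wbar T M) L"
    using csmc_weights_wbar[OF assms(1,3,6,7)] by blast
  then interpret csmc_weights T N ell "wbar T M" L .
  have pot: "0 < pot M t y" if "t \<in> {1..T}" for t y using assms(4) that by (simp add: csmc_model_ok_def)
  have dens: "0 < mdens M t x y" if "t \<in> {1..T}" for t x y using assms(6) that by blast
  let ?\<pi> = "target T M"
  have s\<pi>: "sets ?\<pi> = sets (lborel_on {1..T})" by (simp add: target_def)
  have pw: "path_weight T M x = exp (\<Sum>t=1..T. wbar T M t (x (t - 1)) (x t))" for x
  proof -
    have "exp (wbar T M t (x (t - 1)) (x t)) = mdens M t (x (t - 1)) (x t) * pot M t (x t)" if "t \<in> {1..T}" for t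
      using pot[OF that] dens[OF that] that by (simp add: wbar_def exp_add)
    then show ?thesis by (simp add: path_weight_def exp_sum)
  qed
  have "(\<lambda>x. wbar T M t (x (t - 1)) (x t)) \<in> borel_measurable (lborel_on {1..T})" if "t \<in> {1..T}" for t
    by (rule edge_fun_measurable[OF edge_fun_derivs(1)]) (use that in auto)
  then have pw_meas: "path_weight T M \<in> borel_measurable (lborel_on {1..T})"
    unfolding pw by (intro measurable_compose[OF _ borel_measurable_exp] borel_measurable_sum)
  have pw_pos: "0 \<le> path_weight T M x" for x unfolding pw by simp
  have sq: "integrable ?\<pi> (\<lambda>x. (stat i x)\<^sup>2)" if "i \<in> stat_index" for i
    by (rule stat_square_integrable[OF that assms(5) s\<pi>]) (use assms(8) in auto)
  define m where "m i = (\<integral>x. stat i x \<partial>?\<pi>)" for i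
  define F where "F D = {x \<in> space (\<Pi>\<^sub>M t\<in>{1..T}. \<Pi>\<^sub>M d\<in>{1..D}. borel). \<forall>i\<in>stat_index.
       \<bar>(\<Sum>d=1..D. stat i (\<lambda>t\<in>{1..T}. x t d)) / D - (\<integral>x. stat i x \<partial>?\<pi>)\<bar> < D powr (-1/4)}" for D :: nat
  note typical = typical_sets[OF pw_meas pw_pos assms(5) _ stat_measurable sq F_def]
  have F_sets: "F D \<in> sets (\<Pi>\<^sub>M t\<in>{1..T}. \<Pi>\<^sub>M d\<in>{1..D}. borel)" for D by (rule typical(1)) auto
  have F_lim: "(\<lambda>D. measure (target_D T D M) (F D)) \<longlonglongrightarrow> 1" by (rule typical(2)) auto
  have F_stat: "\<bar>mean_stat D x (t, k) - m (t, k)\<bar> \<le> D powr (-1/4)" if "x \<in> F D" "t \<in> {1..T}" "k \<le> 4" for x D t k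
    using that unfolding F_def mean_stat_def m_def by (auto intro!: less_imp_le)

  \<comment> \<open>The limiting 2 by 2 covariances. The zero matrix outside \<open>{1..T}\<close>
    keeps \<open>p t\<close> positive semidefinite at every \<open>t\<close>, as
    \<open>limit_expectation_VW\<close> demands.\<close>
  define p where "p t = (if t \<in> {1..T} then (ell t * m (t, 2), ell t * m (t, 3), ell t * m (t, 4)) else (0, 0, 0))" for t
  have p_psd: "p t \<in> psd2" for t
  proof (cases "t \<in> {1..T}")
    case True
    let ?f = "\<lambda>x. partial2 (wbar T M t) (x (t - 1)) (x t)" and ?g = "\<lambda>x. partial1 (wbar T M (t + 1)) (x t) (x (t + 1))"
    have st: "stat (t, 2) = (\<lambda>x. (?f x)\<^sup>2)" "stat (t, 3) = (\<lambda>x. ?f x * ?g x)" "stat (t, 4) = (\<lambda>x. (?g x)\<^sup>2)"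
      by (simp_all add: stat_def Let_def fun_eq_iff)
    have "integrable ?\<pi> (stat (t, k))" if "k \<le> 4" for k
      by (rule finite_measure.square_integrable_imp_integrable[OF prob_space.finite_measure[OF assms(5)] _ sq])
        (use True that stat_measurable[of "(t, k)"] in \<open>auto simp: measurable_cong_sets[OF s\<pi> refl]\<close>)
    \<comment> \<open>Positivity of the determinant of the limiting covariance is the Cauchy-Schwarz
      inequality for the two first derivatives under the target.\<close>
    from this[of 2] this[of 3] this[of 4]
    have "(m (t, 3))\<^sup>2 \<le> m (t, 2) * m (t, 4)"
      unfolding m_def st by (intro Cauchy_Schwarz_integral) auto
    moreover have "0 \<le> m (t, 2)" "0 \<le> m (t, 4)" unfolding m_def st by simp_all
    ultimately show ?thesis using True ell[OF True]
      by (simp add: p_def psd2_def power2_eq_square mult.assoc mult.left_commute mult_left_mono)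
  next
    case False
    then have "p t = (0, 0, 0)" unfolding p_def by (rule if_not_P)
    then show ?thesis by (simp add: psd2_def)
  qed
  have G: "gaussian_law ({1..N} <+> {1..N}) (VW_mean T M ell t) (VW_cov T M ell t)
    = gaussian_law ({1..N} <+> {1..N}) (VW_mean T M ell t) (block_cov (fst (p t)) (fst (snd (p t))) (snd (snd (p t))))"
    if "t \<in> {1..T}" for t
  proof -
    have "VW_cov T M ell t i j = block_cov (fst (p t)) (fst (snd (p t))) (snd (snd (p t))) i j" for i j
      using that by (simp add: VW_cov_def block_cov_def p_def m_def stat_def Let_def target_mean_def VW_cross_def
          power2_eq_square split: sum.split)
    then have "VW_cov T M ell t = block_cov (fst (p t)) (fst (snd (p t))) (snd (snd (p t)))" by (intro ext)
    then show ?thesis by simp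
  qed
  let ?G = "\<lambda>t. gaussian_law ({1..N} <+> {1..N}) (VW_mean T M ell t) (VW_cov T M ell t)"
  note VW_all = limit_expectation_VW[where G="?G" and \<mu>="VW_mean T M ell" and N=N, OF T p_psd]
  have VW: "prob_space (VW_law T N M ell)"
    unfolding VW_law_def by (rule VW_all(1)) (rule G)
  have VW_measurable: "(\<lambda>vw. pmf (limit_indices_pmf bs fm T N vw) (A, K)) \<in> borel_measurable (VW_law T N M ell)"
    if "(A, K) \<in> index_range T N" for A K
    unfolding VW_law_def by (rule VW_all(2)[OF _ that]) (rule G)
  have VW_expectation: "(\<integral>vw. pmf (limit_indices_pmf bs fm T N vw) (A, K) \<partial>VW_law T N M ell)
      = (\<integral>u. pmf (scheme_pmf bs fm T N (lim_delta (\<lambda>t i. VW_mean T M ell t i + noise_lin 2 (root_alpha p) (root_beta p) u t i))) (A, K) \<partial>noise_law T N 2)"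
    if "(A, K) \<in> index_range T N" for A K
    unfolding VW_law_def by (rule VW_all(3)[OF _ that]) (rule G)
  have mean: "VW_mean T M ell t (Inl n) = 1/2 * ell t * m (t, 0)" "VW_mean T M ell t (Inr n) = 1/2 * ell t * m (t, 1)" for t n
    by (simp_all add: VW_mean_def m_def stat_def target_mean_def)

  define \<Omega> where "\<Omega> = index_range T N"
  have \<Omega>: "finite \<Omega>" unfolding \<Omega>_def by (rule finite_index_range)
  define C where "C = scheme_const T N * (real T * (real N + 1)\<^sup>2)"
  have C0: "0 \<le> C" by (simp add: C_def scheme_const_nonneg)
  let ?tv = "\<lambda>D x. tv_dist (irwcsmc_law bs fm T N D M ell x) (limit_law bs fm T N M ell)"
  have csmc: "csmc_indices_pmf bs fm T N D M (particle D ell x u) = scheme_pmf bs fm T N (delta D x u)" for D x u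
    by (subst csmc_eq_scheme[OF T pot dens]) (simp_all add: delta_def[abs_def] particle_def)

  have tv: "0 \<le> ?tv D x \<and> ?tv D x \<le> card \<Omega> * (C * (remainder_const / sqrt D) + C * (10 * \<eta>))"
    if D: "1 \<le> D" and \<eta>: "0 \<le> \<eta>"
      and \<mu>: "\<And>t i. t \<in> {1..T} \<Longrightarrow> \<bar>mu D x t i - VW_mean T M ell t i\<bar> \<le> \<eta>"
      and s: "\<And>t. t \<in> {1..T} \<Longrightarrow> \<bar>sqrt11 (gram D x t) - sqrt11 (p t)\<bar> \<le> \<eta>"
        "\<And>t. t \<in> {1..T} \<Longrightarrow> \<bar>sqrt12 (gram D x t) - sqrt12 (p t)\<bar> \<le> \<eta>"
        "\<And>t. t \<in> {1..T} \<Longrightarrow> \<bar>sqrt22 (gram D x t) - sqrt22 (p t)\<bar> \<le> \<eta>" for D x \<eta>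
  proof -
    have le: "\<bar>(\<integral>u. pmf (csmc_indices_pmf bs fm T N D M (particle D ell x u)) \<omega> \<partial>noise_law T N D)
        - (\<integral>vw. pmf (limit_indices_pmf bs fm T N vw) \<omega> \<partial>VW_law T N M ell)\<bar>
      \<le> C * (remainder_const / sqrt D) + C * (10 * \<eta>)" if \<omega>: "\<omega> \<in> \<Omega>" for \<omega>
    proof -
      obtain A K where AK: "\<omega> = (A, K)" "(A, K) \<in> index_range T N" using \<omega> by (cases \<omega>) (auto simp: \<Omega>_def)
      show ?thesis
        using expectation_distance[OF D AK(2) \<eta> \<mu> s, of bs fm]
        unfolding csmc AK(1) VW_expectation[OF AK(2)] C_def by (simp only: mult.assoc)
    qed
    have "(\<lambda>u. pmf (csmc_indices_pmf bs fm T N D M (particle D ell x u)) \<omega>) \<in> borel_measurable (noise_law T N D)"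
      if "\<omega> \<in> \<Omega>" for \<omega>
      unfolding csmc using that T
      by (cases \<omega>) (auto simp: \<Omega>_def intro!: scheme_pmf_measurable delta_measurable)
    moreover have "(\<lambda>vw. pmf (limit_indices_pmf bs fm T N vw) \<omega>) \<in> borel_measurable (VW_law T N M ell)"
      if "\<omega> \<in> \<Omega>" for \<omega>
      using that VW_measurable by (cases \<omega>) (simp add: \<Omega>_def)
    moreover have "set_pmf (csmc_indices_pmf bs fm T N D M (particle D ell x u)) \<subseteq> \<Omega>"
      "set_pmf (limit_indices_pmf bs fm T N vw) \<subseteq> \<Omega>" for u vw
      unfolding csmc limit_pmf_eq \<Omega>_def by (rule set_scheme_pmf[OF T])+
    ultimately show ?thesis
      unfolding irwcsmc_law_def limit_law_def
      using tv_dist_le_sum[OF \<Omega> prob_space_noise_law _ _ VW _ _ le] by blast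
  qed

  have conv: "\<forall>\<^sub>F D in sequentially. \<forall>x\<in>F D. 0 \<le> ?tv D x \<and> ?tv D x \<le> \<epsilon>" if \<epsilon>: "0 < \<epsilon>" for \<epsilon>
  proof -
    define \<kappa> where "\<kappa> = card \<Omega> * C"
    have \<kappa>: "0 \<le> \<kappa>" using C0 by (simp add: \<kappa>_def)
    \<comment> \<open>Chosen so that the coupling error \<open>\<kappa> * (10 * \<eta>)\<close>
      takes at most half of \<epsilon>; the summand 1 covers \<open>\<kappa> = 0\<close>. The other
      half is left to the Taylor remainder.\<close>
    define \<eta> where "\<eta> = \<epsilon> / (20 * (\<kappa> + 1))"
    have \<eta>: "0 < \<eta>" using \<epsilon> \<kappa> by (simp add: \<eta>_def)
    have \<kappa>\<eta>: "\<kappa> * (10 * \<eta>) \<le> \<epsilon> / 2" using \<kappa> \<epsilon> by (simp add: \<eta>_def field_simps)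
    \<comment> \<open>The tolerance of the good sets times the constant of
      \<open>parameter_distance\<close>. Only \<open>r\<close> tending to 0 is used, since the roots
      are merely continuous at \<open>p t\<close>.\<close>
    define r where "r D = 3 * Lam * real D powr (-1/4)" for D
    have "(\<lambda>D. real D powr (-1/4)) \<longlonglongrightarrow> 0"
      by (rule tendsto_neg_powr) (auto intro: filterlim_real_sequentially)
    from tendsto_mult_right_zero[OF this, of "3 * Lam"] have r: "r \<longlonglongrightarrow> 0" unfolding r_def .
    have "(\<lambda>D. \<kappa> * (remainder_const / sqrt D)) \<longlonglongrightarrow> \<kappa> * 0"
      by (intro tendsto_mult tendsto_const tendsto_divide_0[OF tendsto_const]
          filterlim_at_top_imp_at_infinity filterlim_compose[OF sqrt_at_top filterlim_real_sequentially])
    then have "\<forall>\<^sub>F D in sequentially. \<kappa> * (remainder_const / sqrt D) < \<epsilon> / 2"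
      using \<epsilon> by (intro order_tendstoD) auto
    moreover have "\<forall>\<^sub>F D in sequentially. r D < \<eta>" using r \<eta> by (rule order_tendstoD)
    moreover have "\<forall>\<^sub>F D in sequentially. \<forall>t\<in>{1..T}. \<forall>q\<in>psd2. dist q (p t) \<le> r D \<longrightarrow> \<bar>f q - f (p t)\<bar> \<le> \<eta>"
      if "continuous_on psd2 f" for f :: "real \<times> real \<times> real \<Rightarrow> real"
      using continuous_on_eventually_close[OF that p_psd r \<eta>] by (intro eventually_ball_finite) auto
    note this[OF continuous_on_psd_sqrt(1)] this[OF continuous_on_psd_sqrt(2)] this[OF continuous_on_psd_sqrt(3)]
    moreover have "\<forall>\<^sub>F D in sequentially. (1 :: nat) \<le> D" by (rule eventually_ge_at_top)
    ultimately show ?thesis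
    proof eventually_elim
      case (elim D)
      show ?case
      proof
        fix x assume x: "x \<in> F D"
        have par: "\<bar>mu D x t i - VW_mean T M ell t i\<bar> \<le> \<eta>" "dist (gram D x t) (p t) \<le> r D" if t: "t \<in> {1..T}" for t i
        proof -
          note pd = parameter_distance[OF elim(6) t F_stat[OF x t], folded r_def]
          show "\<bar>mu D x t i - VW_mean T M ell t i\<bar> \<le> \<eta>"
            using pd(1,2) elim(2) by (cases i) (auto simp: mean intro: order_trans[OF _ less_imp_le])
          show "dist (gram D x t) (p t) \<le> r D" using pd(3) t by (simp add: p_def)
        qed
        have "0 \<le> ?tv D x \<and> ?tv D x \<le> card \<Omega> * (C * (remainder_const / sqrt D) + C * (10 * \<eta>))"
          by (rule tv) (use elim par gram_psd \<eta> in \<open>auto intro: less_imp_le\<close>)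
        moreover have "card \<Omega> * (C * (remainder_const / sqrt D) + C * (10 * \<eta>)) = \<kappa> * (remainder_const / sqrt D) + \<kappa> * (10 * \<eta>)"
          by (simp add: \<kappa>_def distrib_left mult.assoc)
        ultimately show "0 \<le> ?tv D x \<and> ?tv D x \<le> \<epsilon>" using elim(1) \<kappa>\<eta> by linarith
      qed
    qed
  qed

  \<comment> \<open>The real supremum over an empty set is unspecified. Sets of positive measure are
    nonempty, and this holds for all large \<open>D\<close>.\<close>
  have "\<forall>\<^sub>F D in sequentially. 0 < measure (target_D T D M) (F D)"
    by (rule order_tendstoD[OF F_lim]) simp
  then have nonempty: "\<forall>\<^sub>F D in sequentially. F D \<noteq> {}"
    by eventually_elim auto
  have "(\<lambda>D. SUP x\<in>F D. ?tv D x) \<longlonglongrightarrow> 0"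
  proof (rule tendstoI)
    fix e :: real assume "0 < e"
    \<comment> \<open>Half of \<open>e\<close>, because a supremum of values below \<open>e\<close>
      need not itself be below \<open>e\<close>.\<close>
    then have "\<forall>\<^sub>F D in sequentially. \<forall>x\<in>F D. 0 \<le> ?tv D x \<and> ?tv D x \<le> e / 2" by (intro conv) simp
    with nonempty show "\<forall>\<^sub>F D in sequentially. dist (SUP x\<in>F D. ?tv D x) 0 < e"
    proof eventually_elim
      case (elim D)
      then obtain x where x: "x \<in> F D" by blast
      have "(SUP x\<in>F D. ?tv D x) \<le> e / 2" using elim by (intro cSUP_least) auto
      moreover have "?tv D x \<le> (SUP x\<in>F D. ?tv D x)"
        using elim by (intro cSUP_upper x bdd_aboveI2[where M="e / 2"]) auto
      moreover have "0 \<le> ?tv D x" using elim x by blast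
      ultimately show ?case using \<open>0 < e\<close> by (simp add: dist_real_def)
    qed
  qed
  then show ?thesis using F_sets F_lim by (intro exI[of _ F]) auto
qed

end
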